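(* Let $B\subset A$ be an inclusion of simple unital $C^*$-algebras with a conditional expectation of index-finite type. Define linear maps $\Delta:B'\cap A_1\to(B'\cap A_1)\otimes(B'\cap A_1)$ and $\varepsilon:B'\cap A_1\to\mathbb C$ by $$\langle\Delta(x),y\otimes z\rangle=\tau^{1/2}\langle x,y\star z\rangle,\qquad \varepsilon(x)=\tau^{-1}\langle e_1,x\rangle,\qquad x,y,z\in B'\cap A_1.$$ Then $(B'\cap A_1,\Delta,\varepsilon)$ is a coalgebra.
   Context: Setting: $B\subset A$ is a unital inclusion of simple unital $C^*$-algebras with a conditional expectation of index-finite type (i.e. one admitting a finite quasi-basis). $E_0:A\to B$ is the unique minimal conditional expectation, with quasi-basis $\{\lambda_i\}_{i=1}^n\subset A$, i.e. $x=\sum_i\lambda_iE_0(\lambda_i^*x)$ for all $x\in A$; $[A:B]_0=\sum_i\lambda_i\lambda_i^*$ is its (scalar) Watatani index and $\tau=[A:B]_0^{-1}$. Put $A_{-1}=B$, $A_0=A$. $B\subset A\subset A_1\subset A_2\subset\cdots$ is the tower of Watatani's $C^*$-basic constructions: $A_n$ is generated by $A_{n-1}$ and the Jones projection $e_n$, with $e_nxe_n=E_{n-1}(x)e_n$ for $x\in A_{n-1}$ and $e_n$ commuting with $A_{n-2}$; $E_n:A_n\to A_{n-1}$ is the dual (minimal) conditional expectation, with $E_n(xe_ny)=\tau xy$ for $x,y\in A_{n-1}$. $C'\cap D$ denotes the relative commutant; $B'\cap A_n$, $A'\cap A_n$ are finite-dimensional $C^*$-algebras. $\operatorname{tr}=E_0\circ\cdots\circ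 E_n$ restricted to $B'\cap A_n$ is a faithful tracial state, compatible with inclusions. $\langle x,y\rangle=\operatorname{tr}(x^*y)$ and $\langle a\otimes b,c\otimes d\rangle=\langle a,c\rangle\langle b,d\rangle$. Fourier transform and convolution: $\mathcal F_1:B'\cap A_1\to A'\cap A_2$, $\mathcal F_1(x)=\tau^{-3/2}E^{B'\cap A_2}_{A'\cap A_2}(xe_2e_1)$, where $E^{B'\cap A_2}_{A'\cap A_2}(x)=\tau\sum_i\lambda_ix\lambda_i^*$ is the trace-preserving conditional expectation of $B'\cap A_2$ onto $A'\cap A_2$; it is bijective with inverse $\mathcal F_1^{-1}(w)=\tau^{-3/2}E_2(we_1e_2)$. $x\star y=\mathcal F_1^{-1}(\mathcal F_1(y)\mathcal F_1(x))$. Coalgebra means: $\Delta$ is coassociative, $(\Delta\otimes\mathrm{id})\Delta=(\mathrm{id}\otimes\Delta)\Delta$, and $\varepsilon$ is a counit, $(\varepsilon\otimes\mathrm{id})\Delta=(\mathrm{id}\otimes\varepsilon)\Delta=\mathrm{id}$. *)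

theory Defs
  imports "HOL-Analysis.Analysis" "HOL-Library.Function_Algebras"
begin

section \<open>Complex vector spaces and their tensor products\<close>

class complex_vector = ab_group_add +
  fixes scaleC :: "complex \<Rightarrow> 'a \<Rightarrow> 'a"  (infixr "*\<^sub>C" 75)
  assumes scaleC_add_right: "c *\<^sub>C (x + y) = c *\<^sub>C x + c *\<^sub>C y"
    and scaleC_add_left: "(c + d) *\<^sub>C x = c *\<^sub>C x + d *\<^sub>C x"
    and scaleC_scaleC: "c *\<^sub>C (d *\<^sub>C x) = (c * d) *\<^sub>C x"
    and scaleC_one: "1 *\<^sub>C x = x"

instantiation complex :: complex_vector
begin

definition scaleC_complex :: "complex \<Rightarrow> complex \<Rightarrow> complex" where
  "scaleC_complex c z = c * z"

instance
  by standard (simp_all add: scaleC_complex_def algebra_simps)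

end

instantiation "fun" :: (type, complex_vector) complex_vector
begin

definition scaleC_fun :: "complex \<Rightarrow> ('a \<Rightarrow> 'b) \<Rightarrow> 'a \<Rightarrow> 'b" where
  "scaleC_fun c f = (\<lambda>x. c *\<^sub>C f x)"

instance
  by standard
    (simp_all add: scaleC_fun_def fun_eq_iff scaleC_add_right scaleC_add_left
      scaleC_scaleC scaleC_one)

end

global_interpretation complex_vector: vector_space "scaleC :: complex \<Rightarrow> 'a \<Rightarrow> 'a::complex_vector"
  by standard (simp_all add: scaleC_add_right scaleC_add_left scaleC_scaleC scaleC_one)

definition linear_on :: "'a::complex_vector set \<Rightarrow> ('a \<Rightarrow> 'b::complex_vector) \<Rightarrow> bool" where
  "linear_on V f \<longleftrightarrow>
     (\<forall>x\<in>V. \<forall>y\<in>V. f (x + y) = f x + f y) \<and> (\<forall>c. \<forall>x\<in>V. f (c *\<^sub>C x) = c *\<^sub>C f x)"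

definition bilinear_on ::
    "'a::complex_vector set \<Rightarrow> 'b::complex_vector set \<Rightarrow> ('a \<Rightarrow> 'b \<Rightarrow> 'c::complex_vector) \<Rightarrow> bool" where
  "bilinear_on V W b \<longleftrightarrow>
     (\<forall>w\<in>W. linear_on V (\<lambda>v. b v w)) \<and> (\<forall>v\<in>V. linear_on W (b v))"

text \<open>
  The algebraic tensor product of subspaces \<open>V\<close>, \<open>W\<close> is realised in the usual way as a space of
  linear functionals on the bilinear forms on \<open>V \<times> W\<close>: the elementary tensor of \<open>v\<close> and \<open>w\<close> is
  evaluation at \<open>(v, w)\<close>, and the tensor product is the linear span of these. As bilinear forms
  separate the elements of an algebraic tensor product over a field, this is the algebraic tensor
  product.
\<close>

type_synonym ('a, 'b) tensor = "('a \<Rightarrow> 'b \<Rightarrow> complex) \<Rightarrow> complex"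

definition tens ::
    "'a::complex_vector set \<Rightarrow> 'b::complex_vector set \<Rightarrow> 'a \<Rightarrow> 'b \<Rightarrow> ('a, 'b) tensor" where
  "tens V W v w = (\<lambda>\<beta>. if bilinear_on V W \<beta> then \<beta> v w else 0)"

definition tensor_space ::
    "'a::complex_vector set \<Rightarrow> 'b::complex_vector set \<Rightarrow> ('a, 'b) tensor set" where
  "tensor_space V W = complex_vector.span {tens V W v w | v w. v \<in> V \<and> w \<in> W}"

text \<open>
  The linear map on \<open>tensor_space V W\<close> induced by a bilinear map \<open>b\<close> on \<open>V \<times> W\<close>
  (the universal property).
\<close>

definition tensor_lift ::
    "'a::complex_vector set \<Rightarrow> 'b::complex_vector set \<Rightarrow> ('a \<Rightarrow> 'b \<Rightarrow> 'c::complex_vector) \<Rightarrow>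
     ('a, 'b) tensor \<Rightarrow> 'c" where
  "tensor_lift V W b t = (THE y. \<exists>f. linear_on (tensor_space V W) f \<and>
      (\<forall>v\<in>V. \<forall>w\<in>W. f (tens V W v w) = b v w) \<and> f t = y)"

text \<open>The tensor product of linear maps \<open>f : V \<rightarrow> V'\<close> and \<open>g : W \<rightarrow> W'\<close>.\<close>

definition tensor_map ::
    "'a::complex_vector set \<Rightarrow> 'b::complex_vector set \<Rightarrow>
     'c::complex_vector set \<Rightarrow> 'd::complex_vector set \<Rightarrow>
     ('a \<Rightarrow> 'c) \<Rightarrow> ('b \<Rightarrow> 'd) \<Rightarrow> ('a, 'b) tensor \<Rightarrow> ('c, 'd) tensor" where
  "tensor_map V W V' W' f g = tensor_lift V W (\<lambda>v w. tens V' W' (f v) (g w))"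

text \<open>
  The canonical isomorphisms \<open>(U \<otimes> V) \<otimes> W \<rightarrow> U \<otimes> (V \<otimes> W)\<close>, \<open>\<complex> \<otimes> V \<rightarrow> V\<close> and \<open>V \<otimes> \<complex> \<rightarrow> V\<close>.
\<close>

definition tensor_assoc ::
    "'a::complex_vector set \<Rightarrow> 'b::complex_vector set \<Rightarrow> 'c::complex_vector set \<Rightarrow>
     (('a, 'b) tensor, 'c) tensor \<Rightarrow> ('a, ('b, 'c) tensor) tensor" where
  "tensor_assoc U V W = tensor_lift (tensor_space U V) W
     (\<lambda>s w. tensor_lift U V (\<lambda>u v. tens U (tensor_space V W) u (tens V W v w)) s)"

definition tensor_unit_left ::
    "'a::complex_vector set \<Rightarrow> (complex, 'a) tensor \<Rightarrow> 'a" where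
  "tensor_unit_left V = tensor_lift UNIV V (\<lambda>c v. c *\<^sub>C v)"

definition tensor_unit_right ::
    "'a::complex_vector set \<Rightarrow> ('a, complex) tensor \<Rightarrow> 'a" where
  "tensor_unit_right V = tensor_lift V UNIV (\<lambda>v c. c *\<^sub>C v)"

text \<open>
  The form on \<open>V \<otimes> V\<close>, conjugate-linear in the first argument and linear in the second, with
  \<open>\<langle>a \<otimes> b, c \<otimes> d\<rangle> = \<langle>a, c\<rangle> \<langle>b, d\<rangle>\<close>. The two conjugations make the inner lift, which is linear
  in \<open>s\<close>, conjugate-linear.
\<close>

definition tensor_inner ::
    "'a::complex_vector set \<Rightarrow> ('a \<Rightarrow> 'a \<Rightarrow> complex) \<Rightarrow>
     ('a, 'a) tensor \<Rightarrow> ('a, 'a) tensor \<Rightarrow> complex" where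
  "tensor_inner V ip s t =
     tensor_lift V V (\<lambda>c d. cnj (tensor_lift V V (\<lambda>a b. cnj (ip a c * ip b d)) s)) t"

definition coalgebra ::
    "'a::complex_vector set \<Rightarrow> ('a \<Rightarrow> ('a, 'a) tensor) \<Rightarrow> ('a \<Rightarrow> complex) \<Rightarrow> bool" where
  "coalgebra V \<Delta> \<epsilon> \<longleftrightarrow>
     complex_vector.subspace V \<and>
     linear_on V \<Delta> \<and> (\<forall>x\<in>V. \<Delta> x \<in> tensor_space V V) \<and>
     linear_on V \<epsilon> \<and>
     (\<forall>x\<in>V. tensor_assoc V V V (tensor_map V V (tensor_space V V) V \<Delta> id (\<Delta> x))
            = tensor_map V V V (tensor_space V V) id \<Delta> (\<Delta> x)) \<and>
     (\<forall>x\<in>V. tensor_unit_left V (tensor_map V V UNIV V \<epsilon> id (\<Delta> x)) = x) \<and>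
     (\<forall>x\<in>V. tensor_unit_right V (tensor_map V V V UNIV id \<epsilon> (\<Delta> x)) = x)"


section \<open>\<open>C\<^sup>*\<close>-algebras\<close>

text \<open>Unital (and, by \<open>norm 1 = 1\<close>, nonzero) \<open>C\<^sup>*\<close>-algebras.\<close>

class cstar_algebra = complex_vector + real_normed_algebra_1 + banach +
  fixes star :: "'a \<Rightarrow> 'a"
  assumes scaleR_scaleC: "r *\<^sub>R x = complex_of_real r *\<^sub>C x"
    and mult_scaleC_left: "(c *\<^sub>C x) * y = c *\<^sub>C (x * y)"
    and mult_scaleC_right: "x * (c *\<^sub>C y) = c *\<^sub>C (x * y)"
    and norm_scaleC: "norm (c *\<^sub>C x) = cmod c * norm x"
    and star_star: "star (star x) = x"
    and star_add: "star (x + y) = star x + star y"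
    and star_scaleC: "star (c *\<^sub>C x) = cnj c *\<^sub>C star x"
    and star_mult: "star (x * y) = star y * star x"
    and norm_star_mult: "norm (star x * x) = (norm x)\<^sup>2"

definition cstar_subalgebra :: "'a::cstar_algebra set \<Rightarrow> bool" where
  "cstar_subalgebra S \<longleftrightarrow> complex_vector.subspace S \<and> closed S \<and> 1 \<in> S \<and>
     (\<forall>x\<in>S. \<forall>y\<in>S. x * y \<in> S) \<and> (\<forall>x\<in>S. star x \<in> S)"

definition cstar_generated :: "'a::cstar_algebra set \<Rightarrow> 'a set" where
  "cstar_generated X = \<Inter>{S. cstar_subalgebra S \<and> X \<subseteq> S}"

definition simple_cstar :: "'a::cstar_algebra set \<Rightarrow> bool" where
  "simple_cstar S \<longleftrightarrow> (\<forall>I. I \<subseteq> S \<and> complex_vector.subspace I \<and> closed I \<and>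
     (\<forall>a\<in>S. \<forall>x\<in>I. a * x \<in> I \<and> x * a \<in> I) \<longrightarrow> I = {0} \<or> I = S)"

definition rel_commutant :: "'a::cstar_algebra set \<Rightarrow> 'a set \<Rightarrow> 'a set" where
  "rel_commutant C D = {x \<in> D. \<forall>c\<in>C. c * x = x * c}"

definition cstar_spectrum :: "'a::cstar_algebra \<Rightarrow> complex set" where
  "cstar_spectrum a = {z. \<not> (\<exists>b. b * (a - z *\<^sub>C 1) = 1 \<and> (a - z *\<^sub>C 1) * b = 1)}"

text \<open>
  The spectrum is taken in the ambient algebra; it agrees with the spectrum in any unital
  \<open>C\<^sup>*\<close>-subalgebra containing the element.
\<close>

definition cstar_positive :: "'a::cstar_algebra \<Rightarrow> bool" where
  "cstar_positive a \<longleftrightarrow> star a = a \<and> cstar_spectrum a \<subseteq> complex_of_real ` {0..}"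


section \<open>Conditional expectations, index and the basic construction\<close>

text \<open>
  A conditional expectation of \<open>A\<close> onto \<open>B\<close>: a positive contractive \<open>B\<close>-bimodule projection. Only
  the values of \<open>E\<close> on \<open>A\<close> matter.
\<close>

definition cond_expectation :: "'a::cstar_algebra set \<Rightarrow> 'a set \<Rightarrow> ('a \<Rightarrow> 'a) \<Rightarrow> bool" where
  "cond_expectation B A E \<longleftrightarrow>
     linear_on A E \<and> (\<forall>x\<in>A. E x \<in> B) \<and> (\<forall>b\<in>B. E b = b) \<and>
     (\<forall>x\<in>A. \<forall>b\<in>B. E (b * x) = b * E x \<and> E (x * b) = E x * b) \<and>
     (\<forall>x\<in>A. cstar_positive (E (star x * x))) \<and> (\<forall>x\<in>A. norm (E x) \<le> norm x)"

definition quasi_basis ::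
    "'a::cstar_algebra set \<Rightarrow> ('a \<Rightarrow> 'a) \<Rightarrow> nat \<Rightarrow> (nat \<Rightarrow> 'a) \<Rightarrow> bool" where
  "quasi_basis A E n lam \<longleftrightarrow>
     (\<forall>i\<in>{1..n}. lam i \<in> A) \<and> (\<forall>x\<in>A. x = (\<Sum>i=1..n. lam i * E (star (lam i) * x)))"

definition index_finite :: "'a::cstar_algebra set \<Rightarrow> 'a set \<Rightarrow> ('a \<Rightarrow> 'a) \<Rightarrow> bool" where
  "index_finite B A E \<longleftrightarrow> cond_expectation B A E \<and> (\<exists>n lam. quasi_basis A E n lam)"

text \<open>
  The Watatani index as a number. It is meaningful for index-finite \<open>E\<close> on simple \<open>A\<close>: the element
  below is central in \<open>A\<close>, hence a scalar, and does not depend on the quasi-basis.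
\<close>

definition watatani_index :: "'a::cstar_algebra set \<Rightarrow> ('a \<Rightarrow> 'a) \<Rightarrow> real" where
  "watatani_index A E =
     (THE c. \<exists>n lam. quasi_basis A E n lam \<and> (\<Sum>i=1..n. lam i * star (lam i)) = c *\<^sub>R 1)"

definition minimal_expectation :: "'a::cstar_algebra set \<Rightarrow> 'a set \<Rightarrow> ('a \<Rightarrow> 'a) \<Rightarrow> bool" where
  "minimal_expectation B A E \<longleftrightarrow> index_finite B A E \<and>
     (\<forall>F. index_finite B A F \<longrightarrow> watatani_index A E \<le> watatani_index A F)"

text \<open>
  \<open>A1\<close>, with Jones projection \<open>e\<close> and dual expectation \<open>E1 : A1 \<rightarrow> A\<close>, is a basic construction for
  \<open>E : A \<rightarrow> B\<close> with index \<open>1 / \<tau>\<close>, inside the ambient \<open>C\<^sup>*\<close>-algebra.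
\<close>

definition basic_construction ::
    "'a::cstar_algebra set \<Rightarrow> 'a set \<Rightarrow> ('a \<Rightarrow> 'a) \<Rightarrow> real \<Rightarrow> 'a set \<Rightarrow> 'a \<Rightarrow> ('a \<Rightarrow> 'a) \<Rightarrow> bool" where
  "basic_construction B A E \<tau> A1 e E1 \<longleftrightarrow>
     star e = e \<and> e * e = e \<and>
     A1 = cstar_generated (insert e A) \<and>
     (\<forall>x\<in>A. e * x * e = E x * e) \<and> (\<forall>b\<in>B. e * b = b * e) \<and>
     index_finite A A1 E1 \<and> (\<forall>x\<in>A. \<forall>y\<in>A. E1 (x * e * y) = \<tau> *\<^sub>R (x * y))"


section \<open>Trace form, Fourier transform and convolution on the first relative commutant\<close>

text \<open>On the commutant of \<open>B\<close> in \<open>A1\<close> the values of \<open>E0 \<circ> E1\<close> are scalar multiples of \<open>1\<close>.\<close>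

definition tower_trace :: "('a::cstar_algebra \<Rightarrow> 'a) \<Rightarrow> ('a \<Rightarrow> 'a) \<Rightarrow> 'a \<Rightarrow> complex" where
  "tower_trace E0 E1 x = (THE c. E0 (E1 x) = c *\<^sub>C 1)"

definition trace_inner :: "('a::cstar_algebra \<Rightarrow> 'a) \<Rightarrow> ('a \<Rightarrow> 'a) \<Rightarrow> 'a \<Rightarrow> 'a \<Rightarrow> complex" where
  "trace_inner E0 E1 x y = tower_trace E0 E1 (star x * y)"

text \<open>The expectation from the commutant of \<open>B\<close> in \<open>A2\<close> onto the commutant of \<open>A\<close> in \<open>A2\<close>.\<close>

definition commutant_expectation ::
    "real \<Rightarrow> nat \<Rightarrow> (nat \<Rightarrow> 'a::cstar_algebra) \<Rightarrow> 'a \<Rightarrow> 'a" where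
  "commutant_expectation \<tau> n lam x = \<tau> *\<^sub>R (\<Sum>i=1..n. lam i * x * star (lam i))"

definition fourier ::
    "real \<Rightarrow> nat \<Rightarrow> (nat \<Rightarrow> 'a::cstar_algebra) \<Rightarrow> 'a \<Rightarrow> 'a \<Rightarrow> 'a \<Rightarrow> 'a" where
  "fourier \<tau> n lam e1 e2 x = (\<tau> powr (-3/2)) *\<^sub>R commutant_expectation \<tau> n lam (x * e2 * e1)"

text \<open>The order of the two factors is reversed.\<close>

definition convolution :: "'a::cstar_algebra set \<Rightarrow> ('a \<Rightarrow> 'a) \<Rightarrow> 'a \<Rightarrow> 'a \<Rightarrow> 'a" where
  "convolution V F x y = inv_into V F (F y * F x)"

end

theory Submission
  imports Defs
begin

text \<open>
  The comultiplication is dual to the convolution product on \<open>V\<close>, the commutant of \<open>B\<close> in \<open>A1\<close>, and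
  a coalgebra is what one obtains by dualising a finite-dimensional unital associative algebra along
  a nondegenerate form. Three facts are therefore needed: \<open>V\<close> is a finite-dimensional Hilbert space
  under the trace form, convolution is associative, and \<open>e1\<close> is a multiple of its unit.

  \<^emph>\<open>Duality.\<close> With vectors \<open>v\<^sub>i\<close> such that \<open>x = \<Sum>\<^sub>i \<langle>v\<^sub>i, x\<rangle> v\<^sub>i\<close>, every bilinear form on \<open>V\<close> is
  represented by exactly one tensor (\<open>tensor_riesz\<close>), and
  \<open>\<Delta> x = \<tau>\<^sup>1\<^sup>/\<^sup>2 \<Sum>\<^sub>i\<^sub>j \<langle>v\<^sub>i \<star> v\<^sub>j, x\<rangle> v\<^sub>i \<otimes> v\<^sub>j\<close>. Coassociativity and the counit laws are then associativity
  and the unit laws of \<open>\<star>\<close> (\<open>coalgebra_of_dual_algebra\<close>).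

  \<^emph>\<open>Algebra.\<close> The Fourier transform \<open>F\<close> is a bijection of \<open>V\<close> onto the commutant of \<open>A\<close> in \<open>A2\<close>, which
  is closed under multiplication, so that convolution is that multiplication, reversed and transported
  along \<open>F\<close>; and \<open>F e1 = \<tau>\<^sup>1\<^sup>/\<^sup>2\<close>. The inverse is checked by hand (\<open>G_F\<close>, \<open>F_G\<close>) from three relations of
  the tower: \<open>\<Sum>\<^sub>i \<lambda>\<^sub>i e1 \<lambda>\<^sub>i\<^sup>* = 1\<close>, \<open>e1 e2 e1 = \<tau> e1\<close>, and the pull-down property \<open>y e2 \<in> A1 e2\<close> for \<open>y\<close> in
  \<open>A2\<close>. In each of the first two, the sides differ by a multiple of a projection that a faithful expectation
  maps to \<open>0\<close>.

  \<^emph>\<open>Analysis.\<close> For an expectation with a quasi-basis, the Cauchy-Schwarz inequality bounds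
  \<open>\<parallel>x\<parallel>\<^sup>2\<close> by a multiple of \<open>\<parallel>E (x\<^sup>* x)\<parallel>\<close> (\<open>pimsner_popa_bound\<close>). This yields faithfulness, hence
  definiteness of the trace form, and bounds the length of orthonormal families in \<open>V\<close>
  (\<open>orthonormal_length_bounded\<close>). The form has scalar values because the centre of a simple algebra is
  scalar. Positivity being defined by the spectrum, both this and the norm inequalities for positive
  elements rest on the spectral radius formula (\<open>spectral_radius_bound\<close>).
\<close>

section \<open>Induced maps on tensor products\<close>

lemma linear_on_add: "linear_on V f \<Longrightarrow> x \<in> V \<Longrightarrow> y \<in> V \<Longrightarrow> f (x + y) = f x + f y"
  and linear_on_scale: "linear_on V f \<Longrightarrow> x \<in> V \<Longrightarrow> f (c *\<^sub>C x) = c *\<^sub>C f x"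
  by (auto simp: linear_on_def)

lemma linear_onI:
  "(\<And>x y. x \<in> V \<Longrightarrow> y \<in> V \<Longrightarrow> f (x + y) = f x + f y) \<Longrightarrow>
   (\<And>c x. x \<in> V \<Longrightarrow> f (c *\<^sub>C x) = c *\<^sub>C f x) \<Longrightarrow> linear_on V f"
  by (auto simp: linear_on_def)

lemma linear_on_zero: "linear_on V f \<Longrightarrow> complex_vector.subspace V \<Longrightarrow> f 0 = 0"
  using linear_on_scale[of V f 0 0] by (simp add: complex_vector.subspace_0)

lemma linear_on_sum:
  assumes f: "linear_on V f" and V: "complex_vector.subspace V" and g: "\<And>i. i \<in> I \<Longrightarrow> g i \<in> V"
  shows "f (\<Sum>i\<in>I. g i) = (\<Sum>i\<in>I. f (g i))"
  using g
proof (induction I rule: infinite_finite_induct)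
  case (insert i I)
  then show ?case
    using linear_on_add[OF f] complex_vector.subspace_sum[OF V, of I g] by simp
qed (use linear_on_zero[OF f V] in auto)

lemma linear_on_comb:
  assumes "linear_on V f" and V: "complex_vector.subspace V" and "\<And>i. i \<in> I \<Longrightarrow> g i \<in> V"
  shows "f (\<Sum>i\<in>I. c i *\<^sub>C g i) = (\<Sum>i\<in>I. c i *\<^sub>C f (g i))"
  using assms by (simp add: linear_on_sum linear_on_scale complex_vector.subspace_scale)

lemma linear_on_comb2:
  assumes f: "linear_on V f" and V: "complex_vector.subspace V"
    and "\<And>i j. i \<in> I \<Longrightarrow> j \<in> J \<Longrightarrow> g i j \<in> V"
  shows "f (\<Sum>i\<in>I. \<Sum>j\<in>J. c i j *\<^sub>C g i j) = (\<Sum>i\<in>I. \<Sum>j\<in>J. c i j *\<^sub>C f (g i j))"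
proof -
  have inner: "f (\<Sum>j\<in>J. c i j *\<^sub>C g i j) = (\<Sum>j\<in>J. c i j *\<^sub>C f (g i j))" if "i \<in> I" for i
    using that assms(3) by (intro linear_on_comb[OF f V]) auto
  have "f (\<Sum>i\<in>I. \<Sum>j\<in>J. c i j *\<^sub>C g i j) = (\<Sum>i\<in>I. f (\<Sum>j\<in>J. c i j *\<^sub>C g i j))"
    using assms(3)
    by (intro linear_on_sum[OF f V] complex_vector.subspace_sum[OF V]
        complex_vector.subspace_scale[OF V])
  then show ?thesis by (simp add: inner)
qed

lemma linear_on_eq_on_span:
  assumes f: "linear_on (complex_vector.span S) f" and g: "linear_on (complex_vector.span S) g"
    and eq: "\<And>x. x \<in> S \<Longrightarrow> f x = g x" and x: "x \<in> complex_vector.span S"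
  shows "f x = g x"
proof -
  have "x \<in> complex_vector.span S \<and> f x = g x"
    using x
  proof (induction rule: complex_vector.span_induct_alt)
    case base
    then show ?case
      using linear_on_zero[OF f complex_vector.subspace_span]
        linear_on_zero[OF g complex_vector.subspace_span] by (simp add: complex_vector.span_zero)
  next
    case (step c x y)
    then show ?case
      using linear_on_add[OF f] linear_on_add[OF g] linear_on_scale[OF f] linear_on_scale[OF g] eq
      by (simp add: complex_vector.span_base complex_vector.span_scale complex_vector.span_add)
  qed
  then show ?thesis by simp
qed

text \<open>
  A nonzero vector extends to a basis, and its coordinate functional does not vanish on it.
\<close>

lemma linear_functionals_separate_points:
  fixes x y :: "'c::complex_vector"
  assumes "\<And>\<phi> :: 'c \<Rightarrow> complex. linear_on UNIV \<phi> \<Longrightarrow> \<phi> x = \<phi> y"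
  shows "x = y"
proof (rule ccontr)
  assume "x \<noteq> y"
  define d where "d = x - y"
  define X where "X = complex_vector.extend_basis {d}"
  have ind: "complex_vector.independent {d}"
    using \<open>x \<noteq> y\<close> by (simp add: d_def complex_vector.dependent_single)
  have X: "complex_vector.independent X" "complex_vector.span X = UNIV" "d \<in> X"
    unfolding X_def using complex_vector.independent_extend_basis[OF ind]
      complex_vector.span_extend_basis[OF ind] complex_vector.extend_basis_superset[OF ind] by auto
  define \<phi> where "\<phi> z = complex_vector.representation X z d" for z
  have "linear_on UNIV \<phi>"
    by (rule linear_onI)
      (simp_all add: \<phi>_def complex_vector.representation_add[OF X(1)]
        complex_vector.representation_scale[OF X(1)] X(2) scaleC_complex_def)
  then have "\<phi> (y + d) = \<phi> y + \<phi> d" and "\<phi> x = \<phi> y"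
    using assms by (auto simp: linear_on_def)
  moreover have "\<phi> d = 1"
    using X by (simp add: \<phi>_def complex_vector.representation_basis)
  ultimately show False
    by (simp add: d_def)
qed

lemma bilinear_onI:
  assumes "\<And>x y w. x \<in> V \<Longrightarrow> y \<in> V \<Longrightarrow> w \<in> W \<Longrightarrow> b (x + y) w = b x w + b y w"
    and "\<And>c x w. x \<in> V \<Longrightarrow> w \<in> W \<Longrightarrow> b (c *\<^sub>C x) w = c *\<^sub>C b x w"
    and "\<And>x y w. w \<in> V \<Longrightarrow> x \<in> W \<Longrightarrow> y \<in> W \<Longrightarrow> b w (x + y) = b w x + b w y"
    and "\<And>c x w. w \<in> V \<Longrightarrow> x \<in> W \<Longrightarrow> b w (c *\<^sub>C x) = c *\<^sub>C b w x"
  shows "bilinear_on V W b"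
  using assms by (auto simp: bilinear_on_def intro!: linear_onI)

lemma bilinear_on_left: "bilinear_on V W b \<Longrightarrow> w \<in> W \<Longrightarrow> linear_on V (\<lambda>v. b v w)"
  and bilinear_on_right: "bilinear_on V W b \<Longrightarrow> v \<in> V \<Longrightarrow> linear_on W (b v)"
  by (auto simp: bilinear_on_def)

lemma bilinear_on_tens: "bilinear_on V W (tens V W)"
  by (rule bilinear_onI; rule ext)
    (auto simp: tens_def scaleC_fun_def bilinear_on_def linear_on_def)

lemma subspace_tensor_space: "complex_vector.subspace (tensor_space V W)"
  unfolding tensor_space_def by (rule complex_vector.subspace_span)

lemma tens_in_tensor_space: "v \<in> V \<Longrightarrow> w \<in> W \<Longrightarrow> tens V W v w \<in> tensor_space V W"
  unfolding tensor_space_def by (auto intro!: complex_vector.span_base)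

lemma linear_on_tensor_space_eqI:
  assumes "linear_on (tensor_space V W) f" "linear_on (tensor_space V W) g"
    and "\<And>v w. v \<in> V \<Longrightarrow> w \<in> W \<Longrightarrow> f (tens V W v w) = g (tens V W v w)"
    and "t \<in> tensor_space V W"
  shows "f t = g t"
  by (rule linear_on_eq_on_span[OF assms(1,2)[unfolded tensor_space_def] _
        assms(4)[unfolded tensor_space_def]]) (use assms(3) in blast)

text \<open>
  A tensor, being a functional on scalar bilinear forms, prescribes the value at \<open>b\<close> of every
  linear functional; since linear functionals separate points, this defines the induced map.
\<close>

lemma tensor_universal_property:
  fixes b :: "'a::complex_vector \<Rightarrow> 'b::complex_vector \<Rightarrow> 'c::complex_vector"
  assumes b: "bilinear_on V W b"
  shows "\<exists>f. linear_on (tensor_space V W) f \<and> (\<forall>v\<in>V. \<forall>w\<in>W. f (tens V W v w) = b v w)"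
proof -
  define R where "R t y \<longleftrightarrow> (\<forall>\<phi>. linear_on UNIV \<phi> \<longrightarrow> \<phi> y = t (\<lambda>v w. \<phi> (b v w)))"
    for t :: "('a, 'b) tensor" and y
  have unique: "y = y'" if "R t y" "R t y'" for t y y'
    by (rule linear_functionals_separate_points) (use that in \<open>auto simp: R_def\<close>)
  have comp: "bilinear_on V W (\<lambda>v w. \<phi> (b v w))" if "linear_on UNIV \<phi>" for \<phi> :: "'c \<Rightarrow> complex"
    using b that by (auto simp: bilinear_on_def linear_on_def)
  have R_tens: "R (tens V W v w) (b v w)" for v w
    using comp by (auto simp: R_def tens_def)
  have R_add: "R (s + t) (x + y)" if "R s x" "R t y" for s t x y
    using that by (auto simp: R_def linear_on_def)
  have R_scale: "R (c *\<^sub>C s) (c *\<^sub>C x)" if "R s x" for c s x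
    using that by (auto simp: R_def linear_on_def scaleC_fun_def)
  have R_zero: "R 0 0"
  proof -
    have "\<phi> 0 = 0" if "linear_on UNIV \<phi>" for \<phi> :: "'c \<Rightarrow> complex"
      using linear_on_zero[OF that] by simp
    then show ?thesis by (simp add: R_def)
  qed
  have R_ex: "\<exists>y. R t y" if "t \<in> tensor_space V W" for t
    using that unfolding tensor_space_def
  proof (induction rule: complex_vector.span_induct_alt)
    case base
    then show ?case using R_zero by blast
  next
    case (step c s t)
    then show ?case using R_tens R_add R_scale by blast
  qed
  define f where "f t = (THE y. R t y)" for t
  have f_eq: "f t = y" if "R t y" for t y
    unfolding f_def using that unique by blast
  have "linear_on (tensor_space V W) f"
    by (rule linear_onI) (use R_ex R_add R_scale f_eq in metis)+
  then show ?thesis using f_eq R_tens by blast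
qed

lemma tensor_lift_linear: "bilinear_on V W b \<Longrightarrow> linear_on (tensor_space V W) (tensor_lift V W b)"
  and tensor_lift_tens: "bilinear_on V W b \<Longrightarrow> v \<in> V \<Longrightarrow> w \<in> W \<Longrightarrow>
    tensor_lift V W b (tens V W v w) = b v w"
proof -
  assume "bilinear_on V W b"
  from tensor_universal_property[OF this] obtain f where
    f: "linear_on (tensor_space V W) f" "\<And>v w. v \<in> V \<Longrightarrow> w \<in> W \<Longrightarrow> f (tens V W v w) = b v w"
    by blast
  have eq: "tensor_lift V W b t = f t" if "t \<in> tensor_space V W" for t
    unfolding tensor_lift_def
  proof (rule the_equality)
    show "\<exists>g. linear_on (tensor_space V W) g \<and> (\<forall>v\<in>V. \<forall>w\<in>W. g (tens V W v w) = b v w) \<and> g t = f t"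
      using f by blast
    show "y = f t" if "\<exists>g. linear_on (tensor_space V W) g \<and>
        (\<forall>v\<in>V. \<forall>w\<in>W. g (tens V W v w) = b v w) \<and> g t = y" for y
      using that f linear_on_tensor_space_eqI[OF _ f(1) _ \<open>t \<in> tensor_space V W\<close>] by metis
  qed
  show "linear_on (tensor_space V W) (tensor_lift V W b)"
    by (rule linear_onI)
      (simp_all add: eq linear_on_add[OF f(1)] linear_on_scale[OF f(1)]
        complex_vector.subspace_add[OF subspace_tensor_space]
        complex_vector.subspace_scale[OF subspace_tensor_space])
  show "v \<in> V \<Longrightarrow> w \<in> W \<Longrightarrow> tensor_lift V W b (tens V W v w) = b v w"
    by (simp add: eq f tens_in_tensor_space)
qed

lemma bilinear_on_tens_comp:
  assumes "linear_on V f" "linear_on W g" "f ` V \<subseteq> V'" "g ` W \<subseteq> W'"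
  shows "bilinear_on V W (\<lambda>v w. tens V' W' (f v) (g w))"
  using assms bilinear_on_tens[of V' W']
  by (intro bilinear_onI)
    (simp_all add: linear_on_add[OF assms(1)] linear_on_scale[OF assms(1)]
      linear_on_add[OF assms(2)] linear_on_scale[OF assms(2)] image_subset_iff
      bilinear_on_left[THEN linear_on_add] bilinear_on_left[THEN linear_on_scale]
      bilinear_on_right[THEN linear_on_add] bilinear_on_right[THEN linear_on_scale])

lemma tensor_map_linear:
  assumes "linear_on V f" "linear_on W g" "f ` V \<subseteq> V'" "g ` W \<subseteq> W'"
  shows "linear_on (tensor_space V W) (tensor_map V W V' W' f g)"
  unfolding tensor_map_def by (intro tensor_lift_linear bilinear_on_tens_comp assms)

lemma tensor_map_tens:
  assumes "linear_on V f" "linear_on W g" "f ` V \<subseteq> V'" "g ` W \<subseteq> W'" "v \<in> V" "w \<in> W"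
  shows "tensor_map V W V' W' f g (tens V W v w) = tens V' W' (f v) (g w)"
  unfolding tensor_map_def by (intro tensor_lift_tens bilinear_on_tens_comp assms)

lemma linear_on_id: "linear_on V id"
  by (simp add: linear_on_def)

lemma bilinear_on_tens_assoc:
  assumes "w \<in> W"
  shows "bilinear_on U V (\<lambda>u v. tens U (tensor_space V W) u (tens V W v w))"
  by (rule bilinear_on_tens_comp[where f = "\<lambda>u. u" and g = "\<lambda>v. tens V W v w"])
    (use assms in \<open>auto intro!: linear_onI tens_in_tensor_space
      simp: bilinear_on_tens[THEN bilinear_on_left, THEN linear_on_add]
        bilinear_on_tens[THEN bilinear_on_left, THEN linear_on_scale]\<close>)

lemma bilinear_on_tensor_assoc:
  assumes W: "complex_vector.subspace W"
  shows "bilinear_on (tensor_space U V) W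
     (\<lambda>s w. tensor_lift U V (\<lambda>u v. tens U (tensor_space V W) u (tens V W v w)) s)"
    (is "bilinear_on _ _ (\<lambda>s w. ?L w s)")
proof -
  have lin: "linear_on (tensor_space U V) (?L w)" if "w \<in> W" for w
    by (rule tensor_lift_linear[OF bilinear_on_tens_assoc[OF that]])
  have tens_L: "?L w (tens U V u v) = tens U (tensor_space V W) u (tens V W v w)"
    if "w \<in> W" "u \<in> U" "v \<in> V" for u v w
    by (rule tensor_lift_tens[OF bilinear_on_tens_assoc[OF that(1)] that(2,3)])
  note right = bilinear_on_tens[THEN bilinear_on_right, THEN linear_on_add]
    bilinear_on_tens[THEN bilinear_on_right, THEN linear_on_scale]
  have add: "?L (x + y) s = ?L x s + ?L y s" if "x \<in> W" "y \<in> W" "s \<in> tensor_space U V" for x y s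
  proof (rule linear_on_tensor_space_eqI[OF _ _ _ that(3)])
    show "linear_on (tensor_space U V) (?L (x + y))"
      using lin W that by (simp add: complex_vector.subspace_add)
    show "linear_on (tensor_space U V) (\<lambda>s. ?L x s + ?L y s)"
      using lin[OF that(1)] lin[OF that(2)] by (auto simp: linear_on_def scaleC_add_right)
  qed (use that W in \<open>simp add: tens_L complex_vector.subspace_add right tens_in_tensor_space\<close>)
  have scale: "?L (c *\<^sub>C x) s = c *\<^sub>C ?L x s" if "x \<in> W" "s \<in> tensor_space U V" for x c s
  proof (rule linear_on_tensor_space_eqI[OF _ _ _ that(2)])
    show "linear_on (tensor_space U V) (?L (c *\<^sub>C x))"
      using lin W that by (simp add: complex_vector.subspace_scale)
    show "linear_on (tensor_space U V) (\<lambda>s. c *\<^sub>C ?L x s)"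
      using lin[OF that(1)]
      by (auto simp: linear_on_def scaleC_add_right scaleC_scaleC mult.commute)
  qed (use that W in \<open>simp add: tens_L complex_vector.subspace_scale right tens_in_tensor_space\<close>)
  show ?thesis
    by (rule bilinear_onI) (simp_all add: add scale linear_on_add[OF lin] linear_on_scale[OF lin])
qed

lemma tensor_assoc_linear:
  "complex_vector.subspace W \<Longrightarrow>
   linear_on (tensor_space (tensor_space U V) W) (tensor_assoc U V W)"
  unfolding tensor_assoc_def by (intro tensor_lift_linear bilinear_on_tensor_assoc)

lemma tensor_assoc_tens:
  assumes "complex_vector.subspace W" "u \<in> U" "v \<in> V" "w \<in> W"
  shows "tensor_assoc U V W (tens (tensor_space U V) W (tens U V u v) w)
    = tens U (tensor_space V W) u (tens V W v w)"
  using assms unfolding tensor_assoc_def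
  by (simp add: tensor_lift_tens[OF bilinear_on_tensor_assoc] tens_in_tensor_space
      tensor_lift_tens[OF bilinear_on_tens_assoc])

lemma bilinear_on_unit_left: "bilinear_on UNIV V (\<lambda>(c::complex) v. c *\<^sub>C v)"
  by (rule bilinear_onI)
    (auto simp: scaleC_add_left scaleC_add_right scaleC_scaleC scaleC_complex_def mult.commute)

lemma bilinear_on_unit_right: "bilinear_on V UNIV (\<lambda>v (c::complex). c *\<^sub>C v)"
  by (rule bilinear_onI)
    (auto simp: scaleC_add_left scaleC_add_right scaleC_scaleC scaleC_complex_def mult.commute)

lemma sum_rotate3:
  "(\<Sum>i\<in>D. \<Sum>k\<in>A. \<Sum>l\<in>C. f i k l) = (\<Sum>k\<in>A. \<Sum>l\<in>C. \<Sum>i\<in>D. f i k l :: 'a::comm_monoid_add)"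
  by (subst sum.swap, rule sum.cong[OF refl], rule sum.swap)

section \<open>Coalgebras dual to finite-dimensional algebras\<close>

locale hermitian_space =
  fixes V :: "'a::complex_vector set" and ip :: "'a \<Rightarrow> 'a \<Rightarrow> complex"
  assumes subspace: "complex_vector.subspace V"
    and ip_linear: "\<And>x. x \<in> V \<Longrightarrow> linear_on V (ip x)"
    and ip_cnj: "\<And>x y. x \<in> V \<Longrightarrow> y \<in> V \<Longrightarrow> ip y x = cnj (ip x y)"
begin

lemma ip_add_right: "x \<in> V \<Longrightarrow> y \<in> V \<Longrightarrow> z \<in> V \<Longrightarrow> ip x (y + z) = ip x y + ip x z"
  and ip_scale_right: "x \<in> V \<Longrightarrow> y \<in> V \<Longrightarrow> ip x (c *\<^sub>C y) = c * ip x y"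
  using ip_linear by (auto simp: linear_on_def scaleC_complex_def)

lemma ip_add_left: "x \<in> V \<Longrightarrow> y \<in> V \<Longrightarrow> z \<in> V \<Longrightarrow> ip (x + y) z = ip x z + ip y z"
  using ip_cnj[of z "x + y"] ip_cnj[of z x] ip_cnj[of z y] subspace
  by (simp add: ip_add_right complex_vector.subspace_add)

lemma ip_scale_left: "x \<in> V \<Longrightarrow> z \<in> V \<Longrightarrow> ip (c *\<^sub>C x) z = cnj c * ip x z"
  using ip_cnj[of z "c *\<^sub>C x"] ip_cnj[of z x] subspace
  by (simp add: ip_scale_right complex_vector.subspace_scale)

lemma bilinear_on_cnj_ip:
  "y \<in> V \<Longrightarrow> z \<in> V \<Longrightarrow> bilinear_on V V (\<lambda>a b. cnj (ip a y * ip b z))"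
  by (rule bilinear_onI)
    (auto simp: ip_add_left ip_scale_left scaleC_complex_def algebra_simps)

text \<open>
  The form is a lift whose integrand contains another lift, so the outer one can be evaluated only
  once the inner one is known to be bilinear in its parameters. It is enough to compare linear maps
  on elementary tensors.
\<close>

lemma tensor_inner_eq:
  assumes s: "s \<in> tensor_space V V" and "y \<in> V" "z \<in> V"
  shows "tensor_inner V ip s (tens V V y z)
    = cnj (tensor_lift V V (\<lambda>a b. cnj (ip a y * ip b z)) s)"
proof -
  let ?L = "\<lambda>c d. tensor_lift V V (\<lambda>a b. cnj (ip a c * ip b d)) s"
  have expand: "?L c d = f s"
    if f: "linear_on (tensor_space V V) f" and "c \<in> V" "d \<in> V"
      "\<And>a b. a \<in> V \<Longrightarrow> b \<in> V \<Longrightarrow> f (tens V V a b) = cnj (ip a c * ip b d)" for c d f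
    by (rule linear_on_tensor_space_eqI[OF tensor_lift_linear[OF bilinear_on_cnj_ip] f _ s])
      (simp_all add: that tensor_lift_tens[OF bilinear_on_cnj_ip] del: complex_cnj_mult)
  have L: "linear_on (tensor_space V V) (tensor_lift V V (\<lambda>a b. cnj (ip a c * ip b d)))"
    if "c \<in> V" "d \<in> V" for c d
    using that by (intro tensor_lift_linear bilinear_on_cnj_ip)
  note L_simps = tensor_lift_tens[OF bilinear_on_cnj_ip]
  have lin_sum: "linear_on T (\<lambda>t. f t + g t)" if "linear_on T f" "linear_on T g"
    for T :: "('a, 'a) tensor set" and f g :: "_ \<Rightarrow> complex"
    using that by (auto simp: linear_on_def algebra_simps scaleC_complex_def)
  have lin_scale: "linear_on T (\<lambda>t. k * f t)" if "linear_on T f"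
    for T :: "('a, 'a) tensor set" and f :: "_ \<Rightarrow> complex" and k
    using that by (auto simp: linear_on_def algebra_simps scaleC_complex_def)
  have add: "?L (x + y) w = ?L x w + ?L y w" "?L w (x + y) = ?L w x + ?L w y"
    if "x \<in> V" "y \<in> V" "w \<in> V" for x y w
    using that subspace expand[OF lin_sum[OF L[of x w] L[of y w]], of "x + y" w]
      expand[OF lin_sum[OF L[of w x] L[of w y]], of w "x + y"]
    by (simp_all add: L_simps ip_add_right complex_vector.subspace_add ring_distribs
        del: complex_cnj_mult)
  have scale: "?L (k *\<^sub>C x) w = cnj k * ?L x w" "?L w (k *\<^sub>C x) = cnj k * ?L w x"
    if "x \<in> V" "w \<in> V" for x w k
    using that subspace expand[OF lin_scale[OF L[of x w], of "cnj k"], of "k *\<^sub>C x" w]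
      expand[OF lin_scale[OF L[of w x], of "cnj k"], of w "k *\<^sub>C x"]
    by (simp_all add: L_simps ip_scale_right complex_vector.subspace_scale mult_ac
        complex_cnj_mult[of k] del: complex_cnj_mult)
  have "bilinear_on V V (\<lambda>c d. cnj (?L c d))"
    by (rule bilinear_onI)
      (simp_all add: add scale scaleC_complex_def del: complex_cnj_mult(1), simp_all)
  then show ?thesis
    unfolding tensor_inner_def using assms by (simp add: tensor_lift_tens)
qed

lemma tensor_inner_tens:
  assumes "a \<in> V" "b \<in> V" "y \<in> V" "z \<in> V"
  shows "tensor_inner V ip (tens V V a b) (tens V V y z) = ip a y * ip b z"
  using assms
  by (simp add: tensor_inner_eq tens_in_tensor_space tensor_lift_tens[OF bilinear_on_cnj_ip]
      del: complex_cnj_mult)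

lemma linear_on_cnj_tensor_inner:
  assumes "y \<in> V" "z \<in> V"
  shows "linear_on (tensor_space V V) (\<lambda>s. cnj (tensor_inner V ip s (tens V V y z)))"
  using tensor_lift_linear[OF bilinear_on_cnj_ip[OF assms]] subspace_tensor_space[of V V] assms
  by (auto simp: linear_on_def tensor_inner_eq complex_vector.subspace_add
      complex_vector.subspace_scale)

end

text \<open>
  The reconstruction formula exhibits the functionals \<open>\<langle>v\<^sub>i, _\<rangle>\<close> as dual to the vectors \<open>v\<^sub>i\<close>, so that
  tensors and bilinear forms are determined by their values at the pairs \<open>(v\<^sub>i, v\<^sub>j)\<close>.
\<close>
locale hermitian_space_basis = hermitian_space V ip
  for V :: "'a::complex_vector set" and ip +
  fixes N :: nat and v :: "nat \<Rightarrow> 'a"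
  assumes v_in: "\<And>i. i < N \<Longrightarrow> v i \<in> V"
    and expand: "\<And>x. x \<in> V \<Longrightarrow> x = (\<Sum>i<N. ip (v i) x *\<^sub>C v i)"
begin

lemma tens_expand:
  assumes "a \<in> V" "b \<in> V"
  shows "tens V V a b = (\<Sum>i<N. \<Sum>j<N. (ip (v i) a * ip (v j) b) *\<^sub>C tens V V (v i) (v j))"
proof -
  have "tens V V a b = (\<Sum>i<N. ip (v i) a *\<^sub>C tens V V (v i) b)"
    using linear_on_comb[OF bilinear_on_left[OF bilinear_on_tens[of V V] assms(2)] subspace,
        of "{..<N}" v "\<lambda>i. ip (v i) a"] v_in expand[OF assms(1)] by simp
  moreover have "tens V V c b = (\<Sum>j<N. ip (v j) b *\<^sub>C tens V V c (v j))" if "c \<in> V" for c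
    using linear_on_comb[OF bilinear_on_right[OF bilinear_on_tens[of V V] that] subspace,
        of "{..<N}" v "\<lambda>i. ip (v i) b"] v_in expand[OF assms(2)] by simp
  ultimately show ?thesis
    using v_in by (simp add: complex_vector.scale_sum_right scaleC_scaleC)
qed

lemma tensor_expand:
  assumes "t \<in> tensor_space V V"
  shows "t = (\<Sum>i<N. \<Sum>j<N. cnj (tensor_inner V ip t (tens V V (v i) (v j))) *\<^sub>C tens V V (v i) (v j))"
proof (rule linear_on_tensor_space_eqI[OF _ _ _ assms])
  show "linear_on (tensor_space V V) (\<lambda>t. t)"
    by (simp add: linear_on_def)
  show "linear_on (tensor_space V V)
    (\<lambda>t. \<Sum>i<N. \<Sum>j<N. cnj (tensor_inner V ip t (tens V V (v i) (v j))) *\<^sub>C tens V V (v i) (v j))"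
    by (rule linear_onI)
      (simp_all add: linear_on_cnj_tensor_inner[THEN linear_on_add]
        linear_on_cnj_tensor_inner[THEN linear_on_scale] v_in scaleC_add_left sum.distrib
        scaleC_complex_def complex_vector.scale_sum_right scaleC_scaleC)
  show "tens V V a b = (\<Sum>i<N. \<Sum>j<N. cnj (tensor_inner V ip (tens V V a b) (tens V V (v i) (v j)))
      *\<^sub>C tens V V (v i) (v j))" if "a \<in> V" "b \<in> V" for a b
    using that v_in
    by (subst tens_expand[OF that]) (simp add: tensor_inner_tens ip_cnj[of _ "v _"])
qed

lemma tensor_inner_linear_sum:
  assumes "y \<in> V" "z \<in> V"
  shows "tensor_inner V ip (\<Sum>i<N. \<Sum>j<N. c i j *\<^sub>C tens V V (v i) (v j)) (tens V V y z)
    = (\<Sum>i<N. \<Sum>j<N. cnj (c i j) * (ip (v i) y * ip (v j) z))"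
proof -
  have "cnj (tensor_inner V ip (\<Sum>i<N. \<Sum>j<N. c i j *\<^sub>C tens V V (v i) (v j)) (tens V V y z))
    = (\<Sum>i<N. \<Sum>j<N. c i j * cnj (ip (v i) y * ip (v j) z))"
    using assms v_in
    by (subst linear_on_comb2[OF linear_on_cnj_tensor_inner[OF assms] subspace_tensor_space])
      (simp_all add: tens_in_tensor_space tensor_inner_tens scaleC_complex_def)
  then have "cnj (cnj (tensor_inner V ip (\<Sum>i<N. \<Sum>j<N. c i j *\<^sub>C tens V V (v i) (v j)) (tens V V y z)))
    = cnj (\<Sum>i<N. \<Sum>j<N. c i j * cnj (ip (v i) y * ip (v j) z))"
    by simp
  then show ?thesis by simp
qed

text \<open>
  A tensor is the combination of the \<open>v\<^sub>i \<otimes> v\<^sub>j\<close> whose coefficients are the conjugates of its inner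
  products with them; conversely the tensor with coefficients \<open>cnj (\<psi> v\<^sub>i v\<^sub>j)\<close> represents \<open>\<psi>\<close>.
\<close>
lemma tensor_riesz:
  assumes \<psi>: "bilinear_on V V \<psi>"
  shows "\<exists>!t. t \<in> tensor_space V V \<and> (\<forall>y\<in>V. \<forall>z\<in>V. tensor_inner V ip t (tens V V y z) = \<psi> y z)"
proof (rule ex_ex1I)
  let ?t = "\<Sum>i<N. \<Sum>j<N. cnj (\<psi> (v i) (v j)) *\<^sub>C tens V V (v i) (v j)"
  have "?t \<in> tensor_space V V"
    by (intro complex_vector.subspace_sum complex_vector.subspace_scale subspace_tensor_space
        tens_in_tensor_space v_in) auto
  moreover have "tensor_inner V ip ?t (tens V V y z) = \<psi> y z" if "y \<in> V" "z \<in> V" for y z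
  proof -
    have "\<psi> y z = (\<Sum>i<N. ip (v i) y * \<psi> (v i) z)"
      using linear_on_comb[OF bilinear_on_left[OF \<psi> that(2)] subspace,
        of "{..<N}" v "\<lambda>i. ip (v i) y"] v_in expand[OF that(1)] by (simp add: scaleC_complex_def)
    moreover have "\<psi> c z = (\<Sum>j<N. ip (v j) z * \<psi> c (v j))" if "c \<in> V" for c
      using linear_on_comb[OF bilinear_on_right[OF \<psi> that] subspace,
        of "{..<N}" v "\<lambda>i. ip (v i) z"] v_in expand[OF \<open>z \<in> V\<close>] by (simp add: scaleC_complex_def)
    ultimately have "\<psi> y z = (\<Sum>i<N. \<Sum>j<N. \<psi> (v i) (v j) * (ip (v i) y * ip (v j) z))"
      using v_in by (simp add: sum_distrib_left algebra_simps)
    then show ?thesis using that by (simp add: tensor_inner_linear_sum)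
  qed
  ultimately show "\<exists>t. t \<in> tensor_space V V \<and>
      (\<forall>y\<in>V. \<forall>z\<in>V. tensor_inner V ip t (tens V V y z) = \<psi> y z)"
    by blast
next
  fix s t
  assume s: "s \<in> tensor_space V V \<and> (\<forall>y\<in>V. \<forall>z\<in>V. tensor_inner V ip s (tens V V y z) = \<psi> y z)"
    and t: "t \<in> tensor_space V V \<and> (\<forall>y\<in>V. \<forall>z\<in>V. tensor_inner V ip t (tens V V y z) = \<psi> y z)"
  have "s = (\<Sum>i<N. \<Sum>j<N. cnj (\<psi> (v i) (v j)) *\<^sub>C tens V V (v i) (v j))"
    by (subst tensor_expand) (use s v_in in auto)
  also have "\<dots> = t"
    by (subst (2) tensor_expand) (use t v_in in auto)
  finally show "s = t" .
qed

text \<open>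
  In the basis, both sides of coassociativity have the matrix coefficients
  \<open>\<langle>(v\<^sub>k \<star> v\<^sub>l) \<star> v\<^sub>j, x\<rangle>\<close> and \<open>\<langle>v\<^sub>k \<star> (v\<^sub>l \<star> v\<^sub>j), x\<rangle>\<close> up to the same factor, and the counit
  laws read off the unit laws of the product.
\<close>

lemma coalgebra_of_dual_algebra:
  assumes m: "bilinear_on V V m" and m_in: "\<And>x y. x \<in> V \<Longrightarrow> y \<in> V \<Longrightarrow> m x y \<in> V"
    and assoc: "\<And>x y z. x \<in> V \<Longrightarrow> y \<in> V \<Longrightarrow> z \<in> V \<Longrightarrow> m (m x y) z = m x (m y z)"
    and u: "u \<in> V" and unit: "\<And>x. x \<in> V \<Longrightarrow> m u x = of_real r *\<^sub>C x"
      "\<And>x. x \<in> V \<Longrightarrow> m x u = of_real r *\<^sub>C x"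
    and \<Delta>_in: "\<And>x. x \<in> V \<Longrightarrow> \<Delta> x \<in> tensor_space V V"
    and \<Delta>: "\<And>x y z. x \<in> V \<Longrightarrow> y \<in> V \<Longrightarrow> z \<in> V \<Longrightarrow>
      tensor_inner V ip (\<Delta> x) (tens V V y z) = of_real s * ip x (m y z)"
    and \<epsilon>: "\<And>x. x \<in> V \<Longrightarrow> \<epsilon> x = of_real q * ip u x"
    and norm: "q * s * r = 1"
  shows "coalgebra V \<Delta> \<epsilon>"
proof -
  have \<Delta>_eq: "\<Delta> x = (\<Sum>i<N. \<Sum>j<N. (of_real s * ip (m (v i) (v j)) x) *\<^sub>C tens V V (v i) (v j))"
    if "x \<in> V" for x
    by (subst tensor_expand[OF \<Delta>_in[OF that]]) (simp add: \<Delta> that v_in m_in ip_cnj[of x])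
  have \<Delta>_lin: "linear_on V \<Delta>"
    by (rule linear_onI)
      (simp_all add: \<Delta>_eq complex_vector.subspace_add[OF subspace]
        complex_vector.subspace_scale[OF subspace] v_in m_in ip_add_right ip_scale_right
        algebra_simps scaleC_add_left sum.distrib complex_vector.scale_sum_right scaleC_scaleC)
  have \<epsilon>_lin: "linear_on V \<epsilon>"
    by (rule linear_onI)
      (simp_all add: \<epsilon> complex_vector.subspace_add[OF subspace]
        complex_vector.subspace_scale[OF subspace] u ip_add_right ip_scale_right
        algebra_simps scaleC_complex_def)
  have ip_left: "(\<Sum>i<N. ip a (v i) * ip (f (v i)) x) = ip (f a) x"
    if f: "linear_on V f" "\<And>y. y \<in> V \<Longrightarrow> f y \<in> V" and "a \<in> V" "x \<in> V" for f a x
  proof -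
    have "f a = (\<Sum>i<N. ip (v i) a *\<^sub>C f (v i))"
      using linear_on_comb[OF f(1) subspace, of "{..<N}" v "\<lambda>i. ip (v i) a"] v_in
        expand[OF that(3)] by simp
    then have "ip x (f a) = (\<Sum>i<N. ip (v i) a * ip x (f (v i)))"
      using linear_on_comb[OF ip_linear[OF that(4)] subspace, of "{..<N}" "\<lambda>i. f (v i)"] v_in f(2)
      by (simp add: scaleC_complex_def)
    then have "cnj (ip x (f a)) = (\<Sum>i<N. cnj (ip (v i) a) * cnj (ip x (f (v i))))"
      by simp
    then show ?thesis
      using that v_in by (simp add: ip_cnj[symmetric])
  qed
  have left: "(\<Sum>i<N. ip a (v i) * ip (m (v i) b) x) = ip (m a b) x"
    and right: "(\<Sum>i<N. ip a (v i) * ip (m b (v i)) x) = ip (m b a) x"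
    if "a \<in> V" "b \<in> V" "x \<in> V" for a b x
    using ip_left[OF bilinear_on_left[OF m that(2)] m_in]
      ip_left[OF bilinear_on_right[OF m that(2)] m_in] that by simp_all
  note TS = subspace_tensor_space tens_in_tensor_space
  have \<Delta>_im: "\<Delta> ` V \<subseteq> tensor_space V V" and id_im: "id ` V \<subseteq> V" and \<epsilon>_im: "\<epsilon> ` V \<subseteq> UNIV"
    using \<Delta>_in by auto
  have coassoc: "tensor_assoc V V V (tensor_map V V (tensor_space V V) V \<Delta> id (\<Delta> x))
            = tensor_map V V V (tensor_space V V) id \<Delta> (\<Delta> x)" if x: "x \<in> V" for x
  proof -
    define T where "T k l j = tens V (tensor_space V V) (v k) (tens V V (v l) (v j))" for k l j
    have "tensor_map V V (tensor_space V V) V \<Delta> id (\<Delta> x)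
      = (\<Sum>i<N. \<Sum>j<N. (of_real s * ip (m (v i) (v j)) x) *\<^sub>C tens (tensor_space V V) V (\<Delta> (v i)) (v j))"
      unfolding \<Delta>_eq[OF x]
      by (subst linear_on_comb2[OF tensor_map_linear[OF \<Delta>_lin linear_on_id \<Delta>_im id_im]])
        (simp_all add: TS v_in tensor_map_tens[OF \<Delta>_lin linear_on_id \<Delta>_im id_im])
    moreover have "tensor_assoc V V V (tens (tensor_space V V) V (\<Delta> a) b)
       = (\<Sum>k<N. \<Sum>l<N. (of_real s * ip (m (v k) (v l)) a) *\<^sub>C
            tens V (tensor_space V V) (v k) (tens V V (v l) b))" if "a \<in> V" "b \<in> V" for a b
    proof -
      have eq: "tens (tensor_space V V) V (\<Delta> a) b = (\<Sum>k<N. \<Sum>l<N. (of_real s * ip (m (v k) (v l)) a) *\<^sub>C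
          tens (tensor_space V V) V (tens V V (v k) (v l)) b)"
        unfolding \<Delta>_eq[OF that(1)] using v_in
        by (subst linear_on_comb2[OF bilinear_on_left[OF bilinear_on_tens that(2)]])
          (simp_all add: TS)
      show ?thesis
        unfolding eq using v_in that
        by (subst linear_on_comb2[OF tensor_assoc_linear[OF subspace]])
          (simp_all add: TS tensor_assoc_tens[OF subspace])
    qed
    ultimately have "tensor_assoc V V V (tensor_map V V (tensor_space V V) V \<Delta> id (\<Delta> x))
      = (\<Sum>i<N. \<Sum>j<N. (of_real s * ip (m (v i) (v j)) x) *\<^sub>C
          (\<Sum>k<N. \<Sum>l<N. (of_real s * ip (m (v k) (v l)) (v i)) *\<^sub>C T k l j))"
      using v_in \<Delta>_in
      by (simp only:) (subst linear_on_comb2[OF tensor_assoc_linear[OF subspace]];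
        simp add: TS T_def)
    also have "\<dots> = (\<Sum>i<N. \<Sum>j<N. \<Sum>k<N. \<Sum>l<N.
        (of_real (s * s) * (ip (m (v k) (v l)) (v i) * ip (m (v i) (v j)) x)) *\<^sub>C T k l j)"
      by (simp add: complex_vector.scale_sum_right scaleC_scaleC algebra_simps)
    also have "\<dots> = (\<Sum>i<N. \<Sum>k<N. \<Sum>l<N. \<Sum>j<N.
        (of_real (s * s) * (ip (m (v k) (v l)) (v i) * ip (m (v i) (v j)) x)) *\<^sub>C T k l j)"
      by (intro sum.cong refl sum_rotate3)
    also have "\<dots> = (\<Sum>k<N. \<Sum>l<N. \<Sum>i<N. \<Sum>j<N.
        (of_real (s * s) * (ip (m (v k) (v l)) (v i) * ip (m (v i) (v j)) x)) *\<^sub>C T k l j)"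
      by (rule sum_rotate3)
    also have "\<dots> = (\<Sum>k<N. \<Sum>l<N. \<Sum>j<N. \<Sum>i<N.
        (of_real (s * s) * (ip (m (v k) (v l)) (v i) * ip (m (v i) (v j)) x)) *\<^sub>C T k l j)"
      by (intro sum.cong refl sum.swap)
    also have "\<dots> = (\<Sum>k<N. \<Sum>l<N. \<Sum>j<N. (of_real (s * s) * ip (m (m (v k) (v l)) (v j)) x) *\<^sub>C T k l j)"
      using v_in m_in x
      by (simp add: complex_vector.scale_sum_left[symmetric] sum_distrib_left[symmetric] left)
    finally have lhs: "tensor_assoc V V V (tensor_map V V (tensor_space V V) V \<Delta> id (\<Delta> x))
      = (\<Sum>k<N. \<Sum>l<N. \<Sum>j<N. (of_real (s * s) * ip (m (m (v k) (v l)) (v j)) x) *\<^sub>C T k l j)" .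
    have "tensor_map V V V (tensor_space V V) id \<Delta> (\<Delta> x)
      = (\<Sum>k<N. \<Sum>i<N. (of_real s * ip (m (v k) (v i)) x) *\<^sub>C tens V (tensor_space V V) (v k) (\<Delta> (v i)))"
      unfolding \<Delta>_eq[OF x]
      by (subst linear_on_comb2[OF tensor_map_linear[OF linear_on_id \<Delta>_lin id_im \<Delta>_im]])
        (simp_all add: TS v_in tensor_map_tens[OF linear_on_id \<Delta>_lin id_im \<Delta>_im])
    also have "\<dots> = (\<Sum>k<N. \<Sum>i<N. (of_real s * ip (m (v k) (v i)) x) *\<^sub>C
        (\<Sum>l<N. \<Sum>j<N. (of_real s * ip (m (v l) (v j)) (v i)) *\<^sub>C T k l j))"
    proof -
      have "tens V (tensor_space V V) a (\<Delta> b) = (\<Sum>l<N. \<Sum>j<N. (of_real s * ip (m (v l) (v j)) b) *\<^sub>C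
          tens V (tensor_space V V) a (tens V V (v l) (v j)))" if "a \<in> V" "b \<in> V" for a b
        unfolding \<Delta>_eq[OF that(2)] using v_in
        by (subst linear_on_comb2[OF bilinear_on_right[OF bilinear_on_tens that(1)]])
          (simp_all add: TS)
      then show ?thesis using v_in by (simp add: T_def)
    qed
    also have "\<dots> = (\<Sum>k<N. \<Sum>i<N. \<Sum>l<N. \<Sum>j<N.
        (of_real (s * s) * (ip (m (v l) (v j)) (v i) * ip (m (v k) (v i)) x)) *\<^sub>C T k l j)"
      by (simp add: complex_vector.scale_sum_right scaleC_scaleC algebra_simps)
    also have "\<dots> = (\<Sum>k<N. \<Sum>l<N. \<Sum>j<N. \<Sum>i<N.
        (of_real (s * s) * (ip (m (v l) (v j)) (v i) * ip (m (v k) (v i)) x)) *\<^sub>C T k l j)"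
      by (intro sum.cong refl sum_rotate3)
    also have "\<dots> = (\<Sum>k<N. \<Sum>l<N. \<Sum>j<N. (of_real (s * s) * ip (m (v k) (m (v l) (v j))) x) *\<^sub>C T k l j)"
      using v_in m_in x
      by (simp add: complex_vector.scale_sum_left[symmetric] sum_distrib_left[symmetric] right)
    finally show ?thesis
      using v_in by (simp add: lhs assoc)
  qed
  have q: "of_real q * (of_real r * (of_real s * z)) = z" for z :: complex
  proof -
    have "of_real q * (of_real r * (of_real s * z)) = of_real (q * s * r) * z"
      by (simp add: algebra_simps)
    then show ?thesis by (simp add: norm)
  qed
  have counit_left: "tensor_unit_left V (tensor_map V V UNIV V \<epsilon> id (\<Delta> x)) = x"
    if x: "x \<in> V" for x
  proof -
    have "tensor_unit_left V (tensor_map V V UNIV V \<epsilon> id (\<Delta> x))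
      = (\<Sum>i<N. \<Sum>j<N. (of_real s * ip (m (v i) (v j)) x) *\<^sub>C (\<epsilon> (v i) *\<^sub>C v j))"
      unfolding \<Delta>_eq[OF x] tensor_unit_left_def using v_in
      by (subst linear_on_comb2[OF tensor_map_linear[OF \<epsilon>_lin linear_on_id \<epsilon>_im id_im]],
          simp_all add: TS tensor_map_tens[OF \<epsilon>_lin linear_on_id \<epsilon>_im id_im],
          subst linear_on_comb2[OF tensor_lift_linear[OF bilinear_on_unit_left]],
          simp_all add: TS tensor_lift_tens[OF bilinear_on_unit_left])
    also have "\<dots> = (\<Sum>j<N. \<Sum>i<N. (of_real q * of_real s * (ip u (v i) * ip (m (v i) (v j)) x)) *\<^sub>C v j)"
      using v_in by (subst sum.swap) (simp add: scaleC_scaleC \<epsilon> algebra_simps)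
    also have "\<dots> = (\<Sum>j<N. (of_real q * of_real s * ip (m u (v j)) x) *\<^sub>C v j)"
      using v_in u x
      by (simp add: complex_vector.scale_sum_left[symmetric] sum_distrib_left[symmetric] left)
    also have "\<dots> = (\<Sum>j<N. ip (v j) x *\<^sub>C v j)"
      using v_in x by (simp add: unit ip_scale_left q algebra_simps)
    finally show ?thesis using expand[OF x] by simp
  qed
  have counit_right: "tensor_unit_right V (tensor_map V V V UNIV id \<epsilon> (\<Delta> x)) = x"
    if x: "x \<in> V" for x
  proof -
    have "tensor_unit_right V (tensor_map V V V UNIV id \<epsilon> (\<Delta> x))
      = (\<Sum>i<N. \<Sum>j<N. (of_real s * ip (m (v i) (v j)) x) *\<^sub>C (\<epsilon> (v j) *\<^sub>C v i))"
      unfolding \<Delta>_eq[OF x] tensor_unit_right_def using v_in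
      by (subst linear_on_comb2[OF tensor_map_linear[OF linear_on_id \<epsilon>_lin id_im \<epsilon>_im]],
          simp_all add: TS tensor_map_tens[OF linear_on_id \<epsilon>_lin id_im \<epsilon>_im],
          subst linear_on_comb2[OF tensor_lift_linear[OF bilinear_on_unit_right]],
          simp_all add: TS tensor_lift_tens[OF bilinear_on_unit_right])
    also have "\<dots> = (\<Sum>i<N. \<Sum>j<N. (of_real q * of_real s * (ip u (v j) * ip (m (v i) (v j)) x)) *\<^sub>C v i)"
      using v_in by (simp add: scaleC_scaleC \<epsilon> algebra_simps)
    also have "\<dots> = (\<Sum>i<N. (of_real q * of_real s * ip (m (v i) u) x) *\<^sub>C v i)"
      using v_in u x
      by (simp add: complex_vector.scale_sum_left[symmetric] sum_distrib_left[symmetric] right)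
    also have "\<dots> = (\<Sum>i<N. ip (v i) x *\<^sub>C v i)"
      using v_in x by (simp add: unit ip_scale_left q algebra_simps)
    finally show ?thesis using expand[OF x] by simp
  qed
  show ?thesis
    unfolding coalgebra_def
    using subspace \<Delta>_lin \<Delta>_in \<epsilon>_lin coassoc counit_left counit_right by blast
qed

end

section \<open>The spectral radius of a self-adjoint element\<close>

lemma scaleC_zero_left [simp]: "0 *\<^sub>C (x::'a::complex_vector) = 0"
  and scaleC_zero_right [simp]: "c *\<^sub>C (0::'a::complex_vector) = 0"
  and scaleC_minus_left: "(- c) *\<^sub>C (x::'a::complex_vector) = - (c *\<^sub>C x)"
  and scaleC_minus_right: "c *\<^sub>C (- x) = - (c *\<^sub>C (x::'a::complex_vector))"
  and scaleC_diff_left: "(c - d) *\<^sub>C (x::'a::complex_vector) = c *\<^sub>C x - d *\<^sub>C x"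
  and scaleC_diff_right: "c *\<^sub>C (x - y) = c *\<^sub>C x - c *\<^sub>C (y::'a::complex_vector)"
  by (simp_all add: complex_vector.scale_minus_left complex_vector.scale_minus_right
      complex_vector.scale_left_diff_distrib complex_vector.scale_right_diff_distrib)

lemma scaleC_cancel: "c *\<^sub>C (x::'a::complex_vector) = c *\<^sub>C y \<longleftrightarrow> c = 0 \<or> x = y"
  using complex_vector.scale_cancel_left[of c x y] by auto

lemma norm_scaleC_one: "norm (c *\<^sub>C (1::'a::cstar_algebra)) = cmod c"
  by (simp add: norm_scaleC)

lemma scaleC_one_inject: "c *\<^sub>C (1::'a::cstar_algebra) = d *\<^sub>C 1 \<longleftrightarrow> c = d"
  using complex_vector.scale_cancel_right[of c "1::'a" d] by simp

definition two_sided_unit :: "'a::monoid_mult \<Rightarrow> bool" where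
  "two_sided_unit a \<longleftrightarrow> (\<exists>b. b * a = 1 \<and> a * b = 1)"

lemma not_in_cstar_spectrum_iff: "z \<notin> cstar_spectrum a \<longleftrightarrow> two_sided_unit (a - z *\<^sub>C 1)"
  by (simp add: cstar_spectrum_def two_sided_unit_def)

text \<open>
  The inverse is the Neumann series \<open>\<Sum>\<^sub>n y\<^sup>n\<close>.
\<close>

lemma two_sided_unit_one_minus:
  fixes y :: "'a::cstar_algebra"
  assumes "norm y < 1"
  shows "two_sided_unit (1 - y)"
proof -
  have "summable (\<lambda>n. norm (y ^ n))"
    by (rule summable_comparison_test'[OF summable_geometric[of "norm y"], of 0])
      (use assms norm_power_ineq[of y] in auto)
  then have sm: "summable (\<lambda>n. y ^ n)"
    by (rule summable_norm_cancel)
  have eq: "(\<Sum>n. y ^ n) = 1 + (\<Sum>n. y ^ Suc n)"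
    using suminf_split_head[OF sm] by simp
  have sm': "summable (\<lambda>n. y ^ Suc n)"
    using sm by (subst summable_Suc_iff)
  have "(\<Sum>n. y ^ n) * y = (\<Sum>n. y ^ Suc n)" "y * (\<Sum>n. y ^ n) = (\<Sum>n. y ^ Suc n)"
    using suminf_mult[OF sm, of y] suminf_mult2[OF sm, of y]
    by (simp_all add: power_commutes)
  then have "(\<Sum>n. y ^ n) * (1 - y) = 1" "(1 - y) * (\<Sum>n. y ^ n) = 1"
    using eq by (simp_all add: algebra_simps)
  then show ?thesis
    unfolding two_sided_unit_def by blast
qed

lemma two_sided_unit_scale:
  fixes a :: "'a::cstar_algebra"
  assumes "two_sided_unit a" "c \<noteq> 0"
  shows "two_sided_unit (c *\<^sub>C a)"
proof -
  from assms(1) obtain b where "b * a = 1" "a * b = 1"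
    by (auto simp: two_sided_unit_def)
  then have "((1 / c) *\<^sub>C b) * (c *\<^sub>C a) = 1 \<and> (c *\<^sub>C a) * ((1 / c) *\<^sub>C b) = 1"
    using assms(2) by (simp add: mult_scaleC_left mult_scaleC_right scaleC_scaleC scaleC_one)
  then show ?thesis
    unfolding two_sided_unit_def by blast
qed

lemma cstar_spectrum_bound:
  assumes "z \<in> cstar_spectrum a"
  shows "cmod z \<le> norm a"
proof (rule ccontr)
  assume "\<not> cmod z \<le> norm a"
  then have z: "z \<noteq> 0" "norm a < cmod z"
    by auto
  then have "norm ((1 / z) *\<^sub>C a) < 1"
    by (simp add: norm_scaleC norm_divide field_simps)
  then have "two_sided_unit ((- z) *\<^sub>C (1 - (1 / z) *\<^sub>C a))"
    using z by (intro two_sided_unit_scale two_sided_unit_one_minus) auto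
  moreover have "(- z) *\<^sub>C (1 - (1 / z) *\<^sub>C a) = a - z *\<^sub>C 1"
    using z by (simp add: scaleC_diff_right scaleC_minus_left scaleC_scaleC scaleC_one)
  ultimately show False
    using assms not_in_cstar_spectrum_iff[of z a] by simp
qed

lemma cstar_spectrum_shift_scale:
  assumes "z \<in> cstar_spectrum a" "c \<noteq> 0"
  shows "w + c * z \<in> cstar_spectrum (w *\<^sub>C 1 + c *\<^sub>C a)"
proof (rule ccontr)
  assume "w + c * z \<notin> cstar_spectrum (w *\<^sub>C 1 + c *\<^sub>C a)"
  then have "two_sided_unit (w *\<^sub>C 1 + c *\<^sub>C a - (w + c * z) *\<^sub>C 1)"
    by (simp add: not_in_cstar_spectrum_iff)
  then have "two_sided_unit ((1 / c) *\<^sub>C (w *\<^sub>C 1 + c *\<^sub>C a - (w + c * z) *\<^sub>C 1))"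
    using assms(2) by (intro two_sided_unit_scale) auto
  moreover have "(1 / c) *\<^sub>C (w *\<^sub>C 1 + c *\<^sub>C a - (w + c * z) *\<^sub>C 1) = a - z *\<^sub>C 1"
    using assms(2)
    by (simp add: scaleC_diff_right scaleC_add_left scaleC_scaleC scaleC_one algebra_simps)
  ultimately show False
    using assms(1) not_in_cstar_spectrum_iff[of z a] by simp
qed

lemma cstar_spectrum_shift_scale_iff:
  assumes c: "c \<noteq> 0"
  shows "z \<in> cstar_spectrum (w *\<^sub>C 1 + c *\<^sub>C a) \<longleftrightarrow> (z - w) / c \<in> cstar_spectrum a"
proof
  assume "z \<in> cstar_spectrum (w *\<^sub>C 1 + c *\<^sub>C a)"
  from cstar_spectrum_shift_scale[OF this, of "1 / c" "- w / c"] c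
  have "- w / c + 1 / c * z
      \<in> cstar_spectrum ((- w / c) *\<^sub>C 1 + (1 / c) *\<^sub>C (w *\<^sub>C 1 + c *\<^sub>C a))"
    by simp
  moreover have "(- w / c) *\<^sub>C 1 + (1 / c) *\<^sub>C (w *\<^sub>C 1 + c *\<^sub>C a) = a"
    using c by (simp add: scaleC_add_right scaleC_scaleC scaleC_one scaleC_minus_left)
  moreover have "- w / c + 1 / c * z = (z - w) / c"
    by (simp add: diff_divide_distrib)
  ultimately show "(z - w) / c \<in> cstar_spectrum a"
    by simp
next
  assume "(z - w) / c \<in> cstar_spectrum a"
  from cstar_spectrum_shift_scale[OF this c, of w] c
  show "z \<in> cstar_spectrum (w *\<^sub>C 1 + c *\<^sub>C a)"
    by simp
qed

lemma scalar_minus_mult_sum: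
  fixes x :: "'a::cstar_algebra"
  shows "(z *\<^sub>C 1 - x) * (\<Sum>j<n. z ^ j *\<^sub>C x ^ (n - Suc j)) = z ^ n *\<^sub>C 1 - x ^ n"
proof (induction n)
  case (Suc n)
  have "(\<Sum>j<Suc n. z ^ j *\<^sub>C x ^ (Suc n - Suc j))
      = x ^ n + (\<Sum>j<n. z ^ Suc j *\<^sub>C x ^ (n - Suc j))"
    by (subst sum.lessThan_Suc_shift) (simp add: scaleC_one)
  also have "(\<Sum>j<n. z ^ Suc j *\<^sub>C x ^ (n - Suc j)) = z *\<^sub>C (\<Sum>j<n. z ^ j *\<^sub>C x ^ (n - Suc j))"
    by (simp add: complex_vector.scale_sum_right scaleC_scaleC)
  finally have "(z *\<^sub>C 1 - x) * (\<Sum>j<Suc n. z ^ j *\<^sub>C x ^ (Suc n - Suc j))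
      = (z *\<^sub>C 1 - x) * x ^ n + z *\<^sub>C (z ^ n *\<^sub>C 1 - x ^ n)"
    using Suc by (simp add: distrib_left mult_scaleC_right)
  then show ?case
    by (simp add: left_diff_distrib mult_scaleC_left scaleC_diff_right scaleC_scaleC)
qed simp

lemma sum_powers_unity_root:
  assumes "0 < m" "m < n"
  shows "(\<Sum>k<n. cis (2 * pi * real k / real n) ^ m) = 0"
proof -
  define q where "q = cis (2 * pi * real m / real n)"
  have "cis (2 * pi * real k / real n) ^ m = q ^ k" for k
    by (simp add: q_def Complex.DeMoivre mult_ac)
  moreover have "q \<noteq> 1"
  proof
    assume "q = 1"
    then obtain i :: int where i: "2 * pi * real m / real n = of_int i * (2 * pi)"
      unfolding q_def cis_conv_exp exp_eq_1 by auto
    then have "real m = of_int i * real n"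
      using assms by (simp add: field_simps)
    then have "int m = i * int n"
      by (metis of_int_eq_iff of_int_mult of_int_of_nat_eq)
    then show False
      using assms
      by (metis dvd_triv_right int_dvd_int_iff nat_dvd_not_less)
  qed
  moreover have "q ^ n = 1"
    using assms by (simp add: q_def Complex.DeMoivre cis_multiple_2pi)
  ultimately show ?thesis
    by (simp add: geometric_sum)
qed

text \<open>
  Here \<open>h k\<close> stands for \<open>z (z - x)\<^sup>-\<^sup>1\<close> at \<open>z = r \<omega>\<^sup>k\<close>, with \<open>\<omega>\<close> a primitive \<open>n\<close>-th root of unity. By the
  geometric sum, \<open>z (z - x)\<^sup>-\<^sup>1 (z\<^sup>n - x\<^sup>n)\<close> is the sum of the \<open>z\<^sup>j\<^sup>+\<^sup>1 x\<^sup>n\<^sup>-\<^sup>1\<^sup>-\<^sup>j\<close> with \<open>j < n\<close>, and averaging over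
  \<open>k\<close> removes all terms but that with \<open>j = n - 1\<close>.
\<close>

lemma resolvent_average:
  fixes x :: "'a::cstar_algebra"
  assumes h: "\<And>k. k < n \<Longrightarrow> h k * (complex_of_real r * cis (2 * pi * real k / real n)) *\<^sub>C 1 - h k * x
      = (complex_of_real r * cis (2 * pi * real k / real n)) *\<^sub>C 1"
    and n: "0 < n"
  shows "((1 / of_nat n) *\<^sub>C (\<Sum>k<n. h k)) * ((complex_of_real r) ^ n *\<^sub>C 1 - x ^ n)
    = (complex_of_real r) ^ n *\<^sub>C 1"
proof -
  define w where "w k = cis (2 * pi * real k / real n)" for k
  have wn: "w k ^ n = 1" for k
    using n by (simp add: w_def Complex.DeMoivre cis_multiple_2pi)
  define R where "R = complex_of_real r"
  have "h k * (R ^ n *\<^sub>C 1 - x ^ n) = (\<Sum>j<n. (R ^ Suc j * w k ^ Suc j) *\<^sub>C x ^ (n - Suc j))"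
    if "k < n" for k
  proof -
    have "h k * (R ^ n *\<^sub>C 1 - x ^ n)
        = h k * ((R * w k) *\<^sub>C 1 - x) * (\<Sum>j<n. (R * w k) ^ j *\<^sub>C x ^ (n - Suc j))"
      using scalar_minus_mult_sum[of "R * w k" x n]
      by (simp add: mult.assoc power_mult_distrib wn)
    also have "h k * ((R * w k) *\<^sub>C 1 - x) = (R * w k) *\<^sub>C 1"
      using h[OF that] by (simp add: R_def w_def right_diff_distrib)
    finally show ?thesis
      by (simp add: mult_scaleC_left complex_vector.scale_sum_right scaleC_scaleC
          power_mult_distrib mult_ac)
  qed
  then have "(\<Sum>k<n. h k) * (R ^ n *\<^sub>C 1 - x ^ n)
      = (\<Sum>k<n. \<Sum>j<n. (R ^ Suc j * w k ^ Suc j) *\<^sub>C x ^ (n - Suc j))"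
    by (simp add: sum_distrib_right del: power_Suc)
  also have "\<dots> = (\<Sum>j<n. \<Sum>k<n. (R ^ Suc j * w k ^ Suc j) *\<^sub>C x ^ (n - Suc j))"
    by (rule sum.swap)
  also have "\<dots> = (\<Sum>j<n. (R ^ Suc j * (\<Sum>k<n. w k ^ Suc j)) *\<^sub>C x ^ (n - Suc j))"
    by (simp only: sum_distrib_left complex_vector.scale_sum_left)
  also have "\<dots> = (\<Sum>j<n. if j = n - 1 then (R ^ n * of_nat n) *\<^sub>C 1 else 0)"
  proof (rule sum.cong[OF refl])
    fix j assume "j \<in> {..<n}"
    show "(R ^ Suc j * (\<Sum>k<n. w k ^ Suc j)) *\<^sub>C x ^ (n - Suc j)
        = (if j = n - 1 then (R ^ n * of_nat n) *\<^sub>C 1 else 0)"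
    proof (cases "j = n - 1")
      case True
      then have "Suc j = n" using n by simp
      then show ?thesis using True by (simp add: wn del: power_Suc)
    next
      case False
      then have "Suc j < n" using \<open>j \<in> {..<n}\<close> by auto
      then show ?thesis
        using False sum_powers_unity_root[of "Suc j" n] by (simp add: w_def del: power_Suc)
    qed
  qed
  also have "\<dots> = (R ^ n * of_nat n) *\<^sub>C 1"
    using n by simp
  finally have "(\<Sum>k<n. h k) * (R ^ n *\<^sub>C 1 - x ^ n) = (R ^ n * of_nat n) *\<^sub>C 1" .
  then show ?thesis
    using n by (simp add: mult_scaleC_left scaleC_scaleC R_def)
qed


text \<open>
  The spectral radius formula, by Rickart's real-variable argument. The averages of
  \<open>z (z - x)\<^sup>-\<^sup>1\<close> over the vertices of a regular polygon of radius \<open>r\<close> are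
  \<open>(1 - (x / r)\<^sup>n)\<^sup>-\<^sup>1\<close>, and they are Lipschitz in \<open>r\<close> with a constant independent of \<open>n\<close>. Hence if
  \<open>(x / r)\<^sup>n\<close> tends to \<open>0\<close> at one radius, \<open>(x / s)\<^sup>n\<close> is a strict contraction for some \<open>n\<close> at all
  radii \<open>s\<close> closer than a fixed distance, and one steps from a large radius down to \<open>\<rho>\<close>.
\<close>

lemma spectral_radius_bound:
  fixes x :: "'a::cstar_algebra"
  assumes \<rho>: "0 < \<rho>" and res: "\<And>z. \<rho> \<le> cmod z \<Longrightarrow> z \<notin> cstar_spectrum x"
  shows "\<exists>n>0. norm (x ^ n) < \<rho> ^ n"
proof -
  define R where "R z = (SOME b. b * (x - z *\<^sub>C 1) = 1 \<and> (x - z *\<^sub>C 1) * b = 1)" for z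
  have R: "R z * (x - z *\<^sub>C 1) = 1" "(x - z *\<^sub>C 1) * R z = 1" if "\<rho> \<le> cmod z" for z
  proof -
    have "\<exists>b. b * (x - z *\<^sub>C 1) = 1 \<and> (x - z *\<^sub>C 1) * b = 1"
      using res[OF that] by (simp add: not_in_cstar_spectrum_iff two_sided_unit_def)
    from someI_ex[OF this] show "R z * (x - z *\<^sub>C 1) = 1" "(x - z *\<^sub>C 1) * R z = 1"
      by (simp_all add: R_def)
  qed
  have resolvent_eq: "R w - R z = (w - z) *\<^sub>C (R w * R z)" if "\<rho> \<le> cmod w" "\<rho> \<le> cmod z" for w z
  proof -
    have "R w - R z = R w * ((x - z *\<^sub>C 1) * R z) - (R w * (x - w *\<^sub>C 1)) * R z"
      using R that by simp
    also have "\<dots> = R w * ((x - z *\<^sub>C 1) - (x - w *\<^sub>C 1)) * R z"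
      by (simp add: left_diff_distrib right_diff_distrib mult.assoc)
    also have "(x - z *\<^sub>C 1) - (x - w *\<^sub>C 1) = (w - z) *\<^sub>C 1"
      by (simp add: scaleC_diff_left)
    finally show ?thesis
      by (simp add: mult_scaleC_left mult_scaleC_right)
  qed
  have R_dist: "norm (R w - R z) \<le> cmod (w - z) * (norm (R w) * norm (R z))"
    if "\<rho> \<le> cmod w" "\<rho> \<le> cmod z" for w z
    unfolding resolvent_eq[OF that]
    by (simp add: norm_scaleC mult_left_mono norm_mult_ineq)
  define \<rho>' where "\<rho>' = \<rho> + norm x + 1"
  define Z where "Z = {z::complex. \<rho> \<le> cmod z \<and> cmod z \<le> \<rho>'}"
  have "continuous_on Z R"
  proof (rule continuous_onI)
    fix z and e :: real
    assume "z \<in> Z" "0 < e"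
    define M where "M = norm (R z) + 1"
    have M: "0 < M" "norm (R z) \<le> M"
      by (auto simp: M_def add_nonneg_pos)
    define d where "d = min (1 / (2 * M)) (e / (4 * M ^ 2))"
    have "0 < d"
      using M \<open>0 < e\<close> by (auto simp: d_def)
    moreover have "dist (R w) (R z) \<le> e" if "w \<in> Z" "dist w z < d" for w
    proof -
      have wz: "\<rho> \<le> cmod w" "\<rho> \<le> cmod z"
        using \<open>z \<in> Z\<close> that by (auto simp: Z_def)
      have small: "cmod (w - z) \<le> 1 / (2 * M)" "cmod (w - z) \<le> e / (4 * M ^ 2)"
        using that(2) by (auto simp: d_def dist_norm)
      have "norm (R w) \<le> norm (R z) + norm (R w - R z)"
        using norm_triangle_ineq[of "R z" "R w - R z"] by simp
      also have "norm (R w - R z) \<le> cmod (w - z) * (norm (R w) * norm (R z))"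
        by (rule R_dist[OF wz])
      also have "\<dots> \<le> 1 / (2 * M) * (norm (R w) * M)"
        using small(1) M by (intro mult_mono) auto
      also have "\<dots> = norm (R w) / 2"
        using M by simp
      finally have Rw: "norm (R w) \<le> 2 * M"
        using M by simp
      have "norm (R w - R z) \<le> cmod (w - z) * (norm (R w) * norm (R z))"
        by (rule R_dist[OF wz])
      also have "\<dots> \<le> e / (4 * M ^ 2) * (2 * M * M)"
        using small(2) M Rw \<open>0 < e\<close> by (intro mult_mono) auto
      also have "\<dots> \<le> e"
        using M \<open>0 < e\<close> by (simp add: power2_eq_square)
      finally show ?thesis
        by (simp add: dist_norm)
    qed
    ultimately show "\<exists>d>0. \<forall>w\<in>Z. dist w z < d \<longrightarrow> dist (R w) (R z) \<le> e"
      by blast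
  qed
  moreover have "compact Z"
  proof -
    have "Z = cball 0 \<rho>' - ball 0 \<rho>"
      by (auto simp: Z_def)
    then show ?thesis
      using compact_diff[OF compact_cball open_ball] by metis
  qed
  ultimately have "bounded (R ` Z)"
    by (intro compact_imp_bounded compact_continuous_image)
  then obtain K where K: "K > 0" "\<And>z. z \<in> Z \<Longrightarrow> norm (R z) \<le> K"
    unfolding bounded_pos by blast
  \<comment> \<open>This is \<open>z (z - x)\<^sup>-\<^sup>1\<close>, since \<open>R z\<close> inverts \<open>x - z\<close>.\<close>
  define h where "h z = - (z *\<^sub>C R z)" for z
  have h: "h z * z *\<^sub>C 1 - h z * x = z *\<^sub>C 1" if "z \<in> Z" for z
  proof -
    have "h z * z *\<^sub>C 1 - h z * x = z *\<^sub>C (R z * (x - z *\<^sub>C 1))"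
      by (simp add: h_def mult_scaleC_left mult_scaleC_right scaleC_diff_right right_diff_distrib)
    then show ?thesis
      using R that by (simp add: Z_def)
  qed
  define L where "L = K + \<rho>' * K ^ 2"
  have L: "L > 0"
    using K \<rho> by (auto simp: L_def \<rho>'_def intro!: add_pos_nonneg)
  have h_dist: "norm (h w - h z) \<le> L * cmod (w - z)" if "w \<in> Z" "z \<in> Z" for w z
  proof -
    have "h w - h z = - ((w - z) *\<^sub>C R w + z *\<^sub>C (R w - R z))"
      by (simp add: h_def scaleC_diff_left scaleC_diff_right)
    then have "norm (h w - h z) \<le> norm ((w - z) *\<^sub>C R w) + norm (z *\<^sub>C (R w - R z))"
      by (simp only: norm_minus_cancel) (rule norm_triangle_ineq)
    also have "\<dots> \<le> cmod (w - z) * K + \<rho>' * (cmod (w - z) * (K * K))"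
      unfolding norm_scaleC
    proof (intro add_mono mult_mono)
      have "norm (R w - R z) \<le> cmod (w - z) * (norm (R w) * norm (R z))"
        using that by (intro R_dist) (auto simp: Z_def)
      also have "\<dots> \<le> cmod (w - z) * (K * K)"
        using K that by (intro mult_mono) auto
      finally show "norm (R w - R z) \<le> cmod (w - z) * (K * K)" .
    qed (use K that \<rho> in \<open>auto simp: Z_def \<rho>'_def\<close>)
    finally show ?thesis
      by (simp add: L_def algebra_simps power2_eq_square)
  qed
  define p where "p n k r = complex_of_real r * cis (2 * pi * real k / real n)" for n k :: nat and r
  define G where "G n r = (1 / of_nat n) *\<^sub>C (\<Sum>k<n. h (p n k r))" for n r
  have p_in: "p n k r \<in> Z" if "\<rho> \<le> r" "r \<le> \<rho>'" for n k r
    using that \<rho> by (simp add: p_def Z_def norm_mult)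
  have G_eq: "G n r * (1 - (1 / of_real r) ^ n *\<^sub>C x ^ n) = 1"
    if "\<rho> \<le> r" "r \<le> \<rho>'" "0 < n" for n r
  proof -
    have "G n r * ((complex_of_real r) ^ n *\<^sub>C 1 - x ^ n) = (complex_of_real r) ^ n *\<^sub>C 1"
      unfolding G_def using h[OF p_in[OF that(1,2)]] that(3)
      by (intro resolvent_average) (simp_all add: p_def)
    then have "(1 / complex_of_real r) ^ n *\<^sub>C (G n r * ((complex_of_real r) ^ n *\<^sub>C 1 - x ^ n))
        = (1 / complex_of_real r) ^ n *\<^sub>C (complex_of_real r) ^ n *\<^sub>C 1"
      by simp
    moreover have "(1 / complex_of_real r) ^ n * (complex_of_real r) ^ n = 1"
      using that \<rho> by (simp add: power_mult_distrib[symmetric])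
    ultimately show ?thesis
      by (simp add: mult_scaleC_right[symmetric] scaleC_diff_right scaleC_scaleC scaleC_one)
  qed
  have G_dist: "norm (G n s - G n r) \<le> L * \<bar>s - r\<bar>"
    if "\<rho> \<le> r" "r \<le> \<rho>'" "\<rho> \<le> s" "s \<le> \<rho>'" "0 < n" for n r s
  proof -
    have "G n s - G n r = (1 / of_nat n) *\<^sub>C (\<Sum>k<n. h (p n k s) - h (p n k r))"
      by (simp add: G_def scaleC_diff_right sum_subtractf)
    then have "norm (G n s - G n r) = 1 / real n * norm (\<Sum>k<n. h (p n k s) - h (p n k r))"
      by (simp add: norm_scaleC norm_divide)
    also have "\<dots> \<le> 1 / real n * (\<Sum>k<n. L * \<bar>s - r\<bar>)"
    proof (intro mult_left_mono sum_norm_le)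
      fix k
      have "norm (h (p n k s) - h (p n k r)) \<le> L * cmod (p n k s - p n k r)"
        using that by (intro h_dist p_in)
      also have "p n k s - p n k r = of_real (s - r) * cis (2 * pi * real k / real n)"
        by (simp add: p_def algebra_simps)
      finally show "norm (h (p n k s) - h (p n k r)) \<le> L * \<bar>s - r\<bar>"
        by (simp add: norm_mult del: of_real_diff)
    qed simp
    also have "\<dots> = L * \<bar>s - r\<bar>"
      using that by simp
    finally show ?thesis .
  qed
  define S where "S = {r. \<exists>n>0. norm (x ^ n) < r ^ n}"
  \<comment> \<open>Choose a power \<open>m\<close> with \<open>\<parallel>(x / r)\<^sup>m\<parallel> \<le> 1/8\<close>. Then \<open>G m r\<close> is within \<open>1/7\<close> of \<open>1\<close>, and \<open>G m s\<close> within
    \<open>1/7 + 1/4 = 11/28\<close>. As this is less than \<open>1/2\<close>, solving for \<open>(x / s)\<^sup>m\<close> gives norm at most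
    \<open>(11/28) / (1 - 11/28) = 11/17 < 1\<close>.\<close>
  have step: "s \<in> S" if "r \<in> S" "\<rho> \<le> r" "r \<le> \<rho>'" "\<rho> \<le> s" "s \<le> \<rho>'" "L * \<bar>s - r\<bar> \<le> 1 / 4" for r s
  proof -
    from \<open>r \<in> S\<close> obtain n where n: "n > 0" "norm (x ^ n) < r ^ n"
      by (auto simp: S_def)
    have r: "r > 0" and s: "s > 0"
      using that \<rho> by auto
    define q where "q = norm (x ^ n) / r ^ n"
    have q: "0 \<le> q" "q < 1"
      using n r by (auto simp: q_def)
    then obtain k where k: "q ^ k < 1 / 8"
      using real_arch_pow_inv[of "1/8" q] by auto
    have k0: "k > 0"
      using k by (cases k) auto
    define m where "m = n * k"
    have m: "m > 0"
      using n k0 by (simp add: m_def)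
    define y where "y t = (1 / complex_of_real t) ^ m *\<^sub>C x ^ m" for t
    have norm_y: "norm (y t) = norm (x ^ m) / t ^ m" if "t > 0" for t
      using that by (simp add: y_def norm_scaleC norm_power norm_divide power_one_over)
    have "norm (x ^ m) \<le> norm (x ^ n) ^ k"
      unfolding m_def power_mult by (rule norm_power_ineq)
    then have "norm (y r) \<le> q ^ k"
      using r by (simp add: norm_y q_def m_def power_mult power_divide divide_right_mono)
    then have yr: "norm (y r) \<le> 1 / 8"
      using k by simp
    have Gr: "G m r = 1 + G m r * y r" and Gs: "G m s - 1 = G m s * y s"
      using G_eq[of r m] G_eq[of s m] that m by (simp_all add: y_def algebra_simps)
    have "norm (G m r) \<le> 1 + norm (G m r * y r)"
      by (subst Gr) (metis norm_one norm_triangle_ineq)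
    also have "norm (G m r * y r) \<le> norm (G m r) * (1 / 8)"
      using norm_mult_ineq[of "G m r" "y r"] yr
      by (meson mult_left_mono norm_ge_zero order_trans)
    finally have Gr_le: "norm (G m r) \<le> 8 / 7"
      by simp
    have "norm (G m r - 1) = norm (G m r * y r)"
      using Gr by (metis add_diff_cancel_left')
    also have "\<dots> \<le> norm (G m r) * norm (y r)"
      by (rule norm_mult_ineq)
    also have "\<dots> \<le> 8 / 7 * (1 / 8)"
      by (rule mult_mono[OF Gr_le yr]) auto
    finally have "norm (G m r - 1) \<le> 8 / 7 * (1 / 8)" .
    moreover have "norm (G m s - G m r) \<le> 1 / 4"
      using G_dist[of r s m] that m by simp
    moreover have "norm (G m s - 1) \<le> norm (G m s - G m r) + norm (G m r - 1)"
      using norm_triangle_ineq[of "G m s - G m r" "G m r - 1"] by simp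
    ultimately have Gs1: "norm (G m s - 1) \<le> 11 / 28"
      by simp
    have "y s = (G m s - 1) - (G m s - 1) * y s"
      using Gs by (simp add: algebra_simps)
    then have "norm (y s) \<le> norm (G m s - 1) + norm ((G m s - 1) * y s)"
      by (metis norm_triangle_ineq4)
    also have "norm ((G m s - 1) * y s) \<le> 11 / 28 * norm (y s)"
      using norm_mult_ineq[of "G m s - 1" "y s"] Gs1
      by (meson mult_right_mono norm_ge_zero order_trans)
    finally have "norm (y s) \<le> 11 / 17"
      using Gs1 by simp
    then have "norm (y s) < 1"
      by simp
    then have "norm (x ^ m) < s ^ m"
      using s by (simp add: norm_y)
    then show ?thesis
      using m by (auto simp: S_def)
  qed
  have top: "\<rho>' \<in> S"
    unfolding S_def using \<rho> by (auto simp: \<rho>'_def intro!: exI[of _ 1])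
  \<comment> \<open>Descend from \<open>\<rho>'\<close> in steps of \<open>1 / (4 L)\<close>, the last one being cut off at \<open>\<rho>\<close>.\<close>
  have "max \<rho> (\<rho>' - real j * (1 / (4 * L))) \<in> S" for j
  proof (induction j)
    case 0
    have "max \<rho> \<rho>' = \<rho>'"
      by (simp add: \<rho>'_def add_nonneg_nonneg)
    then show ?case
      using top by simp
  next
    case (Suc j)
    let ?d = "1 / (4 * L)"
    let ?r = "max \<rho> (\<rho>' - real j * ?d)" and ?s = "max \<rho> (\<rho>' - real (Suc j) * ?d)"
    have d: "?d > 0"
      using L by simp
    have "\<rho> \<le> \<rho>'"
      by (simp add: \<rho>'_def)
    moreover have "\<bar>max \<rho> (a - (u + d)) - max \<rho> (a - u)\<bar> \<le> d" if "d \<ge> 0" for a u d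
      using that by (auto simp: max_def)
    from this[of ?d \<rho>' "real j * ?d"] d have "\<bar>?s - ?r\<bar> \<le> ?d"
      by (simp only: of_nat_Suc distrib_right mult_1 add.commute less_imp_le)
    then have "L * \<bar>?s - ?r\<bar> \<le> L * ?d"
      using L by (intro mult_left_mono) auto
    then have "L * \<bar>?s - ?r\<bar> \<le> 1 / 4"
      using L by simp
    moreover have "real j * ?d \<ge> 0" "real (Suc j) * ?d \<ge> 0"
      using d by auto
    ultimately show ?case
      by (intro step[OF Suc.IH]) auto
  qed
  moreover obtain j where "(\<rho>' - \<rho>) / (1 / (4 * L)) \<le> real j"
    using real_arch_simple by blast
  then have "\<rho>' - real j * (1 / (4 * L)) \<le> \<rho>"
    using L by (simp add: field_simps)
  ultimately have "\<rho> \<in> S"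
    by (metis max.absorb1)
  then show ?thesis
    by (simp add: S_def)
qed

text \<open>
  Were the spectrum empty, \<open>x\<close> would have an inverse \<open>b\<close>, and the spectral radius formula would make
  \<open>\<parallel>x\<^sup>n\<parallel> < \<parallel>b\<parallel>\<^sup>-\<^sup>n\<close> for some \<open>n\<close>, contrary to \<open>b\<^sup>n x\<^sup>n = 1\<close>.
\<close>

lemma cstar_spectrum_nonempty: "cstar_spectrum (x :: 'a::cstar_algebra) \<noteq> {}"
proof
  assume e: "cstar_spectrum x = {}"
  then have "0 \<notin> cstar_spectrum x"
    by simp
  then obtain b where b: "b * x = 1" "x * b = 1"
    by (auto simp: cstar_spectrum_def)
  then have b0: "norm b > 0"
    by auto
  obtain n where n: "n > 0" "norm (x ^ n) < (1 / norm b) ^ n"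
    using spectral_radius_bound[of "1 / norm b" x] b0 e by auto
  have "b ^ n * x ^ n = 1"
    using b(1)
  proof (induction n)
    case (Suc n)
    have "b ^ Suc n * x ^ Suc n = b ^ n * (b * x) * x ^ n"
      by (simp only: power_Suc2[of b] power_Suc[of x] mult.assoc)
    then show ?case
      using Suc by simp
  qed simp
  then have "1 \<le> norm (b ^ n) * norm (x ^ n)"
    by (metis norm_mult_ineq norm_one)
  also have "\<dots> \<le> norm b ^ n * norm (x ^ n)"
    by (intro mult_right_mono norm_power_ineq) auto
  also have "\<dots> < norm b ^ n * (1 / norm b) ^ n"
    using n b0 by (intro mult_strict_left_mono) auto
  also have "\<dots> = 1"
    using b0 by (simp add: power_one_over)
  finally show False
    by simp
qed


section \<open>Centres of simple algebras\<close>

lemma star_zero [simp]: "star (0::'a::cstar_algebra) = 0"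
  using star_add[of "0::'a" 0] by simp

lemma star_one [simp]: "star (1::'a::cstar_algebra) = 1"
  using star_mult[of "star (1::'a)" 1] star_star[of "1::'a"] by simp

lemma star_minus: "star (- x) = - star (x::'a::cstar_algebra)"
  using star_add[of x "- x"] by (simp add: eq_neg_iff_add_eq_0 add.commute)

lemma star_diff: "star (x - y) = star x - star (y::'a::cstar_algebra)"
  using star_add[of x "- y"] by (simp add: star_minus)

lemma star_sum: "star (\<Sum>i\<in>I. f i) = (\<Sum>i\<in>I. star (f i :: 'a::cstar_algebra))"
  by (induction I rule: infinite_finite_induct) (simp_all add: star_add)

lemma star_scaleR: "star (r *\<^sub>R x) = r *\<^sub>R star (x::'a::cstar_algebra)"
  by (simp add: scaleR_scaleC star_scaleC)

lemma star_power: "star (x ^ n) = star (x::'a::cstar_algebra) ^ n"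
  by (induction n) (simp_all add: star_mult power_commutes)

lemma norm_star: "norm (star x) = norm (x::'a::cstar_algebra)"
proof -
  have le: "norm y \<le> norm (star y)" for y :: 'a
  proof (cases "y = 0")
    case False
    have "norm y * norm y \<le> norm (star y) * norm y"
      using norm_star_mult[of y] norm_mult_ineq[of "star y" y] by (simp add: power2_eq_square)
    then show ?thesis
      using False by simp
  qed simp
  from le[of x] le[of "star x"] show ?thesis
    by (simp add: star_star)
qed

lemma star_inject: "star x = star y \<longleftrightarrow> x = (y::'a::cstar_algebra)"
  by (metis star_star)

text \<open>
  Subtract a spectral value \<open>z\<close> from the central element. If the difference did not vanish, the closed
  ideal that it generates would be the whole algebra, some multiple of it would be close to \<open>1\<close>, and
  it would be invertible.
\<close>

lemma simple_cstar_centre_scalar: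
  assumes B: "cstar_subalgebra B" and simple: "simple_cstar B"
    and c: "c \<in> B" "\<And>b. b \<in> B \<Longrightarrow> b * c = c * b"
  shows "\<exists>z. c = z *\<^sub>C 1"
proof -
  from B have B': "complex_vector.subspace B" "closed B" "1 \<in> B"
    "\<And>x y. x \<in> B \<Longrightarrow> y \<in> B \<Longrightarrow> x * y \<in> B"
    by (auto simp: cstar_subalgebra_def)
  obtain z where z: "z \<in> cstar_spectrum c"
    using cstar_spectrum_nonempty by blast
  define d where "d = c - z *\<^sub>C 1"
  have d: "d \<in> B" "\<And>b. b \<in> B \<Longrightarrow> b * d = d * b"
    using c B' by (auto simp: d_def complex_vector.subspace_diff complex_vector.subspace_scale
        right_diff_distrib left_diff_distrib mult_scaleC_left mult_scaleC_right)
  have "d = 0"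
  proof (rule ccontr)
    assume "d \<noteq> 0"
    define I where "I = closure ((\<lambda>b. d * b) ` B)"
    have lim: "x \<in> I \<longleftrightarrow> (\<exists>f. (\<forall>n. f n \<in> B) \<and> (\<lambda>n. d * f n) \<longlonglongrightarrow> x)" for x
    proof
      assume "x \<in> I"
      then obtain g where "\<forall>n. g n \<in> (\<lambda>b. d * b) ` B" "g \<longlonglongrightarrow> x"
        unfolding I_def closure_sequential by blast
      then have "\<forall>n. \<exists>b\<in>B. g n = d * b"
        by blast
      then obtain f where "\<forall>n. f n \<in> B \<and> g n = d * f n"
        by metis
      moreover from this have "g = (\<lambda>n. d * f n)"
        by auto
      ultimately show "\<exists>f. (\<forall>n. f n \<in> B) \<and> (\<lambda>n. d * f n) \<longlonglongrightarrow> x"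
        using \<open>g \<longlonglongrightarrow> x\<close> by blast
    next
      assume "\<exists>f. (\<forall>n. f n \<in> B) \<and> (\<lambda>n. d * f n) \<longlonglongrightarrow> x"
      then obtain f where "\<forall>n. f n \<in> B" "(\<lambda>n. d * f n) \<longlonglongrightarrow> x"
        by blast
      then show "x \<in> I"
        unfolding I_def closure_sequential by (intro exI[of _ "\<lambda>n. d * f n"]) auto
    qed
    have "I \<subseteq> B"
      unfolding I_def using B' d by (intro closure_minimal) auto
    moreover have "complex_vector.subspace I"
    proof (rule complex_vector.subspaceI)
      show "0 \<in> I"
        unfolding lim using B' by (intro exI[of _ "\<lambda>_. 0"]) (auto simp: complex_vector.subspace_0)
    next
      fix x y assume "x \<in> I" "y \<in> I"
      then obtain f g where "\<forall>n. f n \<in> B" "(\<lambda>n. d * f n) \<longlonglongrightarrow> x" "\<forall>n. g n \<in> B" "(\<lambda>n. d * g n) \<longlonglongrightarrow> y"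
        unfolding lim by blast
      then show "x + y \<in> I"
        unfolding lim using B' tendsto_add[of "\<lambda>n. d * f n" x sequentially "\<lambda>n. d * g n" y]
        by (intro exI[of _ "\<lambda>n. f n + g n"]) (auto simp: complex_vector.subspace_add distrib_left)
    next
      fix k x assume "x \<in> I"
      then obtain f where f: "\<forall>n. f n \<in> B" "(\<lambda>n. d * f n) \<longlonglongrightarrow> x"
        unfolding lim by blast
      have "(\<lambda>n. k *\<^sub>C 1 * (d * f n)) \<longlonglongrightarrow> k *\<^sub>C 1 * x"
        by (intro tendsto_intros f)
      then show "k *\<^sub>C x \<in> I"
        unfolding lim using B' f(1)
        by (intro exI[of _ "\<lambda>n. k *\<^sub>C f n"])
          (auto simp: complex_vector.subspace_scale mult_scaleC_left mult_scaleC_right)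
    qed
    moreover have "a * x \<in> I \<and> x * a \<in> I" if "a \<in> B" "x \<in> I" for a x
    proof -
      from that obtain f where f: "\<And>n. f n \<in> B" "(\<lambda>n. d * f n) \<longlonglongrightarrow> x"
        unfolding lim by blast
      have "(\<lambda>n. a * (d * f n)) \<longlonglongrightarrow> a * x" "(\<lambda>n. d * f n * a) \<longlonglongrightarrow> x * a"
        by (intro tendsto_intros f)+
      moreover have "a * (d * f n) = d * (a * f n)" "d * f n * a = d * (f n * a)" for n
        using d(2)[OF that(1)] by (simp_all add: mult.assoc[symmetric])
      ultimately show ?thesis
        unfolding lim using B' f(1) that
        by (intro conjI, intro exI[of _ "\<lambda>n. a * f n"], simp, intro exI[of _ "\<lambda>n. f n * a"], simp)
    qed
    moreover have "closed I"
      by (simp add: I_def)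
    ultimately have "I = {0} \<or> I = B"
      using simple unfolding simple_cstar_def by blast
    moreover have "d \<in> I"
      unfolding I_def using closure_subset B'(3) by (auto intro!: subsetD[OF closure_subset] image_eqI[of _ _ 1])
    ultimately have "1 \<in> I"
      using \<open>d \<noteq> 0\<close> B'(3) by auto
    then obtain b where b: "b \<in> B" "dist (d * b) 1 < 1"
      unfolding I_def closure_approachable by (metis imageE zero_less_one)
    then have "two_sided_unit (1 - (1 - d * b))"
      by (intro two_sided_unit_one_minus) (simp add: dist_norm norm_minus_commute)
    then obtain e where e: "e * (d * b) = 1" "d * b * e = 1"
      by (auto simp: two_sided_unit_def)
    have "e * b * d = 1"
      using e(1) d(2)[OF b(1)] by (simp add: mult.assoc)
    moreover have "d * (b * e) = 1"
      using e(2) by (simp add: mult.assoc)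
    moreover have "e * b = b * e"
      using calculation by (metis mult.assoc mult_1_left mult_1_right)
    ultimately have "two_sided_unit d"
      unfolding two_sided_unit_def by metis
    then show False
      using z not_in_cstar_spectrum_iff[of z c] by (simp add: d_def)
  qed
  then show ?thesis
    by (auto simp: d_def)
qed

section \<open>Norm estimates for positive elements\<close>

text \<open>
  The \<open>C\<^sup>*\<close>-identity gives equality for exponents that are powers of two; an exponent \<open>n\<close> is squeezed
  below \<open>2\<^sup>n\<close> by submultiplicativity.
\<close>

lemma norm_power_selfadjoint:
  fixes x :: "'a::cstar_algebra"
  assumes "star x = x"
  shows "norm (x ^ n) = norm x ^ n"
proof -
  have pow2: "norm (x ^ (2 ^ k)) = norm x ^ (2 ^ k)" for k
  proof (induction k)
    case (Suc k)
    have "x ^ 2 ^ Suc k = star (x ^ 2 ^ k) * x ^ 2 ^ k"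
      using assms by (simp add: star_power power_add[symmetric] mult_2)
    then show ?case
      using Suc by (simp add: norm_star_mult power_mult[symmetric] mult.commute)
  qed simp
  have le: "n \<le> 2 ^ n"
    by (simp add: less_imp_le)
  show ?thesis
  proof (cases "x = 0")
    case False
    have "norm x ^ n * norm x ^ (2 ^ n - n) = norm (x ^ 2 ^ n)"
      using le by (simp add: pow2 power_add[symmetric])
    also have "x ^ 2 ^ n = x ^ n * x ^ (2 ^ n - n)"
      using le by (simp add: power_add[symmetric])
    also have "norm \<dots> \<le> norm (x ^ n) * norm x ^ (2 ^ n - n)"
      by (intro order_trans[OF norm_mult_ineq] mult_left_mono norm_power_ineq) auto
    finally have "norm x ^ n \<le> norm (x ^ n)"
      using False by simp
    then show ?thesis
      using norm_power_ineq[of x n] by simp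
  qed (cases n; simp)
qed

lemma selfadjoint_spectral_norm:
  assumes "star x = x"
  shows "\<exists>z\<in>cstar_spectrum x. cmod z = norm x"
proof (cases "x = 0")
  case True
  obtain z where "z \<in> cstar_spectrum x"
    using cstar_spectrum_nonempty by blast
  then show ?thesis
    using cstar_spectrum_bound[of z x] True by force
next
  case False
  then have "\<exists>z\<in>cstar_spectrum x. norm x \<le> cmod z"
    using spectral_radius_bound[of "norm x" x] norm_power_selfadjoint[OF assms] by auto
  then show ?thesis
    using cstar_spectrum_bound by (metis antisym)
qed

text \<open>
  If \<open>\<alpha> + \<i> \<beta>\<close> is in the spectrum of \<open>a\<close>, then \<open>\<bar>\<beta> + t\<bar>\<^sup>2 \<le> \<parallel>a + \<i> t\<parallel>\<^sup>2 = \<parallel>a\<^sup>2 + t\<^sup>2\<parallel> \<le> \<parallel>a\<parallel>\<^sup>2 + t\<^sup>2\<close> for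
  every real \<open>t\<close>, which forces \<open>\<beta> = 0\<close>.
\<close>

lemma selfadjoint_spectrum_real:
  fixes a :: "'a::cstar_algebra"
  assumes a: "star a = a" and z: "z \<in> cstar_spectrum a"
  shows "Im z = 0"
proof -
  have ineq: "2 * Im z * t \<le> norm a ^ 2" for t
  proof -
    let ?w = "\<i> * complex_of_real t"
    let ?b = "?w *\<^sub>C 1 + a"
    have "?w + 1 * z \<in> cstar_spectrum (?w *\<^sub>C 1 + 1 *\<^sub>C a)"
      using z by (intro cstar_spectrum_shift_scale) auto
    then have "cmod (?w + z) \<le> norm ?b"
      using cstar_spectrum_bound by (simp add: scaleC_one)
    then have "cmod (?w + z) ^ 2 \<le> norm ?b ^ 2"
      by (intro power_mono) auto
    also have "\<dots> = norm (star ?b * ?b)"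
      by (rule norm_star_mult[symmetric])
    also have "star ?b * ?b = complex_of_real (t ^ 2) *\<^sub>C 1 + a * a"
      using a by (simp add: star_add star_scaleC algebra_simps mult_scaleC_left mult_scaleC_right
          scaleC_scaleC scaleC_minus_left power2_eq_square)
    also have "norm \<dots> \<le> norm (complex_of_real (t ^ 2) *\<^sub>C (1::'a)) + norm (a * a)"
      by (rule norm_triangle_ineq)
    also have "\<dots> \<le> t ^ 2 + norm a ^ 2"
      unfolding norm_scaleC_one norm_of_real using norm_mult_ineq[of a a] by (simp add: power2_eq_square)
    finally have "(Re z) ^ 2 + (t + Im z) ^ 2 \<le> t ^ 2 + norm a ^ 2"
      by (simp add: cmod_power2)
    moreover have "(t + Im z) ^ 2 = t ^ 2 + 2 * Im z * t + (Im z) ^ 2"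
      by (simp add: power2_eq_square algebra_simps)
    ultimately show ?thesis
      using zero_le_power2[of "Re z"] zero_le_power2[of "Im z"] by linarith
  qed
  show ?thesis
  proof (rule ccontr)
    assume "Im z \<noteq> 0"
    then have "2 * Im z * ((norm a ^ 2 + 1) / (2 * Im z)) = norm a ^ 2 + 1"
      by simp
    then show False
      using ineq[of "(norm a ^ 2 + 1) / (2 * Im z)"] by linarith
  qed
qed

text \<open>
  The spectrum of \<open>m - a\<close> is that of \<open>a\<close> reflected, hence contained in \<open>[m - \<parallel>a\<parallel>, m]\<close>. Together with its
  converse below, this turns positivity into a convex condition on norms, from which sums of positive
  elements are positive.
\<close>

lemma cstar_positive_norm_minus:
  fixes a :: "'a::cstar_algebra"
  assumes a: "cstar_positive a" and m: "norm a \<le> m"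
  shows "norm (complex_of_real m *\<^sub>C 1 - a) \<le> m"
proof -
  let ?b = "complex_of_real m *\<^sub>C 1 + (-1) *\<^sub>C a"
  have "star ?b = ?b"
    using a by (simp add: cstar_positive_def star_add star_diff star_minus star_scaleC)
  from selfadjoint_spectral_norm[OF this] obtain z where z: "z \<in> cstar_spectrum ?b" "cmod z = norm ?b"
    by blast
  then have "(z - complex_of_real m) / (-1) \<in> cstar_spectrum a"
    using cstar_spectrum_shift_scale_iff[of "-1" z "complex_of_real m" a] by simp
  moreover from this obtain r where r: "complex_of_real m - z = complex_of_real r" "r \<ge> 0"
    using a by (auto simp: cstar_positive_def)
  ultimately have "r \<le> m"
    using cstar_spectrum_bound[of "complex_of_real r" a] m by simp
  moreover have "z = complex_of_real (m - r)"
    using r(1) by (simp add: algebra_simps)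
  then have "cmod z = \<bar>m - r\<bar>"
    by (simp only: norm_of_real)
  ultimately show ?thesis
    using z(2) r(2) by (simp add: scaleC_minus_left scaleC_one)
qed

lemma cstar_positiveI:
  fixes a :: "'a::cstar_algebra"
  assumes a: "star a = a" and m: "norm (complex_of_real m *\<^sub>C 1 - a) \<le> m"
  shows "cstar_positive a"
  unfolding cstar_positive_def
proof (intro conjI a subsetI)
  fix z assume z: "z \<in> cstar_spectrum a"
  have re: "z = complex_of_real (Re z)"
    using selfadjoint_spectrum_real[OF a z] by (simp add: complex_eq_iff)
  have "complex_of_real m + (-1) * z \<in> cstar_spectrum (complex_of_real m *\<^sub>C 1 + (-1) *\<^sub>C a)"
    using z by (intro cstar_spectrum_shift_scale) auto
  then have "cmod (complex_of_real m - z) \<le> m"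
    using cstar_spectrum_bound m by (fastforce simp: scaleC_minus_left scaleC_one)
  then have "\<bar>m - Re z\<bar> \<le> m"
    using re by (metis norm_of_real of_real_diff)
  then have "Re z \<ge> 0"
    by linarith
  then show "z \<in> complex_of_real ` {0..}"
    using re by (metis atLeast_iff image_eqI)
qed

lemma cstar_positive_zero: "cstar_positive 0"
  by (rule cstar_positiveI[of _ 0]) simp_all

lemma cstar_positive_add:
  assumes "cstar_positive a" "cstar_positive b"
  shows "cstar_positive (a + b)"
proof (rule cstar_positiveI)
  show "star (a + b) = a + b"
    using assms by (simp add: cstar_positive_def star_add)
  have "complex_of_real (norm a + norm b) *\<^sub>C 1 - (a + b)
      = (complex_of_real (norm a) *\<^sub>C 1 - a) + (complex_of_real (norm b) *\<^sub>C 1 - b)"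
    by (simp add: scaleC_add_left)
  then show "norm (complex_of_real (norm a + norm b) *\<^sub>C 1 - (a + b)) \<le> norm a + norm b"
    using norm_triangle_mono[OF cstar_positive_norm_minus[OF assms(1) order_refl]
        cstar_positive_norm_minus[OF assms(2) order_refl]]
    by metis
qed

lemma cstar_positive_scaleR:
  assumes "cstar_positive a" "r \<ge> 0"
  shows "cstar_positive (r *\<^sub>R a)"
proof (rule cstar_positiveI)
  show "star (r *\<^sub>R a) = r *\<^sub>R a"
    using assms by (simp add: cstar_positive_def star_scaleR)
  have "complex_of_real (r * norm a) *\<^sub>C 1 - r *\<^sub>R a = r *\<^sub>R (complex_of_real (norm a) *\<^sub>C 1 - a)"
    by (simp add: scaleR_scaleC scaleC_diff_right scaleC_scaleC)
  then show "norm (complex_of_real (r * norm a) *\<^sub>C 1 - r *\<^sub>R a) \<le> r * norm a"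
    using cstar_positive_norm_minus[OF assms(1) order_refl] assms(2) by (simp add: mult_left_mono)
qed

lemma cstar_positive_sum: "(\<And>i. i \<in> I \<Longrightarrow> cstar_positive (f i)) \<Longrightarrow> cstar_positive (\<Sum>i\<in>I. f i)"
  by (induction I rule: infinite_finite_induct) (simp_all add: cstar_positive_zero cstar_positive_add)

text \<open>
  The norm is monotone on positive elements: \<open>m + \<parallel>a\<parallel>\<close> is a spectral value of \<open>m + a\<close>, which for large
  \<open>m\<close> is within \<open>\<parallel>d\<parallel>\<close> of \<open>m - (d - a)\<close>, an element of norm at most \<open>m\<close>.
\<close>

lemma cstar_positive_norm_mono:
  fixes a d :: "'a::cstar_algebra"
  assumes a: "cstar_positive a" and d: "cstar_positive (d - a)"
  shows "norm a \<le> norm d"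
proof -
  define m where "m = norm (d - a)"
  obtain z where z: "z \<in> cstar_spectrum a" "cmod z = norm a"
    using selfadjoint_spectral_norm a by (auto simp: cstar_positive_def)
  then have "z = complex_of_real (norm a)"
    using a by (auto simp: cstar_positive_def)
  with z(1) have "complex_of_real m + 1 * complex_of_real (norm a)
      \<in> cstar_spectrum (complex_of_real m *\<^sub>C 1 + 1 *\<^sub>C a)"
    by (intro cstar_spectrum_shift_scale) auto
  then have "cmod (complex_of_real (m + norm a)) \<le> norm (complex_of_real m *\<^sub>C 1 + a)"
    using cstar_spectrum_bound by (simp add: scaleC_one)
  also have "complex_of_real m *\<^sub>C 1 + a = (complex_of_real m *\<^sub>C 1 - (d - a)) + d"
    by simp
  also have "norm \<dots> \<le> norm (complex_of_real m *\<^sub>C 1 - (d - a)) + norm d"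
    by (rule norm_triangle_ineq)
  also have "\<dots> \<le> m + norm d"
    using cstar_positive_norm_minus[OF d] by (simp add: m_def)
  finally show ?thesis
    unfolding norm_of_real by (simp add: m_def)
qed

lemma cstar_positive_scalar:
  assumes "cstar_positive (complex_of_real r *\<^sub>C (1::'a::cstar_algebra))"
  shows "r \<ge> 0"
proof -
  have "complex_of_real r \<in> cstar_spectrum (complex_of_real r *\<^sub>C (1::'a))"
    by (simp add: cstar_spectrum_def)
  then show ?thesis
    using assms by (auto simp: cstar_positive_def)
qed

section \<open>Conditional expectations with a quasi-basis\<close>

lemma cstar_subalgebraD:
  assumes "cstar_subalgebra S"
  shows "complex_vector.subspace S" "closed S" "1 \<in> S" "0 \<in> S"
    "\<And>x y. x \<in> S \<Longrightarrow> y \<in> S \<Longrightarrow> x * y \<in> S" "\<And>x. x \<in> S \<Longrightarrow> star x \<in> S"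
    "\<And>x y. x \<in> S \<Longrightarrow> y \<in> S \<Longrightarrow> x + y \<in> S" "\<And>x y. x \<in> S \<Longrightarrow> y \<in> S \<Longrightarrow> x - y \<in> S"
    "\<And>c x. x \<in> S \<Longrightarrow> c *\<^sub>C x \<in> S" "\<And>r x. x \<in> S \<Longrightarrow> r *\<^sub>R x \<in> S"
    "\<And>I f. (\<And>i. i \<in> I \<Longrightarrow> f i \<in> S) \<Longrightarrow> sum f I \<in> S"
proof -
  have S: "complex_vector.subspace S"
    using assms by (simp add: cstar_subalgebra_def)
  show "\<And>x y. x \<in> S \<Longrightarrow> y \<in> S \<Longrightarrow> x + y \<in> S" "\<And>x y. x \<in> S \<Longrightarrow> y \<in> S \<Longrightarrow> x - y \<in> S"
    "\<And>c x. x \<in> S \<Longrightarrow> c *\<^sub>C x \<in> S" "\<And>r x. x \<in> S \<Longrightarrow> r *\<^sub>R x \<in> S" "0 \<in> S"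
    using S by (simp_all add: complex_vector.subspace_0 complex_vector.subspace_add
        complex_vector.subspace_diff complex_vector.subspace_scale scaleR_scaleC)
  show "\<And>I f. (\<And>i. i \<in> I \<Longrightarrow> f i \<in> S) \<Longrightarrow> sum f I \<in> S"
    by (rule complex_vector.subspace_sum[OF S])
qed (use assms in \<open>auto simp: cstar_subalgebra_def\<close>)

lemma linear_on_scaleR:
  fixes f :: "'a::cstar_algebra \<Rightarrow> 'b::cstar_algebra"
  shows "linear_on V f \<Longrightarrow> x \<in> V \<Longrightarrow> f (r *\<^sub>R x) = r *\<^sub>R f x"
  by (simp add: scaleR_scaleC linear_on_scale)

locale expectation =
  fixes B A :: "'a::cstar_algebra set" and E :: "'a \<Rightarrow> 'a"
  assumes B: "cstar_subalgebra B" and A: "cstar_subalgebra A" and sub: "B \<subseteq> A"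
    and E: "cond_expectation B A E"
begin

lemmas B_simps = cstar_subalgebraD[OF B]
lemmas A_simps = cstar_subalgebraD[OF A]

lemma B_in_A: "b \<in> B \<Longrightarrow> b \<in> A"
  using sub by blast

lemma E_linear: "linear_on A E"
  and E_in: "\<And>x. x \<in> A \<Longrightarrow> E x \<in> B"
  and E_id: "\<And>b. b \<in> B \<Longrightarrow> E b = b"
  and E_left: "\<And>b x. b \<in> B \<Longrightarrow> x \<in> A \<Longrightarrow> E (b * x) = b * E x"
  and E_right: "\<And>b x. b \<in> B \<Longrightarrow> x \<in> A \<Longrightarrow> E (x * b) = E x * b"
  and E_pos: "\<And>x. x \<in> A \<Longrightarrow> cstar_positive (E (star x * x))"
  and E_norm: "\<And>x. x \<in> A \<Longrightarrow> norm (E x) \<le> norm x"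
  using E by (auto simp: cond_expectation_def)

lemma E_in_A: "x \<in> A \<Longrightarrow> E x \<in> A"
  using E_in sub by blast

lemma E_add: "x \<in> A \<Longrightarrow> y \<in> A \<Longrightarrow> E (x + y) = E x + E y"
  and E_scale: "x \<in> A \<Longrightarrow> E (c *\<^sub>C x) = c *\<^sub>C E x"
  and E_scaleR: "x \<in> A \<Longrightarrow> E (r *\<^sub>R x) = r *\<^sub>R E x"
  and E_sum: "(\<And>i. i \<in> I \<Longrightarrow> f i \<in> A) \<Longrightarrow> E (sum f I) = (\<Sum>i\<in>I. E (f i))"
  by (simp_all add: linear_on_add[OF E_linear] linear_on_scale[OF E_linear]
      linear_on_scaleR[OF E_linear] linear_on_sum[OF E_linear A_simps(1)])

lemma E_diff: "x \<in> A \<Longrightarrow> y \<in> A \<Longrightarrow> E (x - y) = E x - E y"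
  using E_add[of "x - y" y] A_simps by simp

lemma E_one: "E 1 = 1"
  using E_id B_simps by simp

text \<open>Polarization: \<open>E ((x + c)\<^sup>* (x + c))\<close> is self-adjoint for \<open>c = 1\<close> and \<open>c = \<i>\<close>.\<close>

lemma E_star:
  assumes x: "x \<in> A"
  shows "E (star x) = star (E x)"
proof -
  define P where "P = E (star x)"
  define Q where "Q = E x"
  have sa: "star (E (star y * y)) = E (star y * y)" if "y \<in> A" for y
    using E_pos[OF that] by (simp add: cstar_positive_def)
  have eq: "cnj c *\<^sub>C star P + c *\<^sub>C star Q = c *\<^sub>C P + cnj c *\<^sub>C Q" for c
  proof -
    have "star (x + c *\<^sub>C 1) * (x + c *\<^sub>C 1) = star x * x + c *\<^sub>C star x + cnj c *\<^sub>C x + (c * cnj c) *\<^sub>C 1"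
      by (simp add: star_add star_scaleC distrib_left distrib_right mult_scaleC_left
          mult_scaleC_right scaleC_add_right scaleC_scaleC algebra_simps)
    then have "E (star (x + c *\<^sub>C 1) * (x + c *\<^sub>C 1))
        = E (star x * x) + c *\<^sub>C P + cnj c *\<^sub>C Q + (c * cnj c) *\<^sub>C 1"
      using x A_simps by (simp add: E_add E_scale E_one P_def Q_def)
    moreover have "x + c *\<^sub>C 1 \<in> A"
      using x A_simps by simp
    ultimately show ?thesis
      using sa[of "x + c *\<^sub>C 1"] sa[OF x] by (simp add: star_add star_scaleC mult.commute)
  qed
  have "star P + star Q = P + Q"
    using eq[of 1] by (simp add: scaleC_one)
  moreover have "- star P + star Q = P - Q"
  proof -
    have "\<i> *\<^sub>C (- star P + star Q) = \<i> *\<^sub>C (P - Q)"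
      using eq[of \<i>] by (simp add: scaleC_minus_left scaleC_add_right scaleC_minus_right scaleC_diff_right)
    then show ?thesis
      by (simp add: scaleC_cancel)
  qed
  ultimately have "(star P + star Q) - (- star P + star Q) = (P + Q) - (P - Q)"
    by (simp only:)
  then have "2 *\<^sub>R star P = 2 *\<^sub>R Q"
    by (simp add: scaleR_2)
  then have "star P = Q"
    by simp
  then show ?thesis
    unfolding P_def Q_def by (metis star_star)
qed

lemma positive_square: "b \<in> B \<Longrightarrow> cstar_positive (star b * b)"
  using E_pos[of b] E_id[of "star b * b"] B_simps B_in_A by simp

text \<open>
  With \<open>b = E (y\<^sup>* x)\<close> and \<open>t = 1 / M\<close>, positivity of \<open>E ((x - t y b)\<^sup>* (x - t y b))\<close> says
  \<open>2 t b\<^sup>* b \<le> E (x\<^sup>* x) + t\<^sup>2 b\<^sup>* E (y\<^sup>* y) b\<close>; take norms.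
\<close>

lemma expectation_cauchy_schwarz:
  assumes x: "x \<in> A" and y: "y \<in> A" and M: "0 < M" "norm (E (star y * y)) \<le> M"
  shows "norm (E (star y * x)) ^ 2 \<le> M * norm (E (star x * x))"
proof -
  define b where "b = E (star y * x)"
  define X where "X = E (star x * x)"
  define Y where "Y = E (star y * y)"
  define t where "t = 1 / M"
  have b: "b \<in> B" "b \<in> A" "star b \<in> B" "star b \<in> A"
    using x y A_simps E_in B_simps B_in_A by (simp_all add: b_def)
  note AA = x y A_simps b
  have "star (x - t *\<^sub>R (y * b)) * (x - t *\<^sub>R (y * b))
    = star x * x - t *\<^sub>R ((star x * y) * b) - t *\<^sub>R (star b * (star y * x))
      + (t * t) *\<^sub>R (star b * (star y * y) * b)"
    by (simp add: star_diff star_scaleR star_mult right_diff_distrib left_diff_distrib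
        scaleR_diff_right mult.assoc)
  then have "E (star (x - t *\<^sub>R (y * b)) * (x - t *\<^sub>R (y * b)))
    = X - t *\<^sub>R (E (star x * y) * b) - t *\<^sub>R (star b * b) + (t * t) *\<^sub>R (star b * Y * b)"
    by (simp only: X_def Y_def b_def[symmetric] E_add E_diff E_scaleR E_left E_right AA)
  also have "E (star x * y) = star b"
    using E_star[of "star y * x"] AA by (simp add: b_def star_mult star_star)
  also have "X - t *\<^sub>R p - t *\<^sub>R p + q = X + q - (2 * t) *\<^sub>R p" for p q
    by (simp only: mult_2 scaleR_add_left) (simp add: algebra_simps)
  finally have "E (star (x - t *\<^sub>R (y * b)) * (x - t *\<^sub>R (y * b)))
    = (X + (t * t) *\<^sub>R (star b * Y * b)) - (2 * t) *\<^sub>R (star b * b)" .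
  then have "cstar_positive ((X + (t * t) *\<^sub>R (star b * Y * b)) - (2 * t) *\<^sub>R (star b * b))"
    using E_pos[of "x - t *\<^sub>R (y * b)"] AA by simp
  moreover have "cstar_positive ((2 * t) *\<^sub>R (star b * b))"
    using M b by (intro cstar_positive_scaleR positive_square) (auto simp: t_def)
  ultimately have "norm ((2 * t) *\<^sub>R (star b * b)) \<le> norm (X + (t * t) *\<^sub>R (star b * Y * b))"
    by (rule cstar_positive_norm_mono[rotated])
  also have "\<dots> \<le> norm X + norm ((t * t) *\<^sub>R (star b * Y * b))"
    by (rule norm_triangle_ineq)
  also have "norm ((t * t) *\<^sub>R (star b * Y * b)) \<le> t * t * (norm b * M * norm b)"
  proof -
    have "norm (star b * Y * b) \<le> norm b * M * norm b"
      using M by (intro order_trans[OF norm_mult_ineq] mult_mono)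
        (auto simp: norm_star Y_def intro!: mult_mono)
    then show ?thesis
      by (simp add: mult_left_mono)
  qed
  finally have "2 * t * norm b ^ 2 \<le> norm X + t * t * (norm b * M * norm b)"
    using M by (simp add: norm_star_mult t_def)
  then have "t * norm b ^ 2 \<le> norm X"
    using M by (simp add: t_def power2_eq_square field_simps)
  then show ?thesis
    using M by (simp add: t_def b_def X_def field_simps)
qed

end

locale expectation_basis = expectation B A E for B A :: "'a::cstar_algebra set" and E +
  fixes I :: "'i set" and \<nu> :: "'i \<Rightarrow> 'a"
  assumes finite_I: "finite I" and \<nu>_in: "\<And>i. i \<in> I \<Longrightarrow> \<nu> i \<in> A"
    and basis: "\<And>x. x \<in> A \<Longrightarrow> x = (\<Sum>i\<in>I. \<nu> i * E (star (\<nu> i) * x))"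
begin

lemma basis_adjoint:
  assumes "x \<in> A"
  shows "x = (\<Sum>i\<in>I. E (x * \<nu> i) * star (\<nu> i))"
proof -
  have "star (star x) = star (\<Sum>i\<in>I. \<nu> i * E (star (\<nu> i) * star x))"
    using basis[of "star x"] assms A_simps by simp
  also have "\<dots> = (\<Sum>i\<in>I. star (E (star (\<nu> i) * star x)) * star (\<nu> i))"
    by (simp add: star_sum star_mult)
  also have "\<dots> = (\<Sum>i\<in>I. E (x * \<nu> i) * star (\<nu> i))"
    using assms \<nu>_in A_simps
    by (intro sum.cong refl) (simp add: E_star[symmetric] star_mult star_star)
  finally show ?thesis
    by (simp add: star_star)
qed

text \<open>
  Each coefficient \<open>E (\<nu>\<^sub>i\<^sup>* x)\<close> is controlled by \<open>E (x\<^sup>* x)\<close> through the Cauchy-Schwarz inequality. The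
  summand \<open>1\<close> in the constants only keeps them positive.
\<close>

lemma pimsner_popa_bound: "\<exists>C>0. \<forall>x\<in>A. norm x \<le> C * sqrt (norm (E (star x * x)))"
proof (intro exI conjI ballI)
  let ?c = "\<lambda>i. norm (\<nu> i) * sqrt (norm (\<nu> i) ^ 2 + 1)"
  let ?C = "(\<Sum>i\<in>I. ?c i) + 1"
  show "?C > 0"
    by (intro add_nonneg_pos sum_nonneg) auto
  fix x assume x: "x \<in> A"
  let ?X = "norm (E (star x * x))"
  have "norm (\<nu> i * E (star (\<nu> i) * x)) \<le> ?c i * sqrt ?X" if i: "i \<in> I" for i
  proof -
    have "norm (E (star (\<nu> i) * \<nu> i)) \<le> norm (\<nu> i) ^ 2"
      using E_norm[of "star (\<nu> i) * \<nu> i"] \<nu>_in[OF i] A_simps by (simp add: norm_star_mult)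
    then have "norm (E (star (\<nu> i) * x)) ^ 2 \<le> (norm (\<nu> i) ^ 2 + 1) * ?X"
      using expectation_cauchy_schwarz[OF x \<nu>_in[OF i], of "norm (\<nu> i) ^ 2 + 1"]
      by (simp add: add_nonneg_pos)
    then have "norm (E (star (\<nu> i) * x)) \<le> sqrt ((norm (\<nu> i) ^ 2 + 1) * ?X)"
      by (rule real_le_rsqrt)
    then have "norm (\<nu> i) * norm (E (star (\<nu> i) * x)) \<le> norm (\<nu> i) * sqrt ((norm (\<nu> i) ^ 2 + 1) * ?X)"
      by (intro mult_left_mono) auto
    then show ?thesis
      by (intro order_trans[OF norm_mult_ineq]) (simp add: real_sqrt_mult mult.assoc)
  qed
  then have "norm (\<Sum>i\<in>I. \<nu> i * E (star (\<nu> i) * x)) \<le> (\<Sum>i\<in>I. ?c i * sqrt ?X)"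
    by (rule sum_norm_le)
  also have "\<dots> \<le> ?C * sqrt ?X"
    by (simp add: sum_distrib_right[symmetric] distrib_right)
  finally show "norm x \<le> ?C * sqrt ?X"
    using basis[OF x] by simp
qed

lemma faithful: "x \<in> A \<Longrightarrow> E (star x * x) = 0 \<Longrightarrow> x = 0"
  using pimsner_popa_bound by force

text \<open>
  Left multiplication by \<open>a\<close> has the matrix \<open>E (\<nu>\<^sub>j\<^sup>* a \<nu>\<^sub>i)\<close> in the quasi-basis. Its entries lie in \<open>B\<close>, so they
  pass through \<open>y\<close> and can be reassembled on the right.
\<close>

lemma averaging_commutes:
  assumes y: "\<And>b. b \<in> B \<Longrightarrow> b * y = y * b" and a: "a \<in> A"
  shows "a * (\<Sum>i\<in>I. \<nu> i * y * star (\<nu> i)) = (\<Sum>i\<in>I. \<nu> i * y * star (\<nu> i)) * a"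
proof -
  let ?e = "\<lambda>j i. E (star (\<nu> j) * (a * \<nu> i))"
  have e: "?e j i \<in> B" if "i \<in> I" "j \<in> I" for i j
    using that a \<nu>_in A_simps by (intro E_in) simp
  have "a * (\<Sum>i\<in>I. \<nu> i * y * star (\<nu> i)) = (\<Sum>i\<in>I. (a * \<nu> i) * y * star (\<nu> i))"
    by (simp add: sum_distrib_left mult.assoc)
  also have "\<dots> = (\<Sum>i\<in>I. (\<Sum>j\<in>I. \<nu> j * ?e j i) * y * star (\<nu> i))"
    using a \<nu>_in A_simps basis by (intro sum.cong refl) simp
  also have "\<dots> = (\<Sum>i\<in>I. \<Sum>j\<in>I. \<nu> j * y * (?e j i * star (\<nu> i)))"
  proof (intro sum.cong refl)
    fix i assume i: "i \<in> I"
    have "(\<Sum>j\<in>I. \<nu> j * ?e j i) * y * star (\<nu> i) = (\<Sum>j\<in>I. \<nu> j * (?e j i * y) * star (\<nu> i))"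
      by (simp add: sum_distrib_right mult.assoc)
    also have "\<dots> = (\<Sum>j\<in>I. \<nu> j * y * (?e j i * star (\<nu> i)))"
      using y[OF e[OF i]] by (intro sum.cong refl) (simp add: mult.assoc)
    finally show "(\<Sum>j\<in>I. \<nu> j * ?e j i) * y * star (\<nu> i)
        = (\<Sum>j\<in>I. \<nu> j * y * (?e j i * star (\<nu> i)))" .
  qed
  also have "\<dots> = (\<Sum>j\<in>I. \<nu> j * y * (\<Sum>i\<in>I. ?e j i * star (\<nu> i)))"
    by (subst sum.swap) (simp add: sum_distrib_left)
  also have "\<dots> = (\<Sum>j\<in>I. \<nu> j * y * (star (\<nu> j) * a))"
    using a \<nu>_in A_simps basis_adjoint by (intro sum.cong refl) (simp add: mult.assoc[symmetric])
  finally show ?thesis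
    by (simp add: sum_distrib_right mult.assoc)
qed

end

section \<open>Relative commutants are finite-dimensional Hilbert spaces\<close>

locale scalar_expectation = expectation_basis B A E I \<nu>
  for B A :: "'a::cstar_algebra set" and E and I :: "'i set" and \<nu> +
  assumes centre: "\<And>c. c \<in> B \<Longrightarrow> (\<And>b. b \<in> B \<Longrightarrow> b * c = c * b) \<Longrightarrow> \<exists>z. c = z *\<^sub>C 1"
begin

definition V where "V = rel_commutant B A"

definition tr :: "'a \<Rightarrow> complex" where "tr x = (THE c. E x = c *\<^sub>C 1)"

definition ip :: "'a \<Rightarrow> 'a \<Rightarrow> complex" where "ip x y = tr (star x * y)"

lemma V_in_A: "x \<in> V \<Longrightarrow> x \<in> A"
  and V_commute: "x \<in> V \<Longrightarrow> b \<in> B \<Longrightarrow> b * x = x * b"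
  by (auto simp: V_def rel_commutant_def)

lemma V_star: "x \<in> V \<Longrightarrow> star x \<in> V"
proof -
  assume x: "x \<in> V"
  have "b * star x = star x * b" if "b \<in> B" for b
    using V_commute[OF x, of "star b"] that B_simps star_inject[of "b * star x" "star x * b"]
    by (simp add: star_mult star_star)
  then show ?thesis
    using x A_simps by (auto simp: V_def rel_commutant_def)
qed

lemma V_mult: "x \<in> V \<Longrightarrow> y \<in> V \<Longrightarrow> x * y \<in> V"
proof -
  assume x: "x \<in> V" and y: "y \<in> V"
  have "b * (x * y) = x * y * b" if "b \<in> B" for b
    using V_commute[OF x that] V_commute[OF y that] by (metis mult.assoc)
  then show ?thesis
    using x y A_simps by (auto simp: V_def rel_commutant_def)
qed

lemma V_subspace: "complex_vector.subspace V"
  using A_simps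
  by (auto simp: complex_vector.subspace_def V_def rel_commutant_def distrib_left distrib_right
      mult_scaleC_left mult_scaleC_right)

lemmas V_simps = V_star V_mult complex_vector.subspace_add[OF V_subspace]
  complex_vector.subspace_scale[OF V_subspace] complex_vector.subspace_diff[OF V_subspace]
  complex_vector.subspace_sum[OF V_subspace]

lemma tr_eq:
  assumes "x \<in> V"
  shows "E x = tr x *\<^sub>C 1"
proof -
  have "b * E x = E x * b" if "b \<in> B" for b
    using that assms E_left[OF that, of x] E_right[OF that, of x] V_commute[OF assms that] V_in_A
    by simp
  then obtain z where "E x = z *\<^sub>C 1"
    using centre E_in V_in_A assms by metis
  then show ?thesis
    unfolding tr_def by (auto simp: scaleC_one_inject)
qed

lemma tr_eqI: "x \<in> V \<Longrightarrow> E x = c *\<^sub>C 1 \<Longrightarrow> tr x = c"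
  by (simp add: tr_eq scaleC_one_inject)

sublocale hermitian_space V ip
proof
  show "complex_vector.subspace V"
    by (rule V_subspace)
  show "linear_on V (ip x)" if "x \<in> V" for x
  proof (rule linear_onI)
    fix y z assume "y \<in> V" "z \<in> V"
    then show "ip x (y + z) = ip x y + ip x z"
      unfolding ip_def using that V_simps V_in_A A_simps
      by (intro tr_eqI) (simp_all add: distrib_left E_add tr_eq[symmetric] scaleC_add_left)
  next
    fix c y assume "y \<in> V"
    then show "ip x (c *\<^sub>C y) = c *\<^sub>C ip x y"
      unfolding ip_def using that V_simps V_in_A A_simps
      by (intro tr_eqI)
        (simp_all add: mult_scaleC_right E_scale tr_eq[symmetric] scaleC_scaleC[symmetric] scaleC_complex_def)
  qed
  show "ip y x = cnj (ip x y)" if "x \<in> V" "y \<in> V" for x y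
  proof -
    have "E (star y * x) = star (E (star x * y))"
      using E_star[of "star x * y"] that V_in_A A_simps by (simp add: star_mult star_star)
    also have "\<dots> = cnj (tr (star x * y)) *\<^sub>C 1"
      using that V_simps by (simp add: tr_eq star_scaleC)
    finally show ?thesis
      unfolding ip_def using that V_simps by (intro tr_eqI) auto
  qed
qed

lemma ip_self:
  assumes x: "x \<in> V"
  shows "ip x x = complex_of_real (norm (E (star x * x)))"
proof -
  have "ip x x = cnj (ip x x)"
    using ip_cnj[OF x x] .
  then have re: "ip x x = complex_of_real (Re (ip x x))"
    by (simp add: complex_eq_iff)
  have E_x: "E (star x * x) = ip x x *\<^sub>C 1"
    unfolding ip_def using x V_simps by (simp add: tr_eq)
  then have "Re (ip x x) \<ge> 0"
    using E_pos[OF V_in_A[OF x]] re cstar_positive_scalar[of "Re (ip x x)"] by metis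
  moreover have "norm (E (star x * x)) = \<bar>Re (ip x x)\<bar>"
    unfolding E_x norm_scaleC_one by (subst re) (rule norm_of_real)
  ultimately show ?thesis
    using re by simp
qed

definition orthonormal :: "nat \<Rightarrow> (nat \<Rightarrow> 'a) \<Rightarrow> bool" where
  "orthonormal N v \<longleftrightarrow> (\<forall>i<N. v i \<in> V) \<and> (\<forall>i<N. \<forall>j<N. ip (v i) (v j) = (if i = j then 1 else 0))"

text \<open>
  Let \<open>P y = \<Sum>\<^sub>i v\<^sub>i E (v\<^sub>i\<^sup>* y)\<close> for an orthonormal family in the commutant. Bessel's inequality and the
  Pimsner-Popa bound make \<open>\<parallel>P y\<parallel> \<le> C \<parallel>y\<parallel>\<close> independently of the family. Expanding \<open>v\<^sub>i\<^sup>*\<close> in the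
  quasi-basis gives \<open>\<Sum>\<^sub>i v\<^sub>i v\<^sub>i\<^sup>* = \<Sum>\<^sub>k P \<nu>\<^sub>k \<nu>\<^sub>k\<^sup>*\<close>, which is therefore bounded, while each
  \<open>E (v\<^sub>i v\<^sub>i\<^sup>*)\<close> is a scalar at least \<open>1 / C\<^sup>2\<close>.
\<close>

lemma orthonormal_length_bounded: "\<exists>K. \<forall>N v. orthonormal N v \<longrightarrow> real N \<le> K"
proof -
  obtain C where C: "C > 0" "\<And>x. x \<in> A \<Longrightarrow> norm x \<le> C * sqrt (norm (E (star x * x)))"
    using pimsner_popa_bound by blast
  define K where "K = C ^ 2 * (\<Sum>k\<in>I. C * norm (\<nu> k) * norm (\<nu> k))"
  have "real N \<le> K" if on: "orthonormal N v" for N v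
  proof -
    have v: "v i \<in> V" "v i \<in> A" "star (v i) \<in> A" if "i < N" for i
      using on that V_in_A A_simps by (auto simp: orthonormal_def)
    have E_v: "E (star (v i) * v j) = (if i = j then 1 else 0)" if "i < N" "j < N" for i j
      using on that tr_eq[of "star (v i) * v j"] V_simps v
      by (auto simp: orthonormal_def ip_def scaleC_one)
    define P where "P y = (\<Sum>i<N. v i * E (star (v i) * y))" for y
    have P_in: "P y \<in> A" if "y \<in> A" for y
      unfolding P_def using v that A_simps E_in_A by (intro A_simps(11)) auto
    have E_P: "E (star (v i) * P y) = E (star (v i) * y)" if "i < N" "y \<in> A" for i y
    proof -
      have "star (v i) * P y = (\<Sum>j<N. (star (v i) * v j) * E (star (v j) * y))"
        by (simp add: P_def sum_distrib_left mult.assoc)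
      also have "E \<dots> = (\<Sum>j<N. E (star (v i) * v j) * E (star (v j) * y))"
        using that v A_simps E_in E_in_A by (subst E_sum) (simp_all add: E_right)
      also have "\<dots> = (\<Sum>j<N. if j = i then E (star (v i) * y) else 0)"
        using that by (intro sum.cong refl) (simp add: E_v)
      finally show ?thesis
        using that by simp
    qed
    have P_norm: "norm (P y) \<le> C * norm y" if y: "y \<in> A" for y
    proof -
      define Q where "Q = (\<Sum>i<N. star (E (star (v i) * y)) * E (star (v i) * y))"
      have adj: "star (P y) * z = (\<Sum>i<N. star (E (star (v i) * y)) * (star (v i) * z))" for z
        by (simp add: P_def star_sum star_mult sum_distrib_right mult.assoc)
      have E_adj: "E (star (P y) * z) = (\<Sum>i<N. star (E (star (v i) * y)) * E (star (v i) * z))"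
        if "z \<in> A" for z
        unfolding adj using that v y A_simps E_in B_simps E_in_A
          by (subst E_sum) (simp_all add: E_left)
      have PP: "E (star (P y) * P y) = Q" and Py: "E (star (P y) * y) = Q"
        using E_adj[OF P_in[OF y]] E_adj[OF y] E_P[OF _ y] by (simp_all add: Q_def)
      have Q_sa: "star Q = Q"
        by (simp add: Q_def star_sum star_mult star_star)
      have yP: "E (star y * P y) = Q"
        using E_star[of "star (P y) * y"] Py Q_sa y P_in[OF y] A_simps
        by (simp add: star_mult star_star)
      have "E (star (y - P y) * (y - P y)) = E (star y * y) - Q"
        using y P_in[OF y] A_simps
        by (simp add: star_diff left_diff_distrib right_diff_distrib E_diff PP Py yP)
      moreover have "cstar_positive (E (star (y - P y) * (y - P y)))"
        using y P_in[OF y] A_simps by (intro E_pos) auto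
      moreover have "cstar_positive Q"
        using E_pos[OF P_in[OF y]] PP by simp
      ultimately have "norm Q \<le> norm (E (star y * y))"
        by (intro cstar_positive_norm_mono) simp_all
      also have "\<dots> \<le> norm y ^ 2"
        using E_norm[of "star y * y"] y A_simps by (simp add: norm_star_mult)
      finally have "sqrt (norm Q) \<le> norm y"
        by (simp add: real_le_lsqrt)
      then have "C * sqrt (norm Q) \<le> C * norm y"
        using C by simp
      then show ?thesis
        using C(2)[OF P_in[OF y]] PP by simp
    qed
    define T where "T = (\<Sum>i<N. v i * star (v i))"
    have "v i * star (v i) = (\<Sum>k\<in>I. (v i * E (star (v i) * \<nu> k)) * star (\<nu> k))" if "i < N" for i
      using basis_adjoint[OF v(3)[OF that]] by (metis (no_types, lifting) mult.assoc sum.cong sum_distrib_left)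
    then have "T = (\<Sum>k\<in>I. P (\<nu> k) * star (\<nu> k))"
      unfolding T_def P_def by (simp add: sum_distrib_right) (rule sum.swap)
    then have "norm T \<le> (\<Sum>k\<in>I. C * norm (\<nu> k) * norm (\<nu> k))"
    proof (simp only:, intro sum_norm_le)
      fix k assume "k \<in> I"
      then have "norm (P (\<nu> k)) * norm (\<nu> k) \<le> C * norm (\<nu> k) * norm (\<nu> k)"
        by (intro mult_right_mono P_norm \<nu>_in) auto
      then show "norm (P (\<nu> k) * star (\<nu> k)) \<le> C * norm (\<nu> k) * norm (\<nu> k)"
        using norm_mult_ineq[of "P (\<nu> k)" "star (\<nu> k)"] by (simp add: norm_star)
    qed
    then have T_bound: "C ^ 2 * norm T \<le> K"
      unfolding K_def by (intro mult_left_mono) auto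
    define r where "r i = norm (E (star (star (v i)) * star (v i)))" for i
    have E_r: "E (v i * star (v i)) = complex_of_real (r i) *\<^sub>C 1" if "i < N" for i
      using ip_self[OF V_star[OF v(1)[OF that]]] tr_eq[of "v i * star (v i)"] v(1)[OF that] V_simps
      by (simp add: r_def ip_def star_star)
    have r_ge: "1 \<le> C ^ 2 * r i" if i: "i < N" for i
    proof -
      have "1 = norm (E (star (v i) * v i))"
        using E_v[OF i i] by simp
      also have "\<dots> \<le> norm (star (v i) * v i)"
        using v[OF i] A_simps by (intro E_norm) auto
      also have "\<dots> = norm (star (v i)) ^ 2"
        by (simp add: norm_star_mult norm_star)
      also have "\<dots> \<le> (C * sqrt (r i)) ^ 2"
        unfolding r_def by (intro power_mono C(2) v(3) i) auto
      also have "\<dots> = C ^ 2 * r i"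
        by (simp add: power_mult_distrib r_def)
      finally show ?thesis .
    qed
    have "E T = (\<Sum>i<N. complex_of_real (r i) *\<^sub>C 1)"
      unfolding T_def using v A_simps by (subst E_sum) (simp_all add: E_r)
    also have "\<dots> = complex_of_real (\<Sum>i<N. r i) *\<^sub>C 1"
      by (simp add: complex_vector.scale_sum_left)
    finally have "norm (E T) = \<bar>\<Sum>i<N. r i\<bar>"
      by (simp only: norm_scaleC_one norm_of_real)
    moreover have "norm (E T) \<le> norm T"
      unfolding T_def using v A_simps by (intro E_norm A_simps(11)) auto
    ultimately have "(\<Sum>i<N. r i) \<le> norm T"
      by linarith
    then have "C ^ 2 * (\<Sum>i<N. r i) \<le> C ^ 2 * norm T"
      by (intro mult_left_mono) auto
    moreover have "(\<Sum>i<N. 1) \<le> (\<Sum>i<N. C ^ 2 * r i)"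
      by (intro sum_mono r_ge) auto
    ultimately show ?thesis
      using T_bound by (simp add: sum_distrib_left)
  qed
  then show ?thesis
    by blast
qed

text \<open>
  An orthonormal family of maximal length spans: a vector orthogonal to it could be normalised and
  added.
\<close>

lemma orthonormal_basis_exists: "\<exists>N v. hermitian_space_basis V ip N v"
proof -
  obtain K where K: "\<And>N v. orthonormal N v \<Longrightarrow> real N \<le> K"
    using orthonormal_length_bounded by blast
  define \<P> where "\<P> N \<longleftrightarrow> (\<exists>v. orthonormal N v)" for N
  have bound: "N \<le> nat \<lceil>K\<rceil>" if "\<P> N" for N
    using that K unfolding \<P>_def by (meson of_nat_le_iff order_trans real_nat_ceiling_ge)
  have "\<P> 0"
    by (simp add: \<P>_def orthonormal_def)
  then obtain N where "\<P> N" and max: "\<And>M. \<P> M \<Longrightarrow> M \<le> N"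
    using bound by (metis GreatestI_nat Greatest_le_nat)
  then obtain v where on: "orthonormal N v"
    by (auto simp: \<P>_def)
  then have v: "\<And>i. i < N \<Longrightarrow> v i \<in> V"
    "\<And>i j. i < N \<Longrightarrow> j < N \<Longrightarrow> ip (v i) (v j) = (if i = j then 1 else 0)"
    by (auto simp: orthonormal_def)
  have "x = (\<Sum>i<N. ip (v i) x *\<^sub>C v i)" if x: "x \<in> V" for x
  proof (rule ccontr)
    assume neq: "x \<noteq> (\<Sum>i<N. ip (v i) x *\<^sub>C v i)"
    define y where "y = x - (\<Sum>i<N. ip (v i) x *\<^sub>C v i)"
    have s: "(\<Sum>i<N. ip (v i) x *\<^sub>C v i) \<in> V"
      using v V_simps by (intro V_simps(6)) auto
    have y: "y \<in> V" "y \<noteq> 0"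
      using x s neq V_simps by (auto simp: y_def)
    have orth: "ip (v j) y = 0" if j: "j < N" for j
    proof -
      have "ip (v j) (\<Sum>i<N. ip (v i) x *\<^sub>C v i) = (\<Sum>i<N. ip (v i) x * ip (v j) (v i))"
        using linear_on_comb[OF ip_linear[OF v(1)[OF j]] V_subspace, of "{..<N}" v] v
        by (simp add: scaleC_complex_def)
      also have "\<dots> = (\<Sum>i<N. if i = j then ip (v j) x else 0)"
        using j by (intro sum.cong refl) (simp add: v)
      also have "\<dots> = ip (v j) x"
        using j by simp
      finally have "ip (v j) (\<Sum>i<N. ip (v i) x *\<^sub>C v i) = ip (v j) x" .
      moreover have "x = y + (\<Sum>i<N. ip (v i) x *\<^sub>C v i)"
        by (simp add: y_def)
      then have "ip (v j) x = ip (v j) y + ip (v j) (\<Sum>i<N. ip (v i) x *\<^sub>C v i)"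
        using ip_add_right[OF v(1)[OF j] y(1) s] by simp
      ultimately show ?thesis
        by simp
    qed
    define n where "n = norm (E (star y * y))"
    have "n > 0"
      using faithful[OF V_in_A[OF y(1)]] y by (auto simp: n_def)
    define c where "c = complex_of_real (1 / sqrt n)"
    define w where "w = c *\<^sub>C y"
    have w: "w \<in> V"
      using y V_simps by (simp add: w_def)
    have "ip w w = cnj c * c * ip y y"
      unfolding w_def using y V_simps by (simp add: ip_scale_left ip_scale_right)
    also have "\<dots> = complex_of_real (1 / sqrt n * (1 / sqrt n) * n)"
      by (simp only: ip_self[OF y(1)] n_def[symmetric] c_def complex_cnj_complex_of_real of_real_mult)
    also have "1 / sqrt n * (1 / sqrt n) * n = 1"
      using \<open>n > 0\<close> by (simp add: field_simps)
    finally have ww: "ip w w = 1"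
      by simp
    have vw: "ip (v j) w = 0" "ip w (v j) = 0" if "j < N" for j
      using that orth[OF that] v y w ip_cnj[of "v j" w] by (simp_all add: w_def ip_scale_right)
    have "orthonormal (Suc N) (v(N := w))"
      unfolding orthonormal_def using v w ww vw by (auto simp: less_Suc_eq)
    then have "Suc N \<le> N"
      using max unfolding \<P>_def by blast
    then show False
      by simp
  qed
  then have "hermitian_space_basis V ip N v"
    by unfold_locales (use v in auto)
  then show ?thesis
    by blast
qed

end

section \<open>The basic construction\<close>

lemma cstar_subalgebra_generated: "cstar_subalgebra (cstar_generated X)"
  unfolding cstar_generated_def cstar_subalgebra_def
  by (auto intro: complex_vector.subspace_Inter closed_Inter)

lemma cstar_generated_superset: "X \<subseteq> cstar_generated X"
  by (auto simp: cstar_generated_def)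

lemma cstar_generated_least: "cstar_subalgebra S \<Longrightarrow> X \<subseteq> S \<Longrightarrow> cstar_generated X \<subseteq> S"
  by (auto simp: cstar_generated_def)

lemma expectation_basisI:
  "expectation B A E \<Longrightarrow> quasi_basis A E n lam \<Longrightarrow> expectation_basis B A E {1..n} lam"
  by (simp add: expectation_basis_def expectation_basis_axioms_def quasi_basis_def)

locale basic_step = expectation B A E for B A :: "'a::cstar_algebra set" and E +
  fixes \<tau> :: real and A1 :: "'a set" and e :: 'a and E1 :: "'a \<Rightarrow> 'a"
  assumes bc: "basic_construction B A E \<tau> A1 e E1"
begin

lemma e_star: "star e = e"
  and e_idem: "e * e = e"
  and A1_eq: "A1 = cstar_generated (insert e A)"
  and e_sandwich: "\<And>x. x \<in> A \<Longrightarrow> e * x * e = E x * e"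
  and e_commute: "\<And>b. b \<in> B \<Longrightarrow> e * b = b * e"
  and E1_index_finite: "index_finite A A1 E1"
  and E1_e: "\<And>x y. x \<in> A \<Longrightarrow> y \<in> A \<Longrightarrow> E1 (x * e * y) = \<tau> *\<^sub>R (x * y)"
  using bc by (auto simp: basic_construction_def)

lemma e_in: "e \<in> A1" and A_sub: "A \<subseteq> A1"
  using cstar_generated_superset[of "insert e A"] by (auto simp: A1_eq)

lemma A_in_A1: "x \<in> A \<Longrightarrow> x \<in> A1"
  using A_sub by blast

sublocale dual: expectation A A1 E1
  using A cstar_subalgebra_generated[of "insert e A"] A_sub E1_index_finite
  by unfold_locales (auto simp: A1_eq index_finite_def)

lemma E1_left_e: "x \<in> A \<Longrightarrow> E1 (x * e) = \<tau> *\<^sub>R x"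
  using E1_e[of x 1] A_simps by simp

lemma dual_faithful: "x \<in> A1 \<Longrightarrow> E1 (star x * x) = 0 \<Longrightarrow> x = 0"
proof -
  obtain n lam where "quasi_basis A1 E1 n lam"
    using E1_index_finite by (auto simp: index_finite_def)
  then interpret expectation_basis A A1 E1 "{1..n}" lam
    by (intro expectation_basisI dual.expectation_axioms)
  show "x \<in> A1 \<Longrightarrow> E1 (star x * x) = 0 \<Longrightarrow> x = 0"
    by (rule faithful)
qed

end

locale pos_basic_step = basic_step +
  assumes \<tau>_pos: "\<tau> > 0"
begin

text \<open>
  The elements that, together with their adjoints, map \<open>A e\<close> into itself form a \<open>C\<^sup>*\<close>-algebra
  containing \<open>A\<close> and \<open>e\<close>. It is closed because \<open>E1\<close> recovers \<open>a\<close> continuously from \<open>a e\<close>.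
\<close>

lemma pull_down:
  assumes "y \<in> A1"
  shows "y * e = inverse \<tau> *\<^sub>R (E1 (y * e) * e)"
proof -
  define good where "good x \<longleftrightarrow> x \<in> A1 \<and> (\<forall>a\<in>A. x * a * e = inverse \<tau> *\<^sub>R (E1 (x * a * e) * e))" for x
  note A1 = dual.A_simps
  have Ae: "x * a * e \<in> A1" if "x \<in> A1" "a \<in> A" for x a
    using that A1 e_in A_sub by auto
  have goodI: "good x" if "x \<in> A1" "\<And>a. a \<in> A \<Longrightarrow> \<exists>a'\<in>A. x * a * e = a' * e" for x
  proof -
    have "x * a * e = inverse \<tau> *\<^sub>R (E1 (x * a * e) * e)" if "a \<in> A" for a
    proof -
      obtain a' where "a' \<in> A" "x * a * e = a' * e"
        using \<open>a \<in> A\<close> \<open>\<And>a. a \<in> A \<Longrightarrow> \<exists>a'\<in>A. x * a * e = a' * e\<close> by blast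
      then show ?thesis
        using \<tau>_pos by (simp add: E1_left_e)
    qed
    then show ?thesis
      using that by (simp add: good_def)
  qed
  have goodD: "\<exists>a'\<in>A. x * a * e = a' * e" if "good x" "a \<in> A" for x a
    using that Ae[of x a] dual.E_in[of "x * a * e"] A_simps
    by (intro bexI[of _ "inverse \<tau> *\<^sub>R E1 (x * a * e)"]) (auto simp: good_def)
  have good_A: "good x" if "x \<in> A" for x
    using that A_simps A_sub by (intro goodI bexI[of _ "x * _"]) auto
  have good_e: "good e"
    using e_in E_in_A by (intro goodI) (auto simp: e_sandwich)
  have good_mult: "good (x * y)" if x: "good x" and y: "good y" for x y
  proof (rule goodI)
    show "x * y \<in> A1"
      using x y A1 by (simp add: good_def)
    fix a assume "a \<in> A"
    from goodD[OF y this] obtain b where b: "b \<in> A" "y * a * e = b * e"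
      by blast
    from goodD[OF x this(1)] obtain c where "c \<in> A" "x * b * e = c * e"
      by blast
    then show "\<exists>a'\<in>A. x * y * a * e = a' * e"
      using b by (metis mult.assoc)
  qed
  have good_add: "good (x + y)" if x: "good x" and y: "good y" for x y
  proof (rule goodI)
    show "x + y \<in> A1"
      using x y A1 by (simp add: good_def)
    fix a assume "a \<in> A"
    then obtain b c where "b \<in> A" "y * a * e = b * e" "c \<in> A" "x * a * e = c * e"
      using goodD x y by metis
    then show "\<exists>a'\<in>A. (x + y) * a * e = a' * e"
      using A_simps by (intro bexI[of _ "c + b"]) (auto simp: distrib_right)
  qed
  have good_scale: "good (k *\<^sub>C x)" if x: "good x" for k x
  proof (rule goodI)
    show "k *\<^sub>C x \<in> A1"
      using x A1 by (simp add: good_def)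
    fix a assume "a \<in> A"
    then obtain c where "c \<in> A" "x * a * e = c * e"
      using goodD x by metis
    then show "\<exists>a'\<in>A. (k *\<^sub>C x) * a * e = a' * e"
      using A_simps by (intro bexI[of _ "k *\<^sub>C c"]) (auto simp: mult_scaleC_left)
  qed
  have good_lim: "good x" if f: "\<And>n. good (f n)" "f \<longlonglongrightarrow> x" for f x
    unfolding good_def
  proof (intro conjI ballI)
    show x: "x \<in> A1"
      using closed_sequentially[OF A1(2), of f x] f by (auto simp: good_def)
    fix a assume a: "a \<in> A"
    have lim: "(\<lambda>n. f n * a * e) \<longlonglongrightarrow> x * a * e"
      by (intro tendsto_intros f)
    have "(\<lambda>n. E1 (f n * a * e)) \<longlonglongrightarrow> E1 (x * a * e)"
    proof (rule Lim_transform_bound[OF _ lim[THEN LIM_zero], THEN LIM_zero_cancel])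
      show "\<forall>\<^sub>F n in sequentially. norm (E1 (f n * a * e) - E1 (x * a * e)) \<le> norm (f n * a * e - x * a * e)"
        using f(1) x a Ae A1 dual.E_norm dual.E_diff
        by (intro always_eventually allI) (metis good_def)
    qed
    then have "(\<lambda>n. inverse \<tau> *\<^sub>R (E1 (f n * a * e) * e)) \<longlonglongrightarrow> inverse \<tau> *\<^sub>R (E1 (x * a * e) * e)"
      by (intro tendsto_intros)
    moreover have "(\<lambda>n. inverse \<tau> *\<^sub>R (E1 (f n * a * e) * e)) = (\<lambda>n. f n * a * e)"
      using f(1) a by (auto simp: good_def)
    ultimately have "(\<lambda>n. f n * a * e) \<longlonglongrightarrow> inverse \<tau> *\<^sub>R (E1 (x * a * e) * e)"
      by (simp only:)
    then show "x * a * e = inverse \<tau> *\<^sub>R (E1 (x * a * e) * e)"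
      by (rule LIMSEQ_unique[OF lim])
  qed
  define T where "T = {x. good x \<and> good (star x)}"
  have "cstar_subalgebra T"
    unfolding cstar_subalgebra_def
  proof (intro conjI ballI)
    show "complex_vector.subspace T"
      using good_add good_scale good_A[of 0] A_simps
      by (auto simp: complex_vector.subspace_def T_def star_add star_scaleC)
    show "closed T"
      unfolding closed_sequential_limits
    proof (intro allI impI, elim conjE)
      fix f x assume f: "\<forall>n. f n \<in> T" and lim: "f \<longlonglongrightarrow> x"
      have "(\<lambda>n. star (f n)) \<longlonglongrightarrow> star x"
      proof (rule Lim_transform_bound[OF _ lim[THEN LIM_zero], THEN LIM_zero_cancel])
        show "\<forall>\<^sub>F n in sequentially. norm (star (f n) - star x) \<le> norm (f n - x)"
          by (simp add: star_diff[symmetric] norm_star)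
      qed
      then show "x \<in> T"
        using f lim good_lim[of f x] good_lim[of "\<lambda>n. star (f n)" "star x"] by (simp add: T_def)
    qed
    show "1 \<in> T"
      using good_A[of 1] A_simps by (simp add: T_def)
    show "x * y \<in> T" if "x \<in> T" "y \<in> T" for x y
      using that good_mult by (simp add: T_def star_mult)
    show "star x \<in> T" if "x \<in> T" for x
      using that by (simp add: T_def star_star)
  qed
  moreover have "insert e A \<subseteq> T"
    using good_e good_A A_simps by (auto simp: T_def e_star)
  ultimately have "A1 \<subseteq> T"
    unfolding A1_eq by (rule cstar_generated_least)
  then have "good y"
    using assms by (auto simp: T_def)
  then have "y * 1 * e = inverse \<tau> *\<^sub>R (E1 (y * 1 * e) * e)"
    using A_simps(3) unfolding good_def by blast
  then show ?thesis
    by (simp only: mult_1_right)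
qed

end

locale indexed_basic_step =
  pos_basic_step B A E \<tau> A1 e E1 + expectation_basis B A E I \<nu>
  for B A :: "'a::cstar_algebra set" and E \<tau> A1 e E1 and I :: "'i set" and \<nu> +
  assumes index: "(\<Sum>i\<in>I. \<nu> i * star (\<nu> i)) = inverse \<tau> *\<^sub>R 1"
begin

text \<open>
  The sum is a projection that acts as the identity on \<open>A e\<close>; by the value of the index, \<open>E1\<close> maps
  its complement to \<open>0\<close>.
\<close>

lemma jones_partition_of_unity: "(\<Sum>i\<in>I. \<nu> i * e * star (\<nu> i)) = 1"
proof -
  define f where "f = (\<Sum>i\<in>I. \<nu> i * e * star (\<nu> i))"
  note A1 = dual.A_simps
  have f_in: "f \<in> A1"
    unfolding f_def using \<nu>_in A_in_A1 e_in A1 by (intro A1(11)) auto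
  have f_e: "f * a * e = a * e" if "a \<in> A" for a
  proof -
    have "f * a * e = (\<Sum>i\<in>I. \<nu> i * (e * (star (\<nu> i) * a) * e))"
      by (simp add: f_def sum_distrib_right mult.assoc)
    also have "\<dots> = (\<Sum>i\<in>I. \<nu> i * (E (star (\<nu> i) * a) * e))"
      using that \<nu>_in A_simps by (intro sum.cong refl) (simp add: e_sandwich)
    also have "\<dots> = (\<Sum>i\<in>I. \<nu> i * E (star (\<nu> i) * a)) * e"
      by (simp add: sum_distrib_right mult.assoc)
    finally show ?thesis
      using basis[OF that] by simp
  qed
  have f_star: "star f = f"
    by (simp add: f_def star_sum star_mult star_star e_star mult.assoc)
  have "f * f = (\<Sum>i\<in>I. f * \<nu> i * e * star (\<nu> i))"
    by (subst (2) f_def) (simp add: sum_distrib_left mult.assoc)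
  also have "\<dots> = (\<Sum>i\<in>I. \<nu> i * e * star (\<nu> i))"
    using \<nu>_in by (intro sum.cong refl) (simp add: f_e)
  also have "\<dots> = f"
    by (rule f_def[symmetric])
  finally have f_idem: "f * f = f" .
  have "E1 f = (\<Sum>i\<in>I. E1 (\<nu> i * e * star (\<nu> i)))"
    unfolding f_def using \<nu>_in A_in_A1 e_in A1 by (intro dual.E_sum) auto
  also have "\<dots> = \<tau> *\<^sub>R (\<Sum>i\<in>I. \<nu> i * star (\<nu> i))"
    using \<nu>_in A_simps by (simp add: E1_e scaleR_sum_right)
  also have "\<dots> = 1"
    using \<tau>_pos by (simp add: index)
  finally have "E1 (1 - f) = 0"
    using f_in A1 dual.E_one by (simp add: dual.E_diff)
  moreover have "star (1 - f) * (1 - f) = 1 - f"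
    by (simp add: star_diff f_star left_diff_distrib right_diff_distrib f_idem)
  ultimately have "E1 (star (1 - f) * (1 - f)) = 0"
    by (simp only:)
  then have "1 - f = 0"
    by (rule dual_faithful[rotated]) (intro A1 f_in)
  then show ?thesis
    by (simp add: f_def)
qed

text \<open>
  Inserting the partition of unity and pulling down, \<open>E1 (x\<^sup>* x)\<close> becomes a sum of elements
  \<open>a a\<^sup>*\<close> with \<open>a\<close> in \<open>A\<close>; this makes \<open>E \<circ> E1\<close> positive without square roots.
\<close>

lemma dual_square_sum:
  assumes x: "x \<in> A1"
  shows "E1 (star x * x) = \<tau> *\<^sub>R (\<Sum>i\<in>I. (inverse \<tau> *\<^sub>R E1 (star x * \<nu> i * e))
    * star (inverse \<tau> *\<^sub>R E1 (star x * \<nu> i * e)))" (is "_ = \<tau> *\<^sub>R (\<Sum>i\<in>I. ?a i * star (?a i))")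
proof -
  note A1 = dual.A_simps
  have a_in: "?a i \<in> A" "star (?a i) \<in> A" if "i \<in> I" for i
    using that x A1 A_simps \<nu>_in[OF that] A_sub e_in dual.E_in[of "star x * \<nu> i * e"] by auto
  have a: "star x * \<nu> i * e = ?a i * e" if "i \<in> I" for i
    using pull_down[of "star x * \<nu> i"] that x A1 \<nu>_in[OF that] A_sub by auto
  have square: "u * e * star (u * e) = u * e * star u" for u
  proof -
    have "u * e * star (u * e) = u * (e * e) * star u"
      by (simp add: star_mult e_star mult.assoc)
    then show ?thesis
      by (simp add: e_idem)
  qed
  have "star x * x = star x * (\<Sum>i\<in>I. \<nu> i * e * star (\<nu> i)) * x"
    by (simp add: jones_partition_of_unity)
  also have "\<dots> = (\<Sum>i\<in>I. (star x * \<nu> i * e) * star (star x * \<nu> i * e))"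
  proof -
    have "(star x * \<nu> i * e) * star (star x * \<nu> i * e) = star x * (\<nu> i * e * star (\<nu> i)) * x" for i
      unfolding square by (simp add: star_mult star_star mult.assoc)
    then show ?thesis
      by (simp add: sum_distrib_left sum_distrib_right)
  qed
  also have "\<dots> = (\<Sum>i\<in>I. ?a i * e * star (?a i))"
  proof (intro sum.cong refl)
    fix i assume "i \<in> I"
    show "(star x * \<nu> i * e) * star (star x * \<nu> i * e) = ?a i * e * star (?a i)"
      by (rule trans[OF arg_cong[OF a[OF \<open>i \<in> I\<close>], of "\<lambda>z. z * star z"] square])
  qed
  finally have "E1 (star x * x) = E1 (\<Sum>i\<in>I. ?a i * e * star (?a i))"
    by (rule arg_cong)
  also have "\<dots> = (\<Sum>i\<in>I. E1 (?a i * e * star (?a i)))"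
    by (intro dual.E_sum A1(5) A_in_A1[OF a_in(1)] A_in_A1[OF a_in(2)] e_in)
  also have "\<dots> = (\<Sum>i\<in>I. \<tau> *\<^sub>R (?a i * star (?a i)))"
    by (intro sum.cong refl E1_e a_in)
  finally show ?thesis
    by (simp only: scaleR_sum_right)
qed

lemma expectation_comp: "expectation B A1 (\<lambda>x. E (E1 x))"
proof
  show "cstar_subalgebra B" "cstar_subalgebra A1"
    by (rule B dual.A)+
  show "B \<subseteq> A1"
    using sub A_sub by blast
  have "cstar_positive (E (E1 (star x * x)))" if x: "x \<in> A1" for x
  proof -
    define a where "a i = star (inverse \<tau> *\<^sub>R E1 (star x * \<nu> i * e))" for i
    have a: "a i \<in> A" if "i \<in> I" for i
      unfolding a_def
      using that x dual.A_simps A_simps \<nu>_in[OF that] A_sub e_in dual.E_in[of "star x * \<nu> i * e"] by auto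
    have "E1 (star x * x) = \<tau> *\<^sub>R (\<Sum>i\<in>I. star (a i) * a i)"
      by (simp add: dual_square_sum[OF x] a_def star_star)
    then have "E (E1 (star x * x)) = \<tau> *\<^sub>R E (\<Sum>i\<in>I. star (a i) * a i)"
      using a A_simps by (simp only:) (intro E_scaleR A_simps(11), auto)
    also have "E (\<Sum>i\<in>I. star (a i) * a i) = (\<Sum>i\<in>I. E (star (a i) * a i))"
      using a A_simps by (intro E_sum) auto
    finally show ?thesis
      using a E_pos \<tau>_pos by (auto intro!: cstar_positive_scaleR cstar_positive_sum)
  qed
  moreover have "norm (E (E1 x)) \<le> norm x" if "x \<in> A1" for x
    using E_norm[of "E1 x"] dual.E_norm[of x] dual.E_in that by force
  ultimately show "cond_expectation B A1 (\<lambda>x. E (E1 x))"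
    unfolding cond_expectation_def
    using E_in E_id E_left E_right dual.E_in dual.E_id dual.E_left dual.E_right B_in_A
    by (auto intro!: linear_onI simp: dual.E_add dual.E_scale E_add E_scale)
qed

lemma expectation_basis_comp:
  assumes "expectation_basis A A1 E1 J \<mu>"
  shows "expectation_basis B A1 (\<lambda>x. E (E1 x)) (J \<times> I) (\<lambda>(j, i). \<mu> j * \<nu> i)"
proof -
  interpret D: expectation_basis A A1 E1 J \<mu>
    by fact
  interpret C: expectation B A1 "\<lambda>x. E (E1 x)"
    by (rule expectation_comp)
  show ?thesis
  proof
    show "finite (J \<times> I)"
      using finite_I D.finite_I by simp
    show "(case k of (j, i) \<Rightarrow> \<mu> j * \<nu> i) \<in> A1" if "k \<in> J \<times> I" for k
      using that D.\<nu>_in \<nu>_in A_in_A1 dual.A_simps by (auto split: prod.splits)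
    fix x assume x: "x \<in> A1"
    have "\<mu> j * E1 (star (\<mu> j) * x)
        = (\<Sum>i\<in>I. \<mu> j * \<nu> i * E (E1 (star (\<mu> j * \<nu> i) * x)))" if j: "j \<in> J" for j
    proof -
      have m: "star (\<mu> j) * x \<in> A1"
        using x j D.\<nu>_in dual.A_simps by simp
      have "E1 (star (\<mu> j) * x) = (\<Sum>i\<in>I. \<nu> i * E (star (\<nu> i) * E1 (star (\<mu> j) * x)))"
        using dual.E_in[OF m] by (rule basis)
      also have "\<dots> = (\<Sum>i\<in>I. \<nu> i * E (E1 (star (\<mu> j * \<nu> i) * x)))"
        using m \<nu>_in A_simps
        by (intro sum.cong refl) (simp add: dual.E_left[symmetric] star_mult mult.assoc)
      finally have eq: "E1 (star (\<mu> j) * x) = (\<Sum>i\<in>I. \<nu> i * E (E1 (star (\<mu> j * \<nu> i) * x)))" .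
      show ?thesis
        by (subst eq) (simp add: sum_distrib_left mult.assoc)
    qed
    then have "x = (\<Sum>j\<in>J. \<Sum>i\<in>I. \<mu> j * \<nu> i * E (E1 (star (\<mu> j * \<nu> i) * x)))"
      using D.basis[OF x] by simp
    then show "x = (\<Sum>k\<in>J \<times> I. (case k of (j, i) \<Rightarrow> \<mu> j * \<nu> i)
        * E (E1 (star (case k of (j, i) \<Rightarrow> \<mu> j * \<nu> i) * x)))"
      by (simp add: sum.cartesian_product case_prod_unfold)
  qed
qed

end

section \<open>The Fourier transform\<close>

locale jones_tower =
  s1: indexed_basic_step B A E0 \<tau> A1 e1 E1 "{1..n}" lam + s2: pos_basic_step A A1 E1 \<tau> A2 e2 E2
  for B A :: "'a::cstar_algebra set" and E0 \<tau> A1 e1 E1 and n :: nat and lam A2 e2 E2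
begin

definition V where "V = rel_commutant B A1"
definition W where "W = rel_commutant A A2"
definition F where "F = fourier \<tau> n lam e1 e2"
text \<open>The inverse Fourier transform.\<close>
definition G where "G w = (\<tau> powr (-3/2)) *\<^sub>R E2 (w * e1 * e2)" for w

lemma V_D: "x \<in> V \<Longrightarrow> x \<in> A1" "x \<in> V \<Longrightarrow> b \<in> B \<Longrightarrow> b * x = x * b"
  and W_D: "w \<in> W \<Longrightarrow> w \<in> A2" "w \<in> W \<Longrightarrow> a \<in> A \<Longrightarrow> a * w = w * a"
  by (auto simp: V_def W_def rel_commutant_def)

lemma V_I: "x \<in> A1 \<Longrightarrow> (\<And>b. b \<in> B \<Longrightarrow> b * x = x * b) \<Longrightarrow> x \<in> V"
  and W_I: "w \<in> A2 \<Longrightarrow> (\<And>a. a \<in> A \<Longrightarrow> a * w = w * a) \<Longrightarrow> w \<in> W"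
  by (auto simp: V_def W_def rel_commutant_def)

lemmas A_simps = s1.A_simps and A1_simps = s1.dual.A_simps and A2_simps = s2.dual.A_simps
lemmas \<tau>_pos = s1.\<tau>_pos

lemma A_A1: "x \<in> A \<Longrightarrow> x \<in> A1" and A1_A2: "x \<in> A1 \<Longrightarrow> x \<in> A2"
  using s1.A_sub s2.A_sub by auto

lemma e1_in: "e1 \<in> A1" and e2_in: "e2 \<in> A2"
  by (rule s1.e_in s2.e_in)+

lemma W_mult: "w \<in> W \<Longrightarrow> w' \<in> W \<Longrightarrow> w * w' \<in> W"
  by (rule W_I) (use W_D A2_simps in \<open>auto simp: mult.assoc[symmetric], metis mult.assoc\<close>)

lemma E1_e1: "E1 e1 = \<tau> *\<^sub>R 1"
  using s1.E1_left_e[of 1] A_simps by simp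

lemma e2_e1_e2: "e2 * e1 * e2 = \<tau> *\<^sub>R e2"
  by (simp add: s2.e_sandwich[OF e1_in] E1_e1)

text \<open>
  \<open>e1 - \<tau>\<^sup>-\<^sup>1 e1 e2 e1\<close> is a projection because \<open>e2 e1 e2 = \<tau> e2\<close>, and \<open>E2\<close> maps it to \<open>0\<close>.
\<close>

lemma e1_e2_e1: "e1 * e2 * e1 = \<tau> *\<^sub>R e1"
proof -
  define q where "q = e1 * e2 * e1"
  define p where "p = e1 - inverse \<tau> *\<^sub>R q"
  have q_in: "q \<in> A2" and p_in: "p \<in> A2"
    using e1_in e2_in A1_A2 A2_simps by (auto simp: p_def q_def)
  have "q * q = e1 * (e2 * (e1 * e1) * e2) * e1"
    by (simp add: q_def mult.assoc)
  then have qq: "q * q = \<tau> *\<^sub>R q"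
    by (simp add: s1.e_idem e2_e1_e2 q_def)
  have eq: "e1 * q = q" "q * e1 = q"
    by (simp_all add: q_def mult.assoc s1.e_idem) (simp add: mult.assoc[symmetric] s1.e_idem)
  have "star q = q"
    by (simp add: q_def star_mult s1.e_star s2.e_star mult.assoc)
  then have "star p * p = p * p"
    by (simp add: p_def star_diff star_scaleR s1.e_star)
  also have "\<dots> = p"
    using \<tau>_pos by (simp add: p_def left_diff_distrib right_diff_distrib s1.e_idem eq qq)
  finally have pp: "star p * p = p" .
  have "E2 q = \<tau> *\<^sub>R e1"
    unfolding q_def using s2.E1_e[OF e1_in e1_in] by (simp add: s1.e_idem)
  then have "E2 p = 0"
    unfolding p_def using \<tau>_pos e1_in A1_A2 q_in A2_simps
    by (simp add: s2.dual.E_diff s2.dual.E_scaleR s2.dual.E_id)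
  then have "p = 0"
    using s2.dual_faithful[OF p_in] pp by simp
  then have "\<tau> *\<^sub>R e1 = \<tau> *\<^sub>R (inverse \<tau> *\<^sub>R q)"
    by (simp add: p_def)
  then show ?thesis
    using \<tau>_pos by (simp add: q_def)
qed

lemma F_eq: "F x = (\<tau> powr (-3/2) * \<tau>) *\<^sub>R (\<Sum>i=1..n. lam i * (x * e2 * e1) * star (lam i))"
  by (simp add: F_def fourier_def commutant_expectation_def)

text \<open>
  The element \<open>x e2 e1\<close> commutes with \<open>B\<close>, hence its average commutes with \<open>A\<close>.
\<close>

lemma F_in: assumes x: "x \<in> V" shows "F x \<in> W"
proof (rule W_I)
  have "lam i * (x * e2 * e1) * star (lam i) \<in> A2" if "i \<in> {1..n}" for i
    using s1.\<nu>_in[OF that] V_D(1)[OF x] A_A1 A1_A2 e1_in e2_in A2_simps by simp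
  then show "F x \<in> A2"
    unfolding F_eq by (intro A2_simps(10,11))
  have "b * (x * e2 * e1) = x * e2 * e1 * b" if "b \<in> B" for b
    using V_D(2)[OF x that] s1.e_commute[OF that] s2.e_commute[OF s1.B_in_A[OF that]]
    by (metis mult.assoc)
  from s1.averaging_commutes[OF this] show "a * F x = F x * a" if "a \<in> A" for a
    using that by (simp add: F_eq)
qed

lemma G_in: assumes w: "w \<in> W" shows "G w \<in> V"
proof (rule V_I)
  have in2: "w * e1 * e2 \<in> A2"
    using W_D(1)[OF w] e1_in e2_in A1_A2 A2_simps by simp
  then show "G w \<in> A1"
    unfolding G_def by (intro A1_simps(10) s2.dual.E_in)
  show "b * G w = G w * b" if "b \<in> B" for b
  proof -
    have b: "b \<in> A" "b \<in> A1"
      using that s1.B_in_A A_A1 by auto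
    have "b * (w * e1 * e2) = w * e1 * e2 * b"
      using W_D(2)[OF w b(1)] s1.e_commute[OF that] s2.e_commute[OF b(1)] by (metis mult.assoc)
    then show ?thesis
      using s2.dual.E_left[OF b(2) in2] s2.dual.E_right[OF b(2) in2] by (simp add: G_def)
  qed
qed

lemma powr_tau: "\<tau> powr (-3/2) * \<tau> * \<tau> = \<tau> powr (1/2)" "\<tau> powr (-3/2) * (\<tau> powr (1/2) * \<tau>) = 1"
proof -
  have t: "\<tau> = \<tau> powr 1"
    using \<tau>_pos by simp
  have "\<tau> powr (-3/2) * \<tau> powr 1 * \<tau> powr 1 = \<tau> powr (1/2)"
    "\<tau> powr (-3/2) * (\<tau> powr (1/2) * \<tau> powr 1) = \<tau> powr 0"
    by (simp_all only: powr_add[symmetric]) simp_all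
  then show "\<tau> powr (-3/2) * \<tau> * \<tau> = \<tau> powr (1/2)" "\<tau> powr (-3/2) * (\<tau> powr (1/2) * \<tau>) = 1"
    using \<tau>_pos by simp_all
qed

text \<open>
  In each summand \<open>e1 \<lambda>\<^sub>i\<^sup>* e1 = E0 \<lambda>\<^sub>i\<^sup>* e1\<close>, and \<open>E0 \<lambda>\<^sub>i\<^sup>*\<close> moves to the left through \<open>e2\<close> and \<open>x\<close>, where
  \<open>\<Sum>\<^sub>i \<lambda>\<^sub>i E0 \<lambda>\<^sub>i\<^sup>* = 1\<close>; what remains is \<open>e2 e1 e2 = \<tau> e2\<close>.
\<close>

lemma G_F: assumes x: "x \<in> V" shows "G (F x) = x"
proof -
  have summand: "lam i * (x * e2 * e1) * star (lam i) * e1 * e2 = \<tau> *\<^sub>R (lam i * E0 (star (lam i)) * (x * e2))"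
    if "i \<in> {1..n}" for i
  proof -
    let ?l = "star (lam i)"
    have l: "?l \<in> A" "E0 ?l \<in> B" "E0 ?l \<in> A"
      using s1.\<nu>_in[OF that] A_simps s1.E_in s1.E_in_A by auto
    have "lam i * (x * e2 * e1) * ?l * e1 * e2 = lam i * x * e2 * (e1 * ?l * e1) * e2"
      by (simp add: mult.assoc)
    also have "\<dots> = lam i * x * (e2 * E0 ?l) * e1 * e2"
      unfolding s1.e_sandwich[OF l(1)] by (simp add: mult.assoc)
    also have "\<dots> = lam i * (x * E0 ?l) * (e2 * e1 * e2)"
      unfolding s2.e_commute[OF l(3)] by (simp add: mult.assoc)
    also have "\<dots> = \<tau> *\<^sub>R (lam i * E0 ?l * (x * e2))"
      unfolding e2_e1_e2 V_D(2)[OF x l(2), symmetric] by (simp add: mult.assoc)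
    finally show ?thesis .
  qed
  have "F x * e1 * e2
      = (\<tau> powr (-3/2) * \<tau>) *\<^sub>R (\<Sum>i=1..n. lam i * (x * e2 * e1) * star (lam i) * e1 * e2)"
    by (simp add: F_eq sum_distrib_right)
  also have "(\<Sum>i=1..n. lam i * (x * e2 * e1) * star (lam i) * e1 * e2)
      = (\<Sum>i=1..n. \<tau> *\<^sub>R (lam i * E0 (star (lam i)) * (x * e2)))"
    by (intro sum.cong refl summand)
  also have "(\<tau> powr (-3/2) * \<tau>) *\<^sub>R \<dots>
      = (\<tau> powr (-3/2) * \<tau> * \<tau>) *\<^sub>R ((\<Sum>i=1..n. lam i * E0 (star (lam i))) * (x * e2))"
    by (simp add: scaleR_sum_right[symmetric] sum_distrib_right)
  also have "(\<Sum>i=1..n. lam i * E0 (star (lam i))) = 1"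
    using s1.basis[of 1] A_simps by simp
  finally have "F x * e1 * e2 = (\<tau> powr (1/2)) *\<^sub>R (x * e2)"
    by (simp only: powr_tau mult_1_left)
  then have "G (F x) = \<tau> powr (-3/2) *\<^sub>R ((\<tau> powr (1/2)) *\<^sub>R E2 (x * e2))"
    unfolding G_def using V_D(1)[OF x] A1_A2 e2_in A2_simps by (simp add: s2.dual.E_scaleR)
  also have "E2 (x * e2) = \<tau> *\<^sub>R x"
    by (rule s2.E1_left_e[OF V_D(1)[OF x]])
  finally have "G (F x) = (\<tau> powr (-3/2) * (\<tau> powr (1/2) * \<tau>)) *\<^sub>R x"
    by simp
  then show ?thesis
    by (simp only: powr_tau scaleR_one)
qed

text \<open>
  Pulling down gives \<open>E2 (w e1 e2) e2 = \<tau> w e1 e2\<close>; then \<open>e1 e2 e1 = \<tau> e1\<close>, and \<open>w\<close> moves out of the sum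
  \<open>\<Sum>\<^sub>i \<lambda>\<^sub>i w e1 \<lambda>\<^sub>i\<^sup>*\<close> because it commutes with \<open>A\<close>.
\<close>

lemma F_G: assumes w: "w \<in> W" shows "F (G w) = w"
proof -
  have "w * e1 * e2 = inverse \<tau> *\<^sub>R (E2 (w * e1 * e2) * e2)"
    using W_D(1)[OF w] e1_in A1_A2 A2_simps by (intro s2.pull_down) simp
  then have "\<tau> *\<^sub>R (w * e1 * e2) = E2 (w * e1 * e2) * e2"
    using \<tau>_pos by (metis less_irrefl right_inverse scaleR_one scaleR_scaleR)
  then have Ge2: "G w * e2 = (\<tau> powr (-3/2) * \<tau>) *\<^sub>R (w * e1 * e2)"
    by (simp add: G_def) (metis scaleR_scaleR)
  have Ge: "G w * e2 * e1 = (\<tau> powr (1/2)) *\<^sub>R (w * e1)"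
  proof -
    have "G w * e2 * e1 = (\<tau> powr (-3/2) * \<tau>) *\<^sub>R (w * (e1 * e2 * e1))"
      unfolding Ge2 by (simp add: mult.assoc)
    also have "\<dots> = (\<tau> powr (-3/2) * \<tau> * \<tau>) *\<^sub>R (w * e1)"
      by (simp add: e1_e2_e1)
    finally show ?thesis
      by (simp only: powr_tau)
  qed
  have "F (G w) = (\<tau> powr (-3/2) * \<tau> * \<tau> powr (1/2)) *\<^sub>R (\<Sum>i=1..n. lam i * w * e1 * star (lam i))"
    unfolding F_eq Ge by (simp add: scaleR_sum_right[symmetric] mult.assoc)
  also have "(\<Sum>i=1..n. lam i * w * e1 * star (lam i)) = (\<Sum>i=1..n. w * (lam i * e1 * star (lam i)))"
    using W_D(2)[OF w s1.\<nu>_in] by (intro sum.cong refl) (simp add: mult.assoc[symmetric])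
  also have "\<dots> = w"
    by (simp only: sum_distrib_left[symmetric] s1.jones_partition_of_unity mult_1_right)
  finally show ?thesis
    using powr_tau(2) by (simp add: mult_ac)
qed

lemma e1_V: "e1 \<in> V"
  using e1_in s1.e_commute by (intro V_I) auto

lemma F_e1: "F e1 = (\<tau> powr (1/2)) *\<^sub>R 1"
proof -
  have "F e1 = (\<tau> powr (-3/2) * \<tau> * \<tau>) *\<^sub>R (\<Sum>i=1..n. lam i * e1 * star (lam i))"
    unfolding F_eq e1_e2_e1 by (simp add: scaleR_sum_right[symmetric])
  then show ?thesis
    by (simp only: powr_tau s1.jones_partition_of_unity)
qed

lemma convolution_eq:
  assumes "x \<in> V" "y \<in> V"
  shows "convolution V F x y = G (F y * F x)"
proof -
  have "inj_on F V"
    using G_F by (rule inj_on_inverseI)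
  moreover have w: "F y * F x \<in> W"
    using assms by (intro W_mult F_in)
  ultimately show ?thesis
    unfolding convolution_def
    using inv_into_f_f[of F V "G (F y * F x)"] G_in[OF w] F_G[OF w] by simp
qed

lemma convolution_in: "x \<in> V \<Longrightarrow> y \<in> V \<Longrightarrow> convolution V F x y \<in> V"
  by (simp add: convolution_eq G_in W_mult F_in)

lemma convolution_assoc:
  assumes "x \<in> V" "y \<in> V" "z \<in> V"
  shows "convolution V F (convolution V F x y) z = convolution V F x (convolution V F y z)"
  using assms
  by (simp add: convolution_in convolution_eq[of "convolution V F x y"]
      convolution_eq[of x "convolution V F y z"])
    (simp add: convolution_eq F_G W_mult F_in mult.assoc)

lemma V_subspace: "complex_vector.subspace V"
  using A1_simps
  by (auto simp: complex_vector.subspace_def V_def rel_commutant_def distrib_left distrib_right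
      mult_scaleC_left mult_scaleC_right)

lemma F_linear: "linear_on V F"
  by (rule linear_onI)
    (simp_all add: F_eq distrib_left distrib_right sum.distrib scaleR_add_right mult_scaleC_left
      mult_scaleC_right complex_vector.scale_sum_right[symmetric] scaleR_scaleC scaleC_scaleC scaleC_add_right mult.commute)

lemma G_linear: "linear_on W G"
proof (rule linear_onI)
  fix x y assume "x \<in> W" "y \<in> W"
  then show "G (x + y) = G x + G y"
    using W_D(1) e1_in e2_in A1_A2 A2_simps
    by (simp add: G_def distrib_right s2.dual.E_add scaleR_add_right)
next
  fix c x assume "x \<in> W"
  then show "G (c *\<^sub>C x) = c *\<^sub>C G x"
    using W_D(1) e1_in e2_in A1_A2 A2_simps
    by (simp add: G_def mult_scaleC_left s2.dual.E_scale scaleR_scaleC scaleC_scaleC mult.commute)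
qed

lemma convolution_bilinear: "bilinear_on V V (convolution V F)"
proof (rule bilinear_onI)
  note V = complex_vector.subspace_add[OF V_subspace] complex_vector.subspace_scale[OF V_subspace]
  note lin = linear_on_add[OF F_linear] linear_on_scale[OF F_linear]
    linear_on_add[OF G_linear, symmetric] linear_on_scale[OF G_linear, symmetric]
  show "convolution V F (x + y) w = convolution V F x w + convolution V F y w"
    "convolution V F w (x + y) = convolution V F w x + convolution V F w y"
    if "x \<in> V" "y \<in> V" "w \<in> V" for x y w
    using that V by (simp_all add: convolution_eq lin F_in W_mult distrib_left distrib_right)
  show "convolution V F (c *\<^sub>C x) w = c *\<^sub>C convolution V F x w"
    "convolution V F w (c *\<^sub>C x) = c *\<^sub>C convolution V F w x"
    if "x \<in> V" "w \<in> V" for x w c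
    using that V
    by (simp_all add: convolution_eq lin F_in W_mult mult_scaleC_left mult_scaleC_right)
qed

lemma convolution_e1:
  assumes x: "x \<in> V"
  shows "convolution V F e1 x = complex_of_real (\<tau> powr (1/2)) *\<^sub>C x"
    "convolution V F x e1 = complex_of_real (\<tau> powr (1/2)) *\<^sub>C x"
  using x e1_V F_in[OF x] linear_on_scaleR[OF G_linear F_in[OF x]]
  by (simp_all add: convolution_eq F_e1 G_F scaleR_scaleC mult_scaleC_left mult_scaleC_right)

end


section \<open>The index\<close>

text \<open>
  Expand each element of the first quasi-basis in the second one, and then use the first quasi-basis
  in adjoint form.
\<close>

lemma index_independent:
  assumes "expectation_basis B A E I \<nu>" "expectation_basis B A E J \<mu>"
  shows "(\<Sum>i\<in>I. \<nu> i * star (\<nu> i)) = (\<Sum>j\<in>J. \<mu> j * star (\<mu> j))"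
proof -
  interpret X: expectation_basis B A E I \<nu> by fact
  interpret Y: expectation_basis B A E J \<mu> by fact
  have "(\<Sum>i\<in>I. \<nu> i * star (\<nu> i)) = (\<Sum>i\<in>I. (\<Sum>j\<in>J. \<mu> j * E (star (\<mu> j) * \<nu> i)) * star (\<nu> i))"
    using Y.basis[OF X.\<nu>_in] by (intro sum.cong refl) simp
  also have "\<dots> = (\<Sum>j\<in>J. \<mu> j * (\<Sum>i\<in>I. E (star (\<mu> j) * \<nu> i) * star (\<nu> i)))"
    by (simp only: sum_distrib_left sum_distrib_right mult.assoc) (rule sum.swap)
  also have "\<dots> = (\<Sum>j\<in>J. \<mu> j * star (\<mu> j))"
    using X.basis_adjoint[OF X.A_simps(6)[OF Y.\<nu>_in]] by (intro sum.cong refl) simp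
  finally show ?thesis .
qed

text \<open>
  The sum is self-adjoint and central, hence a real scalar, and the same one for every quasi-basis.
\<close>

lemma quasi_basis_sum_eq_index:
  assumes "expectation B A E" and simple: "simple_cstar A" and qb: "quasi_basis A E n lam"
  shows "(\<Sum>i=1..n. lam i * star (lam i)) = watatani_index A E *\<^sub>R 1"
proof -
  interpret expectation_basis B A E "{1..n}" lam
    by (rule expectation_basisI[OF assms(1,3)])
  define f where "f = (\<Sum>i=1..n. lam i * star (lam i))"
  have "a * f = f * a" if "a \<in> A" for a
    using averaging_commutes[of 1 a] that by (simp add: f_def)
  moreover have "f \<in> A"
    unfolding f_def using \<nu>_in A_simps by (intro A_simps(11)) auto
  ultimately obtain z where z: "f = z *\<^sub>C 1"
    using simple_cstar_centre_scalar[OF A simple] by metis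
  have "star f = f"
    by (simp add: f_def star_sum star_mult star_star)
  then have "cnj z = z"
    by (simp add: z star_scaleC scaleC_one_inject)
  then have "z = complex_of_real (Re z)"
    by (simp add: complex_eq_iff)
  then have f: "f = Re z *\<^sub>R 1"
    by (simp add: z scaleR_scaleC)
  have "watatani_index A E = Re z"
    unfolding watatani_index_def
  proof (rule the_equality)
    show "\<exists>n lam. quasi_basis A E n lam \<and> (\<Sum>i=1..n. lam i * star (lam i)) = Re z *\<^sub>R 1"
      using qb f unfolding f_def by blast
    fix c assume "\<exists>n lam. quasi_basis A E n lam \<and> (\<Sum>i=1..n. lam i * star (lam i)) = c *\<^sub>R 1"
    then obtain m mu where "quasi_basis A E m mu" "(\<Sum>i=1..m. mu i * star (mu i)) = c *\<^sub>R 1"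
      by blast
    then have "c *\<^sub>R (1::'a) = Re z *\<^sub>R 1"
      using index_independent[OF expectation_basisI expectation_basisI, OF assms(1) _ assms(1) qb] f
      by (metis f_def)
    then show "c = Re z"
      by simp
  qed
  then show ?thesis
    using f by (simp add: f_def)
qed

text \<open>
  The scalar is a sum of positive elements; if it were \<open>0\<close>, each of them would vanish and the
  quasi-basis would represent only \<open>0\<close>.
\<close>

lemma (in basic_step) index_positive:
  assumes "expectation_basis B A E I \<nu>" and index: "(\<Sum>i\<in>I. \<nu> i * star (\<nu> i)) = c *\<^sub>R 1"
  shows "c > 0"
proof (rule ccontr)
  interpret expectation_basis B A E I \<nu> by fact
  assume "\<not> c > 0"
  have pos: "cstar_positive (\<nu> i * star (\<nu> i))" if "i \<in> I" for i
    using dual.positive_square[of "star (\<nu> i)"] \<nu>_in[OF that] A_simps by (simp add: star_star)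
  then have "cstar_positive (c *\<^sub>R (1::'a))"
    unfolding index[symmetric] by (rule cstar_positive_sum)
  then have c: "c = 0"
    using \<open>\<not> c > 0\<close> cstar_positive_scalar[of c] by (simp add: scaleR_scaleC)
  have "\<nu> i = 0" if i: "i \<in> I" for i
  proof -
    have "(\<Sum>j\<in>I. \<nu> j * star (\<nu> j)) - \<nu> i * star (\<nu> i) = (\<Sum>j\<in>I - {i}. \<nu> j * star (\<nu> j))"
      using finite_I i by (simp add: sum_diff1)
    moreover have "cstar_positive (\<Sum>j\<in>I - {i}. \<nu> j * star (\<nu> j))"
      by (intro cstar_positive_sum pos) auto
    ultimately have "cstar_positive (0 - \<nu> i * star (\<nu> i))"
      by (simp only: index c scaleR_zero_left)
    from cstar_positive_norm_mono[OF pos[OF i] this] have "norm (star (star (\<nu> i)) * star (\<nu> i)) = 0"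
      by (simp add: star_star)
    then show ?thesis
      by (simp add: norm_star_mult norm_star)
  qed
  then have "(\<Sum>i\<in>I. \<nu> i * E (star (\<nu> i) * 1)) = 0"
    by simp
  then show False
    using basis[of 1] A_simps by simp
qed

section \<open>The coalgebra\<close>

theorem proposition3p2:
  fixes B A A1 A2 V :: "'a::cstar_algebra set"
    and E0 E1 E2 F :: "'a \<Rightarrow> 'a"
    and e1 e2 :: 'a
    and n :: nat and lam :: "nat \<Rightarrow> 'a"
    and \<tau> :: real
    and ip :: "'a \<Rightarrow> 'a \<Rightarrow> complex"
  assumes "cstar_subalgebra B" and "cstar_subalgebra A" and "B \<subseteq> A"
    and "simple_cstar B" and "simple_cstar A"
    and "minimal_expectation B A E0"
    and "quasi_basis A E0 n lam"
    and "\<tau> = inverse (watatani_index A E0)"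
    and "basic_construction B A E0 \<tau> A1 e1 E1"
    and "basic_construction A A1 E1 \<tau> A2 e2 E2"
    and "V = rel_commutant B A1"
    and "ip = trace_inner E0 E1"
    and "F = fourier \<tau> n lam e1 e2"
  shows "(\<forall>x\<in>V. \<exists>!t. t \<in> tensor_space V V \<and>
            (\<forall>y\<in>V. \<forall>z\<in>V. tensor_inner V ip t (tens V V y z)
               = complex_of_real (\<tau> powr (1/2)) * ip x (convolution V F y z))) \<and>
         (\<forall>(\<Delta> :: 'a \<Rightarrow> ('a, 'a) tensor) (\<epsilon> :: 'a \<Rightarrow> complex).
            (\<forall>x\<in>V. \<Delta> x \<in> tensor_space V V \<and>
               (\<forall>y\<in>V. \<forall>z\<in>V. tensor_inner V ip (\<Delta> x) (tens V V y z)
                  = complex_of_real (\<tau> powr (1/2)) * ip x (convolution V F y z))) \<and>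
            (\<forall>x\<in>V. \<epsilon> x = complex_of_real (inverse \<tau>) * ip e1 x)
            \<longrightarrow> coalgebra V \<Delta> \<epsilon>)"
proof -
  have "cond_expectation B A E0"
    using assms(6) by (simp add: minimal_expectation_def index_finite_def)
  then have ex: "expectation B A E0"
    using assms(1-3) by unfold_locales
  then interpret basic_step B A E0 \<tau> A1 e1 E1
    using assms(9) by (simp add: basic_step_def basic_step_axioms_def)
  have eb: "expectation_basis B A E0 {1..n} lam"
    by (rule expectation_basisI[OF ex assms(7)])
  have index: "(\<Sum>i=1..n. lam i * star (lam i)) = inverse \<tau> *\<^sub>R 1"
    using quasi_basis_sum_eq_index[OF ex assms(5,7)] by (simp add: assms(8))
  have "inverse \<tau> > 0"
    by (rule index_positive[OF eb index])
  then have \<tau>_pos: "\<tau> > 0"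
    by simp
  have "indexed_basic_step B A E0 \<tau> A1 e1 E1 {1..n} lam"
    unfolding indexed_basic_step_def pos_basic_step_def pos_basic_step_axioms_def
      indexed_basic_step_axioms_def
    by (intro conjI basic_step_axioms \<tau>_pos eb index)
  moreover have "pos_basic_step A A1 E1 \<tau> A2 e2 E2"
    using assms(10) \<tau>_pos dual.expectation_axioms
    by (simp add: pos_basic_step_def pos_basic_step_axioms_def basic_step_def basic_step_axioms_def)
  ultimately interpret T: jones_tower B A E0 \<tau> A1 e1 E1 n lam A2 e2 E2
    by (rule jones_tower.intro)
  have V: "V = T.V" and F: "F = T.F"
    by (simp_all add: assms(11,13) T.V_def T.F_def)
  obtain m \<mu> where "quasi_basis A1 E1 m \<mu>"
    using E1_index_finite by (auto simp: index_finite_def)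
  then have "expectation_basis A A1 E1 {1..m} \<mu>"
    by (rule expectation_basisI[OF dual.expectation_axioms])
  from T.s1.expectation_basis_comp[OF this]
  interpret S: scalar_expectation B A1 "\<lambda>x. E0 (E1 x)" "{1..m} \<times> {1..n}" "\<lambda>(j, i). \<mu> j * lam i"
    by (rule scalar_expectation.intro)
      (unfold_locales, rule simple_cstar_centre_scalar[OF assms(1,4)])
  have S: "S.V = V" "S.ip = ip"
    by (auto simp: assms(11,12) S.V_def S.ip_def S.tr_def trace_inner_def tower_trace_def fun_eq_iff)
  obtain N v where "hermitian_space_basis V ip N v"
    using S.orthonormal_basis_exists unfolding S by blast
  then interpret H: hermitian_space_basis V ip N v .
  let ?s = "\<tau> powr (1/2)"
  have conv: "bilinear_on V V (convolution V F)" "\<And>y z. y \<in> V \<Longrightarrow> z \<in> V \<Longrightarrow> convolution V F y z \<in> V"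
    using T.convolution_bilinear T.convolution_in by (simp_all add: V F)
  have bil: "bilinear_on V V (\<lambda>y z. complex_of_real ?s * ip x (convolution V F y z))" if "x \<in> V" for x
    using that conv
    by (intro bilinear_onI)
      (simp_all add: bilinear_on_left[OF conv(1), THEN linear_on_add]
        bilinear_on_left[OF conv(1), THEN linear_on_scale]
        bilinear_on_right[OF conv(1), THEN linear_on_add]
        bilinear_on_right[OF conv(1), THEN linear_on_scale]
        H.ip_add_right H.ip_scale_right algebra_simps scaleC_complex_def)
  have norm: "inverse \<tau> * ?s * ?s = 1"
    using \<tau>_pos by (simp add: powr_add[symmetric] mult.assoc)
  show ?thesis
  proof (intro conjI ballI allI impI)
    fix x assume "x \<in> V"
    then show "\<exists>!t. t \<in> tensor_space V V \<and> (\<forall>y\<in>V. \<forall>z\<in>V. tensor_inner V ip t (tens V V y z)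
               = complex_of_real ?s * ip x (convolution V F y z))"
      by (intro H.tensor_riesz bil)
  next
    fix \<Delta> :: "'a \<Rightarrow> ('a, 'a) tensor" and \<epsilon> :: "'a \<Rightarrow> complex"
    assume h: "(\<forall>x\<in>V. \<Delta> x \<in> tensor_space V V \<and>
               (\<forall>y\<in>V. \<forall>z\<in>V. tensor_inner V ip (\<Delta> x) (tens V V y z)
                  = complex_of_real ?s * ip x (convolution V F y z))) \<and>
            (\<forall>x\<in>V. \<epsilon> x = complex_of_real (inverse \<tau>) * ip e1 x)"
    show "coalgebra V \<Delta> \<epsilon>"
    proof (rule H.coalgebra_of_dual_algebra[OF conv(1), where u = e1 and r = ?s and s = ?s and q = "inverse \<tau>"])
      show "convolution V F (convolution V F x y) z = convolution V F x (convolution V F y z)"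
        if "x \<in> V" "y \<in> V" "z \<in> V" for x y z
        using that T.convolution_assoc by (simp add: V F)
      show "e1 \<in> V"
        by (simp add: V T.e1_V)
      show "convolution V F e1 x = complex_of_real ?s *\<^sub>C x" "convolution V F x e1 = complex_of_real ?s *\<^sub>C x"
        if "x \<in> V" for x
        using that T.convolution_e1 by (simp_all add: V F)
    qed (use h conv norm in auto)
  qed
qed

end
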